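(* Let $n\ge2$, $B_1$ the open unit ball of $\mathbb R^n$, and $\alpha\in\mathbb R$ with $|3\alpha+4+n|\le2\sqrt{n^2-n+1}$. Then for every $u\in C_c^2(B_1\setminus\{0\})$, $$\|\Delta u\|_\alpha^2\ \ge\ \frac{(n+\alpha)^2}{4}\|\nabla u\|_{\alpha+2}^2+\frac{(n-4-\alpha)^2}{16}\big\|(\ln|x|)^{-1}u\big\|_{\alpha+4}^2+\frac9{16}\big\|(\ln|x|)^{-2}u\big\|_{\alpha+4}^2 .$$
   Context: For $\beta\in\mathbb R$ and $g$ (scalar or vector valued) continuous with compact support in $\mathbb R^n\setminus\{0\}$, $\|g\|_\beta^2=\int_{\mathbb R^n}|g(x)|^2|x|^{-\beta}\,dx$. *)

theory Defs
  imports "HOL-Analysis.Analysis"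
begin

definition pderiv_dir :: "(real^'n \<Rightarrow> real) \<Rightarrow> 'n \<Rightarrow> real^'n \<Rightarrow> real" where
  "pderiv_dir u i x = frechet_derivative u (at x) (axis i 1)"

definition grad :: "(real^'n \<Rightarrow> real) \<Rightarrow> real^'n \<Rightarrow> real^'n" where
  "grad u x = (\<chi> i. pderiv_dir u i x)"

definition laplacian :: "(real^'n \<Rightarrow> real) \<Rightarrow> real^'n \<Rightarrow> real" where
  "laplacian u x = (\<Sum>i\<in>UNIV. pderiv_dir (pderiv_dir u i) i x)"

definition C2 :: "(real^'n \<Rightarrow> real) \<Rightarrow> bool" where
  "C2 u \<longleftrightarrow> (\<forall>x. u differentiable (at x))
     \<and> (\<forall>i x. pderiv_dir u i differentiable (at x))
     \<and> (\<forall>i j. continuous_on UNIV (pderiv_dir (pderiv_dir u i) j))"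

definition C2c :: "(real^'n) set \<Rightarrow> (real^'n \<Rightarrow> real) \<Rightarrow> bool" where
  "C2c \<Omega> u \<longleftrightarrow> C2 u \<and> compact (closure {x. u x \<noteq> 0}) \<and> closure {x. u x \<noteq> 0} \<subseteq> \<Omega>"

definition wnorm2 :: "real \<Rightarrow> (real^'n \<Rightarrow> 'a::real_normed_vector) \<Rightarrow> real" where
  "wnorm2 \<beta> g = (\<integral>x. (norm (g x))\<^sup>2 * norm x powr (-\<beta>) \<partial>lborel)"

end

theory Submission
  imports Defs "HOL-Probability.Distributions"
begin

text \<open>
  Write $E = x\cdot\nabla$, $L_{ij} = x_i\partial_j - x_j\partial_i$, $\Lambda = \frac12\sum_{i,j} L_{ij}^2$,
  $a = (\alpha+4-n)/2$ and $b = (n+\alpha)/2$, so that $|x|^2\Delta = E^2 + (n-2)E + \Lambda$. For the weight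
  $|x|^{-\alpha-4}$ the operator $E - a$ is antisymmetric and the $L_{ij}$ are antisymmetric and commute with it.
  With $p = (E-a)u$ and $s = (E-a)p$, expanding the square gives
  $$\|\Delta u\|_\alpha^2 - b^2\|\nabla u\|_{\alpha+2}^2
     = \|s\|^2 + a^2\|p\|^2 + 2\langle s,\Lambda u\rangle + \|\Lambda u\|^2 - b(2a+b)\sum_{i<j}\|L_{ij}u\|^2 .$$
  One has $\langle s,\Lambda u\rangle \ge 0$, and the hypothesis on $\alpha$ says precisely $b(2a+b)\le n-1$, where
  $n-1$ is the first nonzero eigenvalue of the sphere; one-dimensional Hardy inequalities
  in $\ln|x|$ bound $\|s\|^2$ and $\|p\|^2$ from below.

  Since $u$ is only $C^2$, derivatives are taken along the flows of dilations and rotations, and integration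
  by parts is invariance of the weighted measure under these flows. The spectral gap of the
  sphere is deduced from the Gaussian Poincare inequality, which in turn is averaged from a
  Wirtinger-type inequality along the curves $\cos\theta\,p + \sin\theta\,q$.
\<close>

subsection \<open>Invariance of Lebesgue measure\<close>

text \<open>The weight exponent is \<beta> = \<alpha> + 4 because the Laplacian gets multiplied by
  |x|^2. Dilation by e^t scales the weighted measure by e^((n - \<beta>) t), which makes E - a
  antisymmetric exactly for 2 a = \<beta> - n. Since n - 2 = b - a, one has E^2 + (n - 2) E = (E -
  a)^2 + (a + b)(E - a) + a b, and the constants of the theorem can be read off: b^2 is (n +
  \<alpha>)^2 / 4; the term with a^2 and p, followed by a Hardy inequality with constant 1/4, gives
  (n - 4 - \<alpha>)^2 / 16; the term with s, followed by Hardy inequalities with constants 1/4 and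
  9/4, gives 9/16. The sphere never appears as a measure space. A function on it is extended to R^n
  by homogeneity, and a Gaussian density makes the extension integrable. If p and q are independent
  Gaussian vectors, then cos t p + sin t q and its t-derivative have the same joint law. Hence
  invariance of Lebesgue measure under orthogonal maps, on R^n and on the product of two copies,
  serves both the angular integration by parts and the Poincare inequality.\<close>

lemma nn_integral_translate:
  fixes f :: "'a::euclidean_space \<Rightarrow> ennreal"
  assumes [measurable]: "f \<in> borel_measurable borel"
  shows "(\<integral>\<^sup>+x. f (x + y) \<partial>lborel) = (\<integral>\<^sup>+x. f x \<partial>lborel)"
proof -
  have "(\<integral>\<^sup>+x. f x \<partial>lborel) = (\<integral>\<^sup>+x. f x \<partial>(distr lborel borel ((+) y)))"
    by (simp only: lborel_distr_plus)
  also have "\<dots> = (\<integral>\<^sup>+x. f (y + x) \<partial>lborel)"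
    by (subst nn_integral_distr) auto
  finally show ?thesis by (simp add: add.commute)
qed

lemma nn_integral_dilate:
  fixes f :: "'a::euclidean_space \<Rightarrow> ennreal"
  assumes c: "c > 0" and [measurable]: "f \<in> borel_measurable borel"
  shows "(\<integral>\<^sup>+x. f x \<partial>lborel) = (\<integral>\<^sup>+x. ennreal (c ^ DIM('a)) * f (c *\<^sub>R x) \<partial>lborel)"
  using c by (subst lborel_affine[of c 0]) (auto simp: nn_integral_density nn_integral_distr nn_integral_cmult)

text \<open>Uniqueness of Haar measure, specialised: integrating $f(Tx+y)g(y)$ in both orders
  compares the image of Lebesgue measure under $T$ with Lebesgue measure itself, and the unit
  ball fixes the constant.\<close>

lemma nn_integral_orthogonal:
  fixes f :: "'a::euclidean_space \<Rightarrow> ennreal" and T :: "'a \<Rightarrow> 'a"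
  assumes f[measurable]: "f \<in> borel_measurable borel" and T: "orthogonal_transformation T"
  shows "(\<integral>\<^sup>+x. f (T x) \<partial>lborel) = (\<integral>\<^sup>+x. f x \<partial>lborel)"
proof -
  have lin: "linear T" using T by (simp add: orthogonal_transformation)
  have nT: "norm (T x) = norm x" for x using T by (simp add: orthogonal_transformation)
  have [measurable]: "T \<in> borel_measurable borel"
    using lin by (intro borel_measurable_continuous_onI linear_continuous_on) (simp add: linear_linear)
  obtain S where S: "\<And>y. T (S y) = y"
    using orthogonal_transformation_surj[OF T] by (metis surjD)
  have shift: "(\<integral>\<^sup>+x. h (T x + y) \<partial>lborel) = (\<integral>\<^sup>+x. h (T x) \<partial>lborel)"
    if [measurable]: "h \<in> borel_measurable borel" for h :: "'a \<Rightarrow> ennreal" and y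
  proof -
    have "(\<integral>\<^sup>+x. h (T x + y) \<partial>lborel) = (\<integral>\<^sup>+x. (\<lambda>x. h (T x)) (x + S y) \<partial>lborel)"
      by (simp add: linear_add[OF lin] S)
    also have "\<dots> = (\<integral>\<^sup>+x. h (T x) \<partial>lborel)"
      by (rule nn_integral_translate) measurable
    finally show ?thesis .
  qed
  define g :: "'a \<Rightarrow> ennreal" where "g = indicator (ball 0 1)"
  have [measurable]: "g \<in> borel_measurable borel" unfolding g_def by (intro borel_measurable_indicator) simp
  have g1: "(\<integral>\<^sup>+x. g x \<partial>lborel) = emeasure lborel (ball (0::'a) 1)"
    unfolding g_def by (subst nn_integral_indicator) auto
  have fin: "emeasure lborel (ball (0::'a) 1) \<noteq> \<infinity>" 
    using emeasure_lborel_ball_finite[of "0::'a" 1] by simp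
  have pos: "emeasure lborel (ball (0::'a) 1) \<noteq> 0"
    using content_ball_pos[of 1 "0::'a"] by (auto simp: measure_def)
  have "(\<integral>\<^sup>+x. f (T x) \<partial>lborel) * (\<integral>\<^sup>+x. g x \<partial>lborel)
    = (\<integral>\<^sup>+y. (\<integral>\<^sup>+x. f (T x + y) * g y \<partial>lborel) \<partial>lborel)"
    by (simp add: nn_integral_multc shift nn_integral_cmult)
  also have "\<dots> = (\<integral>\<^sup>+x. (\<integral>\<^sup>+y. f (T x + y) * g y \<partial>lborel) \<partial>lborel)"
    by (rule lborel_pair.Fubini') measurable
  also have "\<dots> = (\<integral>\<^sup>+x. (\<integral>\<^sup>+y. f y * g (y - T x) \<partial>lborel) \<partial>lborel)"
  proof (rule nn_integral_cong)
    fix x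
    have "(\<integral>\<^sup>+y. f (T x + y) * g y \<partial>lborel) = (\<integral>\<^sup>+y. (\<lambda>y. f y * g (y - T x)) (y + T x) \<partial>lborel)"
      by (simp add: add.commute)
    also have "\<dots> = (\<integral>\<^sup>+y. f y * g (y - T x) \<partial>lborel)"
      by (rule nn_integral_translate) measurable
    finally show "(\<integral>\<^sup>+y. f (T x + y) * g y \<partial>lborel) = (\<integral>\<^sup>+y. f y * g (y - T x) \<partial>lborel)" .
  qed
  also have "\<dots> = (\<integral>\<^sup>+y. (\<integral>\<^sup>+x. f y * g (y - T x) \<partial>lborel) \<partial>lborel)"
    by (rule lborel_pair.Fubini') measurable
  also have "\<dots> = (\<integral>\<^sup>+y. f y * (\<integral>\<^sup>+x. g (T x) \<partial>lborel) \<partial>lborel)"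
  proof (rule nn_integral_cong)
    fix y
    \<comment> \<open>The unit ball is symmetric, so \<open>g\<close> is even; this brings the inner
      integral to the form from which \<open>shift\<close> removes \<open>- y\<close>.\<close>
    have "g (y - T x) = g (T x + - y)" for x
      by (simp add: g_def indicator_def norm_minus_commute)
    then show "(\<integral>\<^sup>+x. f y * g (y - T x) \<partial>lborel) = f y * (\<integral>\<^sup>+x. g (T x) \<partial>lborel)"
      using shift[of g "-y"] by (simp add: nn_integral_cmult)
  qed
  also have "\<dots> = (\<integral>\<^sup>+x. f x \<partial>lborel) * (\<integral>\<^sup>+x. g x \<partial>lborel)"
  proof -
    have "(\<integral>\<^sup>+x. g (T x) \<partial>lborel) = (\<integral>\<^sup>+x. g x \<partial>lborel)"
      by (rule nn_integral_cong) (simp add: g_def indicator_def nT)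
    then show ?thesis by (simp add: nn_integral_multc)
  qed
  finally have eq: "(\<integral>\<^sup>+x. f (T x) \<partial>lborel) * emeasure lborel (ball (0::'a) 1)
     = (\<integral>\<^sup>+x. f x \<partial>lborel) * emeasure lborel (ball (0::'a) 1)" by (simp only: g1)
  show ?thesis
    using arg_cong[OF eq, of "\<lambda>t. t / emeasure lborel (ball (0::'a) 1)"] fin pos
    by (simp add: ennreal_mult_divide_eq)
qed

subsection \<open>A periodic inequality in one variable\<close>

text \<open>Centering at the midpoint and completing the square with $\tan$ instead of $\cot$ avoids singular
  boundary terms, at the price of the strict inequality $kh < \pi$.\<close>

lemma wirtinger_zero_ends_aux:
  fixes F f :: "real \<Rightarrow> real"
  assumes F: "\<And>x. (F has_real_derivative f x) (at x)" and f: "continuous_on UNIV f"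
    and z: "F c = 0" "F (c + h) = 0" and k: "0 < k" "k * h < pi" and h: "h > 0"
  shows "k\<^sup>2 * integral {c..c+h} (\<lambda>x. (F x)\<^sup>2) \<le> integral {c..c+h} (\<lambda>x. (f x)\<^sup>2)"
proof -
  define m where "m = c + h/2"
  define T where "T x = tan (k * (x - m))" for x
  have cosnz: "cos (k * (x - m)) > 0" if "x \<in> {c..c+h}" for x
  proof (rule cos_gt_zero_pi)
    have "\<bar>x - m\<bar> \<le> h / 2" using that by (auto simp: m_def abs_le_iff field_simps)
    then have "k * \<bar>x - m\<bar> \<le> k * (h / 2)" using k by (intro mult_left_mono) auto
    also have "\<dots> < pi / 2" using k by simp
    finally have "\<bar>k * (x - m)\<bar> < pi / 2" using k by (simp add: abs_mult)
    then show "- (pi / 2) < k * (x - m)" "k * (x - m) < pi / 2" by (auto simp: abs_less_iff)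
  qed
  have contF: "continuous_on S F" for S
    using F by (meson DERIV_isCont continuous_at_imp_continuous_on)
  have contf: "continuous_on S f" for S using f continuous_on_subset by blast
  have dT: "((\<lambda>x. - k * T x * (F x)\<^sup>2) has_vector_derivative
      ((f x)\<^sup>2 - k\<^sup>2 * (F x)\<^sup>2 - (f x + k * T x * F x)\<^sup>2)) (at x within {c..c+h})"
    if x: "x \<in> {c..c+h}" for x
  proof -
    have c: "cos (k * (x - m)) \<noteq> 0" using cosnz[OF x] by simp
    have sec: "inverse ((cos (k * (x - m)))\<^sup>2) = 1 + (T x)\<^sup>2"
      unfolding T_def using tan_sec[OF c] by (simp add: power_inverse)
    have "((\<lambda>x. - k * T x * (F x)\<^sup>2) has_real_derivative
      - k * (inverse ((cos (k * (x - m)))\<^sup>2) * k) * (F x)\<^sup>2 - k * T x * (2 * F x * f x)) (at x)"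
      unfolding T_def using c
      by (auto intro!: derivative_eq_intros F simp: algebra_simps)
    then have "((\<lambda>x. - k * T x * (F x)\<^sup>2) has_real_derivative
       ((f x)\<^sup>2 - k\<^sup>2 * (F x)\<^sup>2 - (f x + k * T x * F x)\<^sup>2)) (at x)"
      unfolding sec by (rule DERIV_cong) (simp add: algebra_simps power2_eq_square)
    then show ?thesis
      using has_field_derivative_at_within has_real_derivative_iff_has_vector_derivative by blast
  qed
  have "((\<lambda>x. (f x)\<^sup>2 - k\<^sup>2 * (F x)\<^sup>2 - (f x + k * T x * F x)\<^sup>2) has_integral
     (- k * T (c+h) * (F (c+h))\<^sup>2) - (- k * T c * (F c)\<^sup>2)) {c..c+h}"
    using h dT by (intro fundamental_theorem_of_calculus) auto
  then have hi0: "((\<lambda>x. (f x)\<^sup>2 - k\<^sup>2 * (F x)\<^sup>2 - (f x + k * T x * F x)\<^sup>2) has_integral 0) {c..c+h}"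
    using z by simp
  have i1: "(\<lambda>x. (f x)\<^sup>2) integrable_on {c..c+h}" and i2: "(\<lambda>x. k\<^sup>2 * (F x)\<^sup>2) integrable_on {c..c+h}"
    by (auto intro!: integrable_continuous_interval continuous_intros contf contF)
  have "0 \<le> integral {c..c+h} (\<lambda>x. (f x)\<^sup>2 - k\<^sup>2 * (F x)\<^sup>2)"
    using hi0 i1 i2
    by (intro has_integral_le[OF hi0 integrable_integral]) (auto intro!: integrable_diff)
  then show ?thesis using i1 i2 by (simp add: integral_diff)
qed

text \<open>Both sides are continuous in k, so letting k increase to pi / h reaches the sharp
  constant that the strict inequality k h < pi excludes.\<close>

lemma wirtinger_zero_ends:
  fixes F f :: "real \<Rightarrow> real"
  assumes F: "\<And>x. (F has_real_derivative f x) (at x)" and f: "continuous_on UNIV f"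
    and z: "F c = 0" "F (c + h) = 0" and h: "h > 0"
  shows "(pi / h)\<^sup>2 * integral {c..c+h} (\<lambda>x. (F x)\<^sup>2) \<le> integral {c..c+h} (\<lambda>x. (f x)\<^sup>2)"
proof (rule tendsto_upperbound)
  show "((\<lambda>k. k\<^sup>2 * integral {c..c+h} (\<lambda>x. (F x)\<^sup>2)) \<longlongrightarrow> (pi / h)\<^sup>2 * integral {c..c+h} (\<lambda>x. (F x)\<^sup>2)) (at_left (pi/h))"
    by (intro tendsto_intros)
  have "\<forall>\<^sub>F k in at_left (pi/h). k \<in> {0<..<pi/h}"
    using h by (intro eventually_at_leftI[of 0]) auto
  then show "\<forall>\<^sub>F k in at_left (pi / h). k\<^sup>2 * integral {c..c + h} (\<lambda>x. (F x)\<^sup>2) \<le> integral {c..c + h} (\<lambda>x. (f x)\<^sup>2)"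
    by (eventually_elim) (use h in \<open>auto intro!: wirtinger_zero_ends_aux F f z simp: field_simps\<close>)
qed auto

text \<open>The integral over the window from x to x + h has derivative g (x + h) - g x = 0 in
  x.\<close>

lemma integral_periodic_shift:
  fixes g :: "real \<Rightarrow> real"
  assumes g: "continuous_on UNIV g" and per: "\<And>x. g (x + h) = g x" and h: "h > 0"
  shows "integral {c..c+h} g = integral {0..h} g"
proof -
  have io: "g integrable_on {a..b}" for a b
    using g by (intro integrable_continuous_interval continuous_on_subset[OF g]) auto
  define H where "H x = integral {x..x+h} g" for x
  have dH: "(H has_real_derivative 0) (at x)" for x
  proof -
    \<comment> \<open>The antiderivative starts at x - 1 so that x and its neighbours are interior
      points of the interval on which it is differentiated.\<close>
    define A where "A y = integral {x - 1..y} g" for y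
    have dA: "(A has_real_derivative g y) (at y)" if "y > x - 1" for y
    proof -
      have "(A has_vector_derivative g y) (at y within {x-1..y+1})"
        unfolding A_def using that
        by (intro integral_has_vector_derivative continuous_on_subset[OF g]) auto
      then show ?thesis using that at_within_Icc_at[of "x-1" y "y+1"]
        by (simp add: has_real_derivative_iff_has_vector_derivative)
    qed
    have "((\<lambda>y. A (y + h) - A y) has_real_derivative g (x + h) - g x) (at x)"
      using h by (intro DERIV_diff) (auto simp: DERIV_shift[symmetric] intro!: dA)
    then have "((\<lambda>y. A (y + h) - A y) has_real_derivative 0) (at x)" by (simp add: per)
    moreover have "\<forall>\<^sub>F y in nhds x. H y = A (y + h) - A y"
    proof -
      have "\<forall>\<^sub>F y in nhds x. y \<in> {x-1<..}" by (intro eventually_nhds_in_open) auto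
      then show ?thesis
      proof eventually_elim
        case (elim y)
        then show ?case unfolding A_def H_def
          using Henstock_Kurzweil_Integration.integral_combine[of "x-1" y "y+h" g] io h by auto
      qed
    qed
    ultimately show ?thesis
      by (simp cong: DERIV_cong_ev)
  qed
  have "H c = H 0" by (rule DERIV_isconst_all) (use dH in auto)
  then show ?thesis unfolding H_def by simp
qed

text \<open>Antiperiodicity gives F a zero c by the intermediate value theorem, and c + h is then a
  zero as well. Both squares have period h, so the inequality on the window from c to c + h is the
  one on the window from 0 to h. The constant belongs to the lowest antiperiodic frequency pi /
  h.\<close>

lemma wirtinger_antiperiodic:
  fixes F f :: "real \<Rightarrow> real"
  assumes F: "\<And>x. (F has_real_derivative f x) (at x)" and f: "continuous_on UNIV f"
    and anti: "\<And>x. F (x + h) = - F x" and h: "h > 0"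
  shows "(pi / h)\<^sup>2 * integral {0..h} (\<lambda>x. (F x)\<^sup>2) \<le> integral {0..h} (\<lambda>x. (f x)\<^sup>2)"
proof -
  have contF: "continuous_on S F" for S
    using F by (meson DERIV_isCont continuous_at_imp_continuous_on)
  have antif: "f (x + h) = - f x" for x
  proof -
    have "((\<lambda>x. F (x + h)) has_real_derivative f (x + h)) (at x)"
      using F by (simp add: DERIV_shift[symmetric])
    moreover have "((\<lambda>x. F (x + h)) has_real_derivative - f x) (at x)"
      unfolding anti by (auto intro!: derivative_eq_intros F)
    ultimately show ?thesis using DERIV_unique by fastforce
  qed
  have "\<exists>c. F c = 0"
  proof -
    have *: "F h = - F 0" using anti[of 0] by simp
    show ?thesis
    proof (cases "F 0 \<le> 0")
      case True
      then show ?thesis using IVT'[of F 0 0 h] * h contF by auto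
    next
      case False
      then show ?thesis using IVT2'[of F h 0 0] * h contF by auto
    qed
  qed
  then obtain c where c: "F c = 0" by auto
  have "integral {c..c+h} (\<lambda>x. (F x)\<^sup>2) = integral {0..h} (\<lambda>x. (F x)\<^sup>2)"
    "integral {c..c+h} (\<lambda>x. (f x)\<^sup>2) = integral {0..h} (\<lambda>x. (f x)\<^sup>2)"
    by (auto intro!: integral_periodic_shift continuous_intros contF f h simp: anti antif)
  then show ?thesis
    using wirtinger_zero_ends[OF F f c _ h] anti c by simp
qed


lemma integral_periodic_double:
  fixes g :: "real \<Rightarrow> real"
  assumes g: "continuous_on UNIV g" and per: "\<And>x. g (x + h) = g x" and h: "h > 0"
  shows "integral {0..2*h} g = 2 * integral {0..h} g"
proof -
  have "integral {0..h} g + integral {h..2*h} g = integral {0..2*h} g"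
    using h by (intro Henstock_Kurzweil_Integration.integral_combine integrable_continuous_interval
        continuous_on_subset[OF g]) auto
  moreover have "integral {h..h+h} g = integral {0..h} g"
    by (rule integral_periodic_shift[OF g per h])
  ultimately show ?thesis by simp
qed

lemma integral_periodic_translate:
  fixes g :: "real \<Rightarrow> real"
  assumes g: "continuous_on UNIV g" and per: "\<And>x. g (x + h) = g x" and h: "h > 0"
  shows "integral {0..h} (\<lambda>x. g (x + c)) = integral {0..h} g"
proof -
  have "integral {0..h} (\<lambda>x. g (x + c)) = integral {0+c..h+c} g"
    using integral_shift[of 0 c h g] continuous_on_subset[OF g] by (simp add: o_def)
  also have "\<dots> = integral {0..h} g"
    using integral_periodic_shift[OF g per h, of c] by (simp add: add.commute)
  finally show ?thesis .
qed

text \<open>In Fourier coefficients this is $2 - 2\cos(k\pi/2) \le 2k^2$. It is proved by splitting $F$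
  into the parts $A$ and $B$ that are antiperiodic under shifts by $\pi$ and $\pi/2$.\<close>

lemma integral_quarter_shift_le:
  fixes F f :: "real \<Rightarrow> real"
  assumes F: "\<And>x. (F has_real_derivative f x) (at x)" and f: "continuous_on UNIV f"
    and per: "\<And>x. F (x + 2 * pi) = F x"
  shows "integral {0..2*pi} (\<lambda>x. (F (x + pi/2) - F x)\<^sup>2) \<le> 2 * integral {0..2*pi} (\<lambda>x. (f x)\<^sup>2)"
proof -
  have contF: "continuous_on UNIV F"
    using F by (meson DERIV_isCont continuous_at_imp_continuous_on)
  have perf: "f (x + 2 * pi) = f x" for x
  proof -
    have "((\<lambda>x. F (x + 2*pi)) has_real_derivative f (x + 2*pi)) (at x)"
      using F by (simp add: DERIV_shift[symmetric])
    then show ?thesis unfolding per using DERIV_unique F by blast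
  qed
  have cF: "continuous_on S (\<lambda>x. F (x + c))" for c S
    by (rule continuous_on_compose2[OF contF]) (auto intro!: continuous_intros)
  have cf: "continuous_on S (\<lambda>x. f (x + c))" for c S
    by (rule continuous_on_compose2[OF f]) (auto intro!: continuous_intros)
  have cF0: "continuous_on S F" and cf0: "continuous_on S f" for S
    using contF f continuous_on_subset by blast+
  note [continuous_intros] = cF cf cF0 cf0
  have perF': "F (x + c + 2*pi) = F (x + c)" "F (x + 2*pi + c) = F (x + c)" for x c
    using per[of "x+c"] by (simp_all add: algebra_simps)
  have perf': "f (x + c + 2*pi) = f (x + c)" "f (x + 2*pi + c) = f (x + c)" for x c
    using perf[of "x+c"] by (simp_all add: algebra_simps)
  define S where "S g = integral {0..2*pi} g" for g :: "real \<Rightarrow> real"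
  have Sadd: "S (\<lambda>x. g x + h x) = S g + S h"
    if "continuous_on UNIV g" "continuous_on UNIV h" for g h
    unfolding S_def using that
    by (intro integral_add integrable_continuous_interval) (auto intro: continuous_on_subset)
  have Scm: "S (\<lambda>x. c * g x) = c * S g" for c g
    unfolding S_def by simp
  have Sshift: "S (\<lambda>x. g (x + c)) = S g" if "continuous_on UNIV g" "\<And>x. g (x + 2*pi) = g x" for g c
    unfolding S_def using that by (intro integral_periodic_translate) auto
  have Smono: "S g \<le> S h" if "continuous_on UNIV g" "continuous_on UNIV h" "\<And>x. g x \<le> h x" for g h
    unfolding S_def using that
    by (intro integral_le integrable_continuous_interval) (auto intro: continuous_on_subset)
  \<comment> \<open>Up to factors 2 and 4, \<open>A\<close> keeps the odd frequencies k and
    \<open>B\<close> those with k = 2 mod 4; multiples of 4 are invisible to a quarter shift. The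
    lowest frequencies are 1 and 2, hence the constants 1 and 4 in \<open>WA\<close> and
    \<open>WB\<close>. The part B / 4 changes sign under a quarter shift, so it contributes - B / 2
    to the difference.\<close>
  define A where "A x = F x - F (x + pi)" for x
  define B where "B x = F x + F (x + pi) - F (x + pi/2) - F (x + 3*pi/2)" for x
  define a where "a x = f x - f (x + pi)" for x
  define b where "b x = f x + f (x + pi) - f (x + pi/2) - f (x + 3*pi/2)" for x
  have cA: "continuous_on UNIV A" and cB: "continuous_on UNIV B"
   and ca: "continuous_on UNIV a" and cb: "continuous_on UNIV b"
    unfolding A_def B_def a_def b_def by (intro continuous_intros)+
  have cA': "continuous_on UNIV (\<lambda>x. A (x + c))" for c
    by (rule continuous_on_compose2[OF cA]) (auto intro!: continuous_intros)
  note [continuous_intros] = cA cB ca cb cA'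
  have dF: "((\<lambda>x. F (x + c)) has_real_derivative f (x + c)) (at x)" for x c
    using F by (simp add: DERIV_shift[symmetric])
  have dA: "(A has_real_derivative a x) (at x)" for x
    unfolding A_def a_def by (intro derivative_intros F dF)
  have dB: "(B has_real_derivative b x) (at x)" for x
    unfolding B_def b_def by (intro derivative_intros F dF)
  have antiA: "A (x + pi) = - A x" for x
    using per[of x] by (simp add: A_def add.assoc)
  have antia: "a (x + pi) = - a x" for x
    using perf[of x] by (simp add: a_def add.assoc)
  have perA: "A (x + 2*pi) = A x" "A (x + 2*pi + pi/2) = A (x + pi/2)" for x
    using perF'[of x pi] perF'[of x "pi/2"] perF'[of "x + pi/2" pi] per[of x]
    by (simp_all add: A_def add_ac)
  have e: "x + pi/2 + pi/2 = x + pi" "x + pi/2 + pi = x + 3*pi/2" "x + pi/2 + 3*pi/2 = x + 2*pi" for x :: real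
    by simp_all
  have antiB: "B (x + pi/2) = - B x" for x
    using per[of x] by (simp add: B_def e del: divide_const_simps)
  have antib: "b (x + pi/2) = - b x" for x
    using perf[of x] by (simp add: b_def e del: divide_const_simps)
  have WA: "S (\<lambda>x. (A x)\<^sup>2) \<le> S (\<lambda>x. (a x)\<^sup>2)"
  proof -
    have "S (\<lambda>x. (A x)\<^sup>2) = 2 * integral {0..pi} (\<lambda>x. (A x)\<^sup>2)"
      "S (\<lambda>x. (a x)\<^sup>2) = 2 * integral {0..pi} (\<lambda>x. (a x)\<^sup>2)"
      unfolding S_def by (rule integral_periodic_double; auto intro!: continuous_intros simp: antiA antia)+
    then show ?thesis using wirtinger_antiperiodic[OF dA ca antiA] by simp
  qed
  have WB: "4 * S (\<lambda>x. (B x)\<^sup>2) \<le> S (\<lambda>x. (b x)\<^sup>2)"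
  proof -
    have quad: "S g = 4 * integral {0..pi/2} g" if "continuous_on UNIV g" "\<And>x. g (x + pi/2) = g x" for g
    proof -
      have "g (x + pi) = g x" for x using that(2)[of "x + pi/2"] that(2)[of x] by (simp add: e del: divide_const_simps)
      then have "S g = 2 * integral {0..pi} g"
        unfolding S_def using that by (intro integral_periodic_double) auto
      also have "integral {0..pi} g = 2 * integral {0..pi/2} g"
        using integral_periodic_double[of g "pi/2"] that by simp
      finally show ?thesis by simp
    qed
    have "S (\<lambda>x. (B x)\<^sup>2) = 4 * integral {0..pi/2} (\<lambda>x. (B x)\<^sup>2)"
      "S (\<lambda>x. (b x)\<^sup>2) = 4 * integral {0..pi/2} (\<lambda>x. (b x)\<^sup>2)"
      by (rule quad; auto intro!: continuous_intros simp: antiB antib)+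
    then show ?thesis using wirtinger_antiperiodic[OF dB cb antiB] by simp
  qed
  \<comment> \<open>A quarter shift maps the product A(x) A(x + pi/2) to its negative, because A(x +
    pi) = - A(x).\<close>
  have AA1: "S (\<lambda>x. A x * A (x + pi/2)) = 0"
  proof -
    have "S (\<lambda>x. A x * A (x + pi/2)) = S (\<lambda>x. A (x + pi/2) * A (x + pi/2 + pi/2))"
      by (rule Sshift[symmetric, of "\<lambda>x. A x * A (x + pi/2)" "pi/2"])
        (intro continuous_intros, simp only: perA)
    also have "\<dots> = S (\<lambda>x. (-1) * (A x * A (x + pi/2)))"
      by (simp add: e antiA mult.commute del: divide_const_simps)
    also have "\<dots> = - S (\<lambda>x. A x * A (x + pi/2))" by (subst Scm) simp
    finally show ?thesis by simp
  qed
  have SA1: "S (\<lambda>x. (A (x + pi/2))\<^sup>2) = S (\<lambda>x. (A x)\<^sup>2)"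
    by (rule Sshift[of "\<lambda>x. (A x)\<^sup>2"]) (intro continuous_intros, simp only: perA)
  \<comment> \<open>A shift by pi reverses the sign of the factor built from \<open>A\<close> and
    fixes \<open>B\<close>.\<close>
  have cross: "S (\<lambda>x. (A x - A (x + pi/2)) * B x) = 0"
  proof -
    have B2: "B (x + pi) = B x" for x
      using antiB[of "x + pi/2"] antiB[of x] by (simp add: e del: divide_const_simps)
    have A3: "A (x + pi + pi/2) = - A (x + pi/2)" for x
      using antiA[of "x + pi/2"] by (simp add: algebra_simps)
    have p2: "x + 2*pi = x + pi + pi" "x + 2*pi + pi/2 = x + pi + pi/2 + pi"for x :: real by simp_all
    have "S (\<lambda>x. (A x - A (x + pi/2)) * B x) = S (\<lambda>x. (A (x + pi) - A (x + pi + pi/2)) * B (x + pi))"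
      by (rule Sshift[symmetric, of "\<lambda>x. (A x - A (x + pi/2)) * B x" "pi"])
        (intro continuous_intros, simp only: p2 antiA A3 B2, simp)
    also have "\<dots> = S (\<lambda>x. (-1) * ((A x - A (x + pi/2)) * B x))"
      by (simp only: antiA A3 B2) (simp add: algebra_simps)
    also have "\<dots> = - S (\<lambda>x. (A x - A (x + pi/2)) * B x)" by (subst Scm) simp
    finally show ?thesis by simp
  qed
  have "S (\<lambda>x. (F (x + pi/2) - F x)\<^sup>2) = S (\<lambda>x. (1/4 * (A x)\<^sup>2 + 1/4 * (A (x + pi/2))\<^sup>2)
      + (- 1/2 * (A x * A (x + pi/2)) + (1/4 * (B x)\<^sup>2 + 1/2 * ((A x - A (x + pi/2)) * B x))))"
  proof (rule arg_cong[where f=S], rule ext)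
    fix x
    have "F (x + pi/2) - F x = - 1/2 * (A x - A (x + pi/2)) - 1/2 * B x"
      by (simp add: A_def B_def e del: divide_const_simps) (simp add: field_simps)
    moreover have "(- 1/2 * (s - t) - 1/2 * w)\<^sup>2 = (1/4 * s\<^sup>2 + 1/4 * t\<^sup>2)
      + (- 1/2 * (s * t) + (1/4 * w\<^sup>2 + 1/2 * ((s - t) * w)))" for s t w :: real
      by (simp add: power2_eq_square field_simps)
    ultimately show "(F (x + pi/2) - F x)\<^sup>2 = (1/4 * (A x)\<^sup>2 + 1/4 * (A (x + pi/2))\<^sup>2)
      + (- 1/2 * (A x * A (x + pi/2)) + (1/4 * (B x)\<^sup>2 + 1/2 * ((A x - A (x + pi/2)) * B x)))"
      by (simp only:)
  qed
  also have "\<dots> = 1/2 * S (\<lambda>x. (A x)\<^sup>2) + 1/4 * S (\<lambda>x. (B x)\<^sup>2)"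
  proof -
    have c: "continuous_on UNIV (\<lambda>x. 1/4 * (A x)\<^sup>2)" "continuous_on UNIV (\<lambda>x. 1/4 * (A (x + pi/2))\<^sup>2)"
      "continuous_on UNIV (\<lambda>x. - 1/2 * (A x * A (x + pi/2)))" "continuous_on UNIV (\<lambda>x. 1/4 * (B x)\<^sup>2)"
      "continuous_on UNIV (\<lambda>x. 1/2 * ((A x - A (x + pi/2)) * B x))"
      by (intro continuous_intros)+
    have "S (\<lambda>x. 1/4 * (A x)\<^sup>2) = 1/4 * S (\<lambda>x. (A x)\<^sup>2)"
      "S (\<lambda>x. 1/4 * (A (x + pi/2))\<^sup>2) = 1/4 * S (\<lambda>x. (A x)\<^sup>2)"
      "S (\<lambda>x. - 1/2 * (A x * A (x + pi/2))) = 0" "S (\<lambda>x. 1/4 * (B x)\<^sup>2) = 1/4 * S (\<lambda>x. (B x)\<^sup>2)"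
      "S (\<lambda>x. 1/2 * ((A x - A (x + pi/2)) * B x)) = 0"
      by (simp_all only: Scm SA1 AA1 cross mult_zero_right)
    then show ?thesis
      by (simp only: Sadd[OF continuous_on_add[OF c(1,2)] continuous_on_add[OF c(3) continuous_on_add[OF c(4,5)]]]
        Sadd[OF c(1,2)] Sadd[OF c(3) continuous_on_add[OF c(4,5)]] Sadd[OF c(4,5)])
  qed
  also have "\<dots> \<le> 1/2 * S (\<lambda>x. (a x)\<^sup>2) + 1/16 * S (\<lambda>x. (b x)\<^sup>2)"
    using WA WB by simp
  also have "S (\<lambda>x. (b x)\<^sup>2) \<le> 4 * S (\<lambda>x. (f x + f (x + pi))\<^sup>2)"
  proof -
    have "S (\<lambda>x. (b x)\<^sup>2) \<le> S (\<lambda>x. 2 * (f x + f (x + pi))\<^sup>2 + 2 * (f (x + pi/2) + f (x + 3*pi/2))\<^sup>2)"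
    proof (rule Smono)
      fix x
      define U where "U = f x + f (x + pi)"
      define V where "V = f (x + pi/2) + f (x + 3*pi/2)"
      have "b x = U - V" by (simp add: b_def U_def V_def)
      moreover have "(U - V)\<^sup>2 \<le> 2 * U\<^sup>2 + 2 * V\<^sup>2"
        using zero_le_power2[of "U + V"] by (simp add: power2_eq_square algebra_simps)
      ultimately show "(b x)\<^sup>2 \<le> 2 * (f x + f (x + pi))\<^sup>2 + 2 * (f (x + pi/2) + f (x + 3*pi/2))\<^sup>2"
        unfolding U_def V_def by simp
    qed (intro continuous_intros)+
    also have "\<dots> = 2 * S (\<lambda>x. (f x + f (x + pi))\<^sup>2) + 2 * S (\<lambda>x. (f (x + pi/2) + f (x + 3*pi/2))\<^sup>2)"
      by (subst Sadd, (intro continuous_intros)+) (simp add: Scm)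
    also have "S (\<lambda>x. (f (x + pi/2) + f (x + 3*pi/2))\<^sup>2) = S (\<lambda>x. (f x + f (x + pi))\<^sup>2)"
    proof -
      have "f (x + 2*pi + pi) = f (x + pi)" for x by (rule perf')
      then have "S (\<lambda>x. (f (x + pi/2) + f (x + pi/2 + pi))\<^sup>2) = S (\<lambda>x. (f x + f (x + pi))\<^sup>2)"
        by (intro Sshift[of "\<lambda>x. (f x + f (x + pi))\<^sup>2" "pi/2"] continuous_intros) (simp only: perf)
      then show ?thesis by (simp only: e)
    qed
    finally show ?thesis by simp
  qed
  \<comment> \<open>The coefficient 1/4 of the even part is weakened to 1/2, so that the
    parallelogram identity recombines both parts into f^2. The loss is confined to even frequencies;
    at k = 1 and k = -1 equality is kept.\<close>
  also have "1/2 * S (\<lambda>x. (a x)\<^sup>2) + 1/16 * (4 * S (\<lambda>x. (f x + f (x + pi))\<^sup>2))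
     \<le> 1/2 * (S (\<lambda>x. (a x)\<^sup>2) + S (\<lambda>x. (f x + f (x + pi))\<^sup>2))"
    using Smono[of "\<lambda>_. 0" "\<lambda>x. (f x + f (x + pi))\<^sup>2"]
    by (simp add: S_def continuous_intros)
  also have "S (\<lambda>x. (a x)\<^sup>2) + S (\<lambda>x. (f x + f (x + pi))\<^sup>2) = S (\<lambda>x. 2 * (f x)\<^sup>2 + 2 * (f (x + pi))\<^sup>2)"
    by (subst Sadd[symmetric], (intro continuous_intros)+)
      (simp add: a_def power2_eq_square algebra_simps)
  also have "\<dots> = 2 * S (\<lambda>x. (f x)\<^sup>2) + 2 * S (\<lambda>x. (f (x + pi))\<^sup>2)"
    by (subst Sadd, (intro continuous_intros)+) (simp add: Scm)
  also have "S (\<lambda>x. (f (x + pi))\<^sup>2) = S (\<lambda>x. (f x)\<^sup>2)"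
    by (rule Sshift[of "\<lambda>x. (f x)\<^sup>2"]) (auto intro!: continuous_intros simp: perf)
  finally show ?thesis by (simp add: S_def)
qed

subsection \<open>Derivatives along flows\<close>

definition annular :: "('a::real_normed_vector \<Rightarrow> real) \<Rightarrow> bool" where
  "annular f \<longleftrightarrow> (\<exists>d>0. \<exists>R. \<forall>x. f x \<noteq> 0 \<longrightarrow> d \<le> norm x \<and> norm x \<le> R)"

text \<open>A measurable rather than continuous class, because it has to contain the spherical mean
  \<open>m (norm x)\<close> of \<open>spherical_poincare\<close>, which is obtained only as a
  measurable function. Its members are integrable against every power of |x|.\<close>

definition bdd_annular :: "('a::euclidean_space \<Rightarrow> real) \<Rightarrow> bool" where
  "bdd_annular f \<longleftrightarrow> f \<in> borel_measurable borel \<and> (\<exists>B. \<forall>x. \<bar>f x\<bar> \<le> B) \<and> annular f"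

definition test_fun :: "('a::euclidean_space \<Rightarrow> real) \<Rightarrow> bool" where
  "test_fun f \<longleftrightarrow> continuous_on UNIV f \<and> annular f"

definition wint :: "real \<Rightarrow> ('a::euclidean_space \<Rightarrow> real) \<Rightarrow> real" where
  "wint \<beta> f = (\<integral>x. f x * norm x powr (-\<beta>) \<partial>lborel)"

lemma annular_mono: "annular f \<Longrightarrow> (\<And>x. g x \<noteq> 0 \<Longrightarrow> f x \<noteq> 0) \<Longrightarrow> annular g"
  unfolding annular_def by meson

lemma annular_add:
  assumes "annular f" "annular g" shows "annular (\<lambda>x. f x + g x)"
proof -
  from assms obtain d1 R1 d2 R2 where "d1 > 0" "d2 > 0"
    and 1: "\<And>x. f x \<noteq> 0 \<Longrightarrow> d1 \<le> norm x \<and> norm x \<le> R1"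
    and 2: "\<And>x. g x \<noteq> 0 \<Longrightarrow> d2 \<le> norm x \<and> norm x \<le> R2"
    unfolding annular_def by metis
  have "min d1 d2 \<le> norm x \<and> norm x \<le> max R1 R2" if "f x + g x \<noteq> 0" for x
  proof (cases "f x = 0")
    case True then show ?thesis using that 2[of x] by auto
  next
    case False then show ?thesis using 1[of x] by auto
  qed
  then show ?thesis unfolding annular_def using \<open>d1 > 0\<close> \<open>d2 > 0\<close>
    by (intro exI[of _ "min d1 d2"]) auto
qed

lemma annular_mult1: "annular f \<Longrightarrow> annular (\<lambda>x. f x * g x)"
  by (erule annular_mono) auto

lemma annular_mult2: "annular f \<Longrightarrow> annular (\<lambda>x. g x * f x)"
  by (erule annular_mono) auto

lemma test_fun_add: "test_fun f \<Longrightarrow> test_fun g \<Longrightarrow> test_fun (\<lambda>x. f x + g x)"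
  unfolding test_fun_def by (auto intro: continuous_on_add annular_add)

lemma test_fun_mult: "test_fun f \<Longrightarrow> test_fun g \<Longrightarrow> test_fun (\<lambda>x. f x * g x)"
  unfolding test_fun_def by (auto intro: continuous_on_mult annular_mult1)

lemma test_fun_cmult: "test_fun f \<Longrightarrow> test_fun (\<lambda>x. c * f x)"
  unfolding test_fun_def by (auto intro!: continuous_intros annular_mult2)

lemma test_fun_0: "test_fun (\<lambda>x. 0)"
  unfolding test_fun_def annular_def by (auto intro: exI[of _ 1])

lemma test_fun_diff: "test_fun f \<Longrightarrow> test_fun g \<Longrightarrow> test_fun (\<lambda>x. f x - g x)"
  using test_fun_add[of f "\<lambda>x. - 1 * g x"] test_fun_cmult[of g "-1"] by simp

lemma test_fun_power2: "test_fun f \<Longrightarrow> test_fun (\<lambda>x. (f x)\<^sup>2)"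
  by (simp add: power2_eq_square test_fun_mult)

lemma test_fun_sum: "(\<And>i. i \<in> A \<Longrightarrow> test_fun (f i)) \<Longrightarrow> test_fun (\<lambda>x. \<Sum>i\<in>A. f i x)"
  by (induction A rule: infinite_finite_induct) (auto intro: test_fun_0 test_fun_add)

lemma bdd_annular_add: "bdd_annular f \<Longrightarrow> bdd_annular g \<Longrightarrow> bdd_annular (\<lambda>x. f x + g x)"
  unfolding bdd_annular_def
proof (elim conjE exE, intro conjI)
  fix B C assume "\<forall>x. \<bar>f x\<bar> \<le> B" "\<forall>x. \<bar>g x\<bar> \<le> C"
  then show "\<exists>B. \<forall>x. \<bar>f x + g x\<bar> \<le> B"
    by (intro exI[of _ "B + C"] allI order_trans[OF abs_triangle_ineq]) (simp add: add_mono)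
qed (auto intro: annular_add)

lemma bdd_annular_mult_bounded:
  "bdd_annular f \<Longrightarrow> g \<in> borel_measurable borel \<Longrightarrow> (\<And>x. \<bar>g x\<bar> \<le> C) \<Longrightarrow> bdd_annular (\<lambda>x. g x * f x)"
  unfolding bdd_annular_def
proof (elim conjE exE, intro conjI)
  fix B assume "\<forall>x. \<bar>f x\<bar> \<le> B" "\<And>x. \<bar>g x\<bar> \<le> C"
  then show "\<exists>B. \<forall>x. \<bar>g x * f x\<bar> \<le> B"
    by (intro exI[of _ "C * B"]) (auto simp: abs_mult intro!: mult_mono order_trans[OF abs_ge_zero])
qed (auto intro: annular_mult2)

lemma bdd_annular_mult: "bdd_annular f \<Longrightarrow> bdd_annular g \<Longrightarrow> bdd_annular (\<lambda>x. f x * g x)"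
  using bdd_annular_mult_bounded[of g f] unfolding bdd_annular_def by blast

lemma bdd_annular_cmult: "bdd_annular f \<Longrightarrow> bdd_annular (\<lambda>x. c * f x)"
  by (rule bdd_annular_mult_bounded[of _ _ "\<bar>c\<bar>"]) auto

lemma bdd_annular_diff: "bdd_annular f \<Longrightarrow> bdd_annular g \<Longrightarrow> bdd_annular (\<lambda>x. f x - g x)"
  using bdd_annular_add[of f "\<lambda>x. - 1 * g x"] bdd_annular_cmult[of g "-1"] by simp

lemma bdd_annular_power2: "bdd_annular f \<Longrightarrow> bdd_annular (\<lambda>x. (f x)\<^sup>2)"
  by (simp add: power2_eq_square bdd_annular_mult)

lemma bdd_annular_sum: "(\<And>i. i \<in> A \<Longrightarrow> bdd_annular (f i)) \<Longrightarrow> bdd_annular (\<lambda>x. \<Sum>i\<in>A. f i x)"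
proof (induction A rule: infinite_finite_induct)
  case (insert i A) then show ?case by (simp add: bdd_annular_add)
qed (auto simp: bdd_annular_def annular_def intro: exI[of _ "1::real"])

lemma test_fun_bdd_annular:
  fixes f :: "'a::euclidean_space \<Rightarrow> real"
  assumes "test_fun f" shows "bdd_annular f"
proof -
  from assms obtain d R where c: "continuous_on UNIV f" and R: "\<And>x. f x \<noteq> 0 \<Longrightarrow> norm x \<le> R"
    unfolding test_fun_def annular_def by blast
  have "compact (f ` cball 0 R)"
    by (intro compact_continuous_image continuous_on_subset[OF c]) auto
  then obtain B where B: "\<And>x. x \<in> cball 0 R \<Longrightarrow> \<bar>f x\<bar> \<le> B"
    using compact_imp_bounded[of "f ` cball 0 R"] unfolding bounded_iff by (auto simp del: mem_cball mem_cball_0)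
  have "\<bar>f x\<bar> \<le> max B 0" for x
    using B[of x] R[of x] by (cases "f x = 0") auto
  then show ?thesis
    using assms borel_measurable_continuous_onI[OF c] unfolding bdd_annular_def test_fun_def by blast
qed

lemma powr_le_annulus:
  assumes "0 < d" "d \<le> r" "r \<le> R" shows "r powr \<beta> \<le> d powr \<beta> + R powr (\<beta>::real)"
proof (cases "\<beta> \<ge> 0")
  case True
  then have "r powr \<beta> \<le> R powr \<beta>" using assms by (intro powr_mono2) auto
  then show ?thesis by (simp add: add_increasing)
next
  case False
  then have "r powr \<beta> \<le> d powr \<beta>" using assms by (intro powr_mono2') auto
  then show ?thesis by (simp add: add_increasing2)
qed

lemma bdd_annular_bound:
  fixes f :: "'a::euclidean_space \<Rightarrow> real"
  assumes "bdd_annular f"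
  obtains C R where "C \<ge> 0" "\<And>x. \<bar>f x * norm x powr (-\<beta>)\<bar> \<le> C * indicator (cball 0 R) x"
proof -
  from assms obtain B d R where B: "\<And>x. \<bar>f x\<bar> \<le> B" and "d > 0"
    and R: "\<And>x. f x \<noteq> 0 \<Longrightarrow> d \<le> norm x \<and> norm x \<le> R"
    unfolding bdd_annular_def annular_def by blast
  have B0: "B \<ge> 0" using B[of 0] by linarith
  let ?C = "B * (d powr (-\<beta>) + R powr (-\<beta>))"
  show thesis
  proof
    show "?C \<ge> 0" using B0 by simp
    show "\<bar>f x * norm x powr (-\<beta>)\<bar> \<le> ?C * indicator (cball 0 R) x" for x
    proof (cases "f x = 0")
      case True then show ?thesis using B0 by simp
    next
      case False
      then have "norm x powr (-\<beta>) \<le> d powr (-\<beta>) + R powr (-\<beta>)"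
        using R[of x] \<open>d > 0\<close> by (intro powr_le_annulus) auto
      then show ?thesis using B[of x] R[OF False] B0
        by (simp add: abs_mult indicator_def mult_mono)
    qed
  qed
qed

lemma integrable_indicator_cball:
  "integrable lborel (\<lambda>x. C * indicator (cball (0::'a::euclidean_space) R) x :: real)"
  using emeasure_bounded_finite[OF bounded_cball, of "0::'a" R]
  by (intro integrable_mult_right integrable_real_indicator) auto

lemma bdd_annular_integrable:
  fixes f :: "'a::euclidean_space \<Rightarrow> real"
  assumes "bdd_annular f" shows "integrable lborel (\<lambda>x. f x * norm x powr (-\<beta>))"
proof -
  obtain C R where C: "C \<ge> 0" "\<And>x. \<bar>f x * norm x powr (-\<beta>)\<bar> \<le> C * indicator (cball 0 R) x"
    using bdd_annular_bound[OF assms] by blast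
  have [measurable]: "f \<in> borel_measurable borel" using assms by (simp add: bdd_annular_def)
  show ?thesis
  proof (rule Bochner_Integration.integrable_bound[OF integrable_indicator_cball[of C R]])
    show "AE x in lborel. norm (f x * norm x powr (-\<beta>)) \<le> norm (C * indicator (cball 0 R) x)"
      using C by (intro AE_I2) (simp add: abs_mult)
  qed measurable
qed

lemma wint_add: "bdd_annular f \<Longrightarrow> bdd_annular g \<Longrightarrow> wint \<beta> (\<lambda>x. f x + g x) = wint \<beta> f + wint \<beta> g"
  unfolding wint_def by (simp add: distrib_right bdd_annular_integrable)

lemma wint_diff: "bdd_annular f \<Longrightarrow> bdd_annular g \<Longrightarrow> wint \<beta> (\<lambda>x. f x - g x) = wint \<beta> f - wint \<beta> g"
  unfolding wint_def by (simp add: left_diff_distrib bdd_annular_integrable)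

lemma wint_cmult: "wint \<beta> (\<lambda>x. c * f x) = c * wint \<beta> f"
  unfolding wint_def by (simp add: mult.assoc)

lemma wint_nonneg: "(\<And>x. f x \<ge> 0) \<Longrightarrow> wint \<beta> f \<ge> 0"
  unfolding wint_def by (intro integral_nonneg_AE) auto

lemma wint_sum: "(\<And>i. i \<in> A \<Longrightarrow> bdd_annular (f i)) \<Longrightarrow> wint \<beta> (\<lambda>x. \<Sum>i\<in>A. f i x) = (\<Sum>i\<in>A. wint \<beta> (f i))"
  unfolding wint_def by (simp add: sum_distrib_right bdd_annular_integrable)

text \<open>Covers dilations (\<open>\<kappa>\<close> = 1) and rotations (\<open>\<kappa>\<close> =
  0) at once. The axiom \<open>flow_norm\<close> sends annuli to annuli, so composing with the flow
  preserves test functions.\<close>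

locale flow =
  fixes \<Phi> :: "real \<Rightarrow> 'a::euclidean_space \<Rightarrow> 'a" and \<kappa> :: real
  assumes flow_0: "\<Phi> 0 x = x"
    and flow_add: "\<Phi> (s + t) x = \<Phi> s (\<Phi> t x)"
    and flow_cont: "continuous_on UNIV (\<Phi> t)"
    and flow_norm: "norm (\<Phi> t x) = exp (\<kappa> * t) * norm x"
begin

text \<open>A relation rather than an operator, so that the regularity of both functions travels
  with it. The derivative is required only at t = 0; the group law carries it to every other time in
  \<open>flow_deriv_at\<close>.\<close>

definition flow_deriv :: "('a \<Rightarrow> real) \<Rightarrow> ('a \<Rightarrow> real) \<Rightarrow> bool" where
  "flow_deriv f g \<longleftrightarrow> test_fun f \<and> test_fun g \<and> (\<forall>x. ((\<lambda>t. f (\<Phi> t x)) has_real_derivative g x) (at 0))"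

lemma flow_deriv_at:
  assumes "flow_deriv f g" shows "((\<lambda>t. f (\<Phi> t x)) has_real_derivative g (\<Phi> s x)) (at s)"
proof -
  have "((\<lambda>t. f (\<Phi> t (\<Phi> s x))) has_real_derivative g (\<Phi> s x)) (at (s + - s))"
    using assms by (simp add: flow_deriv_def)
  then have "((\<lambda>t. f (\<Phi> (t + - s) (\<Phi> s x))) has_real_derivative g (\<Phi> s x)) (at s)"
    unfolding DERIV_shift .
  moreover have "\<Phi> (t + - s) (\<Phi> s x) = \<Phi> t x" for t using flow_add[of "t + - s" s x] by simp
  ultimately show ?thesis by simp
qed

lemma annular_flow:
  assumes "annular f" shows "annular (\<lambda>x. f (\<Phi> t x))"
proof -
  from assms obtain d R where "d > 0" and R: "\<And>x. f x \<noteq> 0 \<Longrightarrow> d \<le> norm x \<and> norm x \<le> R"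
    unfolding annular_def by blast
  have "exp (- \<kappa> * t) * d \<le> norm x \<and> norm x \<le> exp (- \<kappa> * t) * R" if "f (\<Phi> t x) \<noteq> 0" for x
  proof -
    have "norm x = exp (- \<kappa> * t) * norm (\<Phi> t x)"
      by (simp add: flow_norm mult.assoc[symmetric] exp_add[symmetric])
    then show ?thesis using R[OF that] by simp
  qed
  then show ?thesis unfolding annular_def using \<open>d > 0\<close>
    by (intro exI[of _ "exp (- \<kappa> * t) * d"]) auto
qed

lemma test_fun_flow: "test_fun f \<Longrightarrow> test_fun (\<lambda>x. f (\<Phi> t x))"
  unfolding test_fun_def
  by (auto intro: annular_flow continuous_on_compose2[OF _ flow_cont])

lemma flow_deriv_flow: "flow_deriv f g \<Longrightarrow> flow_deriv (\<lambda>x. f (\<Phi> s x)) (\<lambda>x. g (\<Phi> s x))"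
  using flow_deriv_at[of f g _ s] DERIV_shift[of "\<lambda>t. f (\<Phi> t x)" _ 0 s for x] unfolding flow_deriv_def
  by (auto intro: test_fun_flow simp: flow_add[symmetric] add.commute[of s])

lemma flow_deriv_mult: "flow_deriv f f' \<Longrightarrow> flow_deriv g g' \<Longrightarrow> flow_deriv (\<lambda>x. f x * g x) (\<lambda>x. f' x * g x + f x * g' x)"
  unfolding flow_deriv_def
  by (auto intro!: test_fun_add test_fun_mult derivative_eq_intros simp: flow_0)

lemma flow_deriv_diff: "flow_deriv f f' \<Longrightarrow> flow_deriv g g' \<Longrightarrow> flow_deriv (\<lambda>x. f x - g x) (\<lambda>x. f' x - g' x)"
  unfolding flow_deriv_def by (auto intro!: test_fun_diff derivative_intros)

lemma flow_deriv_cmult: "flow_deriv f f' \<Longrightarrow> flow_deriv (\<lambda>x. c * f x) (\<lambda>x. c * f' x)"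
  unfolding flow_deriv_def by (auto intro!: test_fun_cmult DERIV_cmult)

text \<open>Dominated convergence: for |t| \<le> 1 the difference quotients are bounded by a bound
  of g' through the mean value theorem, and they vanish off one annulus. The factor h is not moved
  by the flow and carries no smoothness, so that a spherical mean can later take its place.\<close>

lemma flow_deriv_wint_0:
  assumes fd: "flow_deriv g g'" and h[measurable]: "h \<in> borel_measurable borel" and hb: "\<And>x. \<bar>h x\<bar> \<le> H"
  shows "((\<lambda>t. wint \<beta> (\<lambda>x. h x * g (\<Phi> t x))) has_real_derivative wint \<beta> (\<lambda>x. h x * g' x)) (at 0)"
proof -
  have tg: "test_fun g" "test_fun g'" using fd by (auto simp: flow_deriv_def)
  then have [measurable]: "g \<in> borel_measurable borel" "g' \<in> borel_measurable borel"
    using test_fun_bdd_annular unfolding bdd_annular_def by auto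
  have [measurable]: "\<Phi> t \<in> borel_measurable borel" for t
    by (rule borel_measurable_continuous_onI[OF flow_cont])
  obtain B where B: "\<And>x. \<bar>g' x\<bar> \<le> B" using test_fun_bdd_annular[OF tg(2)] unfolding bdd_annular_def by blast
  obtain d R where d: "d > 0" and R: "\<And>x. g x \<noteq> 0 \<Longrightarrow> d \<le> norm x \<and> norm x \<le> R"
    using tg(1) unfolding test_fun_def annular_def by blast
  \<comment> \<open>The annulus of \<open>g\<close>, widened by the factor exp |\<kappa>| on both
    sides: it contains every point that the flow can bring into the support within time 1.\<close>
  define K where "K = {x::'a. exp (- \<bar>\<kappa>\<bar>) * d \<le> norm x \<and> norm x \<le> exp \<bar>\<kappa>\<bar> * R}"
  have Kc: "closed K" unfolding K_def
    by (intro closed_Collect_conj closed_Collect_le continuous_intros)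
  then have [measurable]: "K \<in> sets borel" by simp
  have out: "g (\<Phi> t x) = 0" if "x \<notin> K" "\<bar>t\<bar> \<le> 1" for x t
  proof (rule ccontr)
    assume "g (\<Phi> t x) \<noteq> 0"
    then have "d \<le> exp (\<kappa> * t) * norm x \<and> exp (\<kappa> * t) * norm x \<le> R" using R[of "\<Phi> t x"] by (simp add: flow_norm)
    moreover have "\<bar>\<kappa> * t\<bar> \<le> \<bar>\<kappa>\<bar>" using that(2) by (simp add: abs_mult mult_left_le)
    then have "exp (\<kappa> * t) \<le> exp \<bar>\<kappa>\<bar>" "exp (- \<kappa> * t) \<le> exp \<bar>\<kappa>\<bar>" by auto
    moreover have "norm x = exp (- \<kappa> * t) * (exp (\<kappa> * t) * norm x)"
      by (simp add: mult.assoc[symmetric] exp_add[symmetric])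
    ultimately have 1: "norm x \<le> exp \<bar>\<kappa>\<bar> * R"
      by (metis exp_ge_zero mult_mono mult_nonneg_nonneg norm_ge_zero)
    have "d \<le> exp \<bar>\<kappa>\<bar> * norm x"
      using \<open>d \<le> _ \<and> _\<close> mult_right_mono[OF \<open>exp (\<kappa> * t) \<le> exp \<bar>\<kappa>\<bar>\<close> norm_ge_zero[of x]] by linarith
    then have "exp (- \<bar>\<kappa>\<bar>) * d \<le> exp (- \<bar>\<kappa>\<bar>) * (exp \<bar>\<kappa>\<bar> * norm x)"
      by (intro mult_left_mono) auto
    then have "exp (- \<bar>\<kappa>\<bar>) * d \<le> norm x" by (simp add: mult.assoc[symmetric] exp_add[symmetric])
    with 1 that show False by (simp add: K_def)
  qed
  have quot: "\<bar>(g (\<Phi> t x) - g x) / t\<bar> \<le> B * indicator K x" if "\<bar>t\<bar> \<le> 1" "t \<noteq> 0" for x t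
  proof (cases "x \<in> K")
    case False
    then show ?thesis using out[of x t] out[of x 0] that by (simp add: flow_0)
  next
    case True
    have "norm (g (\<Phi> t x) - g (\<Phi> 0 x)) \<le> B * norm (t - 0)"
      by (rule field_differentiable_bound[where S=UNIV and f'="\<lambda>t. g' (\<Phi> t x)"])
        (use flow_deriv_at[OF fd] B in auto)
    then show ?thesis using True that by (simp add: flow_0 field_simps)
  qed
  have bK: "bdd_annular (\<lambda>x. H * (B * indicator K x))"
  proof (intro bdd_annular_cmult)
    show "bdd_annular (indicator K :: 'a \<Rightarrow> real)"
      unfolding bdd_annular_def annular_def
    proof (intro conjI)
      show "\<exists>B. \<forall>x. \<bar>indicat_real K x\<bar> \<le> B" by (intro exI[of _ 1]) (simp add: indicator_def)
      show "\<exists>d>0. \<exists>R. \<forall>x. indicat_real K x \<noteq> 0 \<longrightarrow> d \<le> norm x \<and> norm x \<le> R"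
        using d by (intro exI[of _ "exp (- \<bar>\<kappa>\<bar>) * d"] conjI exI[of _ "exp \<bar>\<kappa>\<bar> * R"])
          (auto simp: indicator_def K_def)
    qed measurable
  qed
  have bg: "bdd_annular (\<lambda>x. h x * g (\<Phi> t x))" for t
    by (rule bdd_annular_mult_bounded[OF test_fun_bdd_annular[OF test_fun_flow[OF tg(1)]] h hb])
  have H0: "H \<ge> 0" using hb[of 0] by linarith
  have "((\<lambda>t. (wint \<beta> (\<lambda>x. h x * g (\<Phi> t x)) - wint \<beta> (\<lambda>x. h x * g (\<Phi> 0 x))) / (t - 0)) \<longlongrightarrow> wint \<beta> (\<lambda>x. h x * g' x)) (at 0)"
    unfolding tendsto_at_iff_sequentially
  proof (intro allI impI)
    fix X :: "nat \<Rightarrow> real" assume X: "\<forall>i. X i \<in> UNIV - {0}" "X \<longlonglongrightarrow> 0"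
    then have ev: "\<forall>\<^sub>F i in sequentially. \<bar>X i\<bar> < 1"
      using order_tendstoD(2)[of "\<lambda>i. \<bar>X i\<bar>" 0 sequentially 1] tendsto_rabs[OF X(2)] by auto
    \<comment> \<open>Discarding the first N terms keeps |X i| < 1, the range in which the bound
      \<open>quot\<close> holds.\<close>
    then obtain N where N: "\<And>i. i \<ge> N \<Longrightarrow> \<bar>X i\<bar> < 1" unfolding eventually_sequentially by blast
    let ?q = "\<lambda>i x. h x * ((g (\<Phi> (X i) x) - g x) / X i) * norm x powr (-\<beta>)"
    have "(\<lambda>i. \<integral>x. ?q (i + N) x \<partial>lborel) \<longlonglongrightarrow> (\<integral>x. h x * g' x * norm x powr (-\<beta>) \<partial>lborel)"
    proof (rule integral_dominated_convergence[OF _ _ bdd_annular_integrable[OF bK, of \<beta>]])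
      show "AE x in lborel. (\<lambda>i. ?q (i + N) x) \<longlonglongrightarrow> h x * g' x * norm x powr (-\<beta>)"
      proof (intro AE_I2 tendsto_intros)
        fix x
        have "((\<lambda>t. (g (\<Phi> t x) - g (\<Phi> 0 x)) / (t - 0)) \<longlongrightarrow> g' x) (at 0)"
          using fd unfolding flow_deriv_def by (simp add: has_field_derivative_iff)
        then have "(\<lambda>i. (g (\<Phi> (X i) x) - g x) / X i) \<longlonglongrightarrow> g' x"
          using X unfolding tendsto_at_iff_sequentially by (auto simp: o_def flow_0)
        then show "(\<lambda>i. (g (\<Phi> (X (i+N)) x) - g x) / X (i+N)) \<longlonglongrightarrow> g' x"
          by (rule LIMSEQ_ignore_initial_segment)
      qed
      show "AE x in lborel. norm (?q (i + N) x) \<le> H * (B * indicator K x) * norm x powr (-\<beta>)" for i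
      proof (rule AE_I2)
        fix x
        have "\<bar>(g (\<Phi> (X (i+N)) x) - g x) / X (i+N)\<bar> \<le> B * indicator K x"
          using quot[of "X (i+N)"] N[of "i+N"] X(1) by auto
        then have "\<bar>h x\<bar> * \<bar>(g (\<Phi> (X (i+N)) x) - g x) / X (i+N)\<bar> * norm x powr (-\<beta>)
           \<le> H * (B * indicator K x) * norm x powr (-\<beta>)"
          using hb H0 by (intro mult_right_mono mult_mono) auto
        then show "norm (?q (i + N) x) \<le> H * (B * indicator K x) * norm x powr (-\<beta>)"
          by (simp add: abs_mult)
      qed
    qed measurable
    also have "(\<lambda>i. \<integral>x. ?q (i + N) x \<partial>lborel)
      = (\<lambda>i. (wint \<beta> (\<lambda>x. h x * g (\<Phi> (X (i+N)) x)) - wint \<beta> (\<lambda>x. h x * g (\<Phi> 0 x))) / X (i + N))"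
    proof
      fix i
      have "(\<integral>x. ?q (i + N) x \<partial>lborel) = wint \<beta> (\<lambda>x. inverse (X (i+N)) * (h x * g (\<Phi> (X (i+N)) x) - h x * g (\<Phi> 0 x)))"
        unfolding wint_def by (intro Bochner_Integration.integral_cong) (auto simp: flow_0 field_simps)
      also have "\<dots> = inverse (X (i+N)) * (wint \<beta> (\<lambda>x. h x * g (\<Phi> (X (i+N)) x)) - wint \<beta> (\<lambda>x. h x * g (\<Phi> 0 x)))"
        by (simp only: wint_cmult wint_diff[OF bg bg])
      finally show "(\<integral>x. ?q (i + N) x \<partial>lborel)
      = (wint \<beta> (\<lambda>x. h x * g (\<Phi> (X (i+N)) x)) - wint \<beta> (\<lambda>x. h x * g (\<Phi> 0 x))) / X (i + N)"
        by (simp add: field_simps)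
    qed
    finally have "(\<lambda>i. (wint \<beta> (\<lambda>x. h x * g (\<Phi> (X (i+N)) x)) - wint \<beta> (\<lambda>x. h x * g (\<Phi> 0 x))) / X (i + N)) \<longlonglongrightarrow> wint \<beta> (\<lambda>x. h x * g' x)"
      by (simp add: wint_def)
    then show "((\<lambda>t. (wint \<beta> (\<lambda>x. h x * g (\<Phi> t x)) - wint \<beta> (\<lambda>x. h x * g (\<Phi> 0 x))) / (t - 0)) \<circ> X) \<longlonglongrightarrow> wint \<beta> (\<lambda>x. h x * g' x)"
      by (simp add: o_def LIMSEQ_offset)
  qed
  then show ?thesis by (simp add: has_field_derivative_iff)
qed

lemma flow_deriv_wint:
  assumes fd: "flow_deriv g g'" and h: "h \<in> borel_measurable borel" and hb: "\<And>x. \<bar>h x\<bar> \<le> H"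
  shows "((\<lambda>t. wint \<beta> (\<lambda>x. h x * g (\<Phi> t x))) has_real_derivative wint \<beta> (\<lambda>x. h x * g' (\<Phi> s x))) (at s)"
proof -
  have "((\<lambda>t. wint \<beta> (\<lambda>x. h x * g (\<Phi> s (\<Phi> t x)))) has_real_derivative wint \<beta> (\<lambda>x. h x * g' (\<Phi> s x))) (at (s + - s))"
    using flow_deriv_wint_0[OF flow_deriv_flow[OF fd] h hb] by simp
  then have "((\<lambda>t. wint \<beta> (\<lambda>x. h x * g (\<Phi> s (\<Phi> (t + - s) x)))) has_real_derivative wint \<beta> (\<lambda>x. h x * g' (\<Phi> s x))) (at s)"
    unfolding DERIV_shift .
  moreover have "\<Phi> s (\<Phi> (t + - s) x) = \<Phi> t x" for t x using flow_add[of s "t + - s" x] by simp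
  ultimately show ?thesis by simp
qed

text \<open>Differentiating the scaling law of the integral at t = 0 takes the place of the
  divergence theorem; c is 0 for rotations and \<beta> - n for dilations.\<close>

lemma wint_flow_deriv:
  assumes "flow_deriv f g" and inv: "\<And>t. wint \<beta> (\<lambda>x. f (\<Phi> t x)) = exp (c * t) * wint \<beta> f"
  shows "wint \<beta> g = c * wint \<beta> f"
proof -
  have "((\<lambda>t. wint \<beta> (\<lambda>x. f (\<Phi> t x))) has_real_derivative wint \<beta> g) (at 0)"
    using flow_deriv_wint_0[OF assms(1), of "\<lambda>_. 1" 1] by simp
  moreover have "((\<lambda>t. wint \<beta> (\<lambda>x. f (\<Phi> t x))) has_real_derivative c * wint \<beta> f) (at 0)"
    unfolding inv by (auto intro!: derivative_eq_intros)
  ultimately show ?thesis using DERIV_unique by blast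
qed

end

subsection \<open>Dilations and rotations\<close>

lemma distr_lborel_orthogonal:
  fixes T :: "'a::euclidean_space \<Rightarrow> 'a"
  assumes T: "orthogonal_transformation T"
  shows "distr lborel borel T = lborel"
proof (rule measure_eqI)
  have lin: "linear T" using T by (simp add: orthogonal_transformation)
  have [measurable]: "T \<in> borel_measurable borel"
    using lin by (intro borel_measurable_continuous_onI linear_continuous_on) (simp add: linear_linear)
  fix A assume "A \<in> sets (distr lborel borel T)"
  then have [measurable]: "A \<in> sets borel" by simp
  have "emeasure (distr lborel borel T) A = (\<integral>\<^sup>+x. indicator A x \<partial>(distr lborel borel T))"
    by simp
  also have "\<dots> = (\<integral>\<^sup>+x. indicator A (T x) \<partial>lborel)"
    by (subst nn_integral_distr) auto
  also have "\<dots> = (\<integral>\<^sup>+x. indicator A x \<partial>lborel)"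
    by (rule nn_integral_orthogonal[OF _ T]) measurable
  finally show "emeasure (distr lborel borel T) A = emeasure lborel A" by simp
qed simp

lemma integral_orthogonal:
  fixes T :: "'a::euclidean_space \<Rightarrow> 'a" and f :: "'a \<Rightarrow> real"
  assumes T: "orthogonal_transformation T" and [measurable]: "f \<in> borel_measurable borel"
  shows "(\<integral>x. f (T x) \<partial>lborel) = (\<integral>x. f x \<partial>lborel)"
proof -
  have lin: "linear T" using T by (simp add: orthogonal_transformation)
  have [measurable]: "T \<in> borel_measurable borel"
    using lin by (intro borel_measurable_continuous_onI linear_continuous_on) (simp add: linear_linear)
  have "(\<integral>x. f x \<partial>lborel) = (\<integral>x. f x \<partial>(distr lborel borel T))"
    by (simp add: distr_lborel_orthogonal[OF T])
  then show ?thesis by (simp add: integral_distr)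
qed

lemma integral_dilate:
  fixes f :: "'a::euclidean_space \<Rightarrow> real"
  assumes [measurable]: "f \<in> borel_measurable borel" and c: "c > 0"
  shows "(\<integral>x. f x \<partial>lborel) = c ^ DIM('a) * (\<integral>x. f (c *\<^sub>R x) \<partial>lborel)"
  using c by (subst lborel_affine[of c 0]) (auto simp: integral_density integral_distr)

text \<open>The Jacobian contributes exp (- n t) and the homogeneous weight exp (\<beta> t).\<close>

lemma wint_dilate:
  fixes f :: "'a::euclidean_space \<Rightarrow> real"
  assumes [measurable]: "f \<in> borel_measurable borel"
  shows "wint \<beta> (\<lambda>x. f (exp t *\<^sub>R x)) = exp ((\<beta> - real DIM('a)) * t) * wint \<beta> f"
proof -
  have "wint \<beta> f = exp t ^ DIM('a) * (\<integral>x. f (exp t *\<^sub>R x) * norm (exp t *\<^sub>R x) powr (-\<beta>) \<partial>lborel)"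
    unfolding wint_def by (rule integral_dilate) auto
  also have "(\<integral>x. f (exp t *\<^sub>R x) * norm (exp t *\<^sub>R x) powr (-\<beta>) \<partial>lborel)
    = exp (- \<beta> * t) * wint \<beta> (\<lambda>x. f (exp t *\<^sub>R x))"
    unfolding wint_def
    by (subst integral_mult_right_zero[symmetric], intro Bochner_Integration.integral_cong)
      (auto simp: powr_mult exp_powr_real mult_ac)
  finally have "exp ((\<beta> - real DIM('a)) * t) * wint \<beta> f
     = exp ((\<beta> - real DIM('a)) * t) * exp (real DIM('a) * t) * exp (- \<beta> * t) * wint \<beta> (\<lambda>x. f (exp t *\<^sub>R x))"
    by (simp add: exp_of_nat_mult)
  also have "exp ((\<beta> - real DIM('a)) * t) * exp (real DIM('a) * t) * exp (- \<beta> * t) = 1"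
    by (simp add: exp_add[symmetric] algebra_simps)
  finally show ?thesis by simp
qed

lemma wint_orthogonal:
  fixes f :: "'a::euclidean_space \<Rightarrow> real" and T :: "'a \<Rightarrow> 'a"
  assumes T: "orthogonal_transformation T" and [measurable]: "f \<in> borel_measurable borel"
  shows "wint \<beta> (\<lambda>x. f (T x)) = wint \<beta> f"
proof -
  have n: "norm (T x) = norm x" for x using T by (simp add: orthogonal_transformation)
  show ?thesis
    using integral_orthogonal[OF T, of "\<lambda>x. f x * norm x powr (-\<beta>)"] by (simp add: wint_def n)
qed

definition dil :: "real \<Rightarrow> 'a::real_normed_vector \<Rightarrow> 'a" where
  "dil t x = exp t *\<^sub>R x"

text \<open>For i = j the flow is the identity, whose generator is 0 = L_ii. Sums of angular
  operators can therefore run over all ordered pairs, with a factor 1/2.\<close>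

definition rot :: "'n \<Rightarrow> 'n \<Rightarrow> real \<Rightarrow> real^'n \<Rightarrow> real^'n" where
  "rot i j t x = (\<chi> k. if i = j then x $ k else if k = i then cos t * x $ i - sin t * x $ j
     else if k = j then sin t * x $ i + cos t * x $ j else x $ k)"

lemma linear_rot: "linear (rot i j t)"
  by (rule linearI) (simp_all add: rot_def vec_eq_iff algebra_simps)

lemma norm_rot: "norm (rot i j t x) = norm (x :: real^'n)"
proof (cases "i = j")
  case True then show ?thesis by (simp add: rot_def)
next
  case False
  have split: "(\<Sum>k\<in>UNIV. (y $ k)\<^sup>2) = (y $ i)\<^sup>2 + ((y $ j)\<^sup>2 + (\<Sum>k\<in>UNIV - {i} - {j}. (y $ k)\<^sup>2))" for y :: "real^'n"
    using False by (subst sum.remove[of _ i]; simp) (subst sum.remove[of _ j]; simp)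
  have "(cos t * a - sin t * b)\<^sup>2 + (sin t * a + cos t * b)\<^sup>2 = ((cos t)\<^sup>2 + (sin t)\<^sup>2) * (a\<^sup>2 + b\<^sup>2)" for a b
    by (simp only: power2_eq_square) (simp only: algebra_simps)
  then have "(\<Sum>k\<in>UNIV. (rot i j t x $ k)\<^sup>2) = (\<Sum>k\<in>UNIV. (x $ k)\<^sup>2)"
    unfolding split using False by (simp add: rot_def)
  then show ?thesis by (simp add: norm_vec_def L2_set_def)
qed

lemma orthogonal_rot: "orthogonal_transformation (rot i j t)"
  unfolding orthogonal_transformation by (simp add: linear_rot norm_rot)

interpretation dil: flow dil 1
  by unfold_locales (auto simp: dil_def exp_add intro!: continuous_intros)

interpretation rot: flow "rot i j" 0 for i j
proof
  fix s t x
  show "rot i j (s + t) x = rot i j s (rot i j t x)"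
    by (auto simp: rot_def vec_eq_iff cos_add sin_add algebra_simps)
  show "rot i j 0 x = x" by (simp add: rot_def vec_eq_iff)
  show "continuous_on UNIV (rot i j t)"
    using linear_rot linear_continuous_on linear_linear by blast
qed (simp add: norm_rot)

lemma dil_rot: "rot i j t (dil s x) = dil s (rot i j t x)"
  by (simp add: dil_def linear_scale[OF linear_rot])

lemma test_fun_measurable: "test_fun f \<Longrightarrow> f \<in> borel_measurable borel"
  using test_fun_bdd_annular unfolding bdd_annular_def by blast

lemma wint_rot:
  "f \<in> borel_measurable borel \<Longrightarrow> wint \<beta> (\<lambda>x. f (rot i j t x)) = wint \<beta> f"
  by (rule wint_orthogonal[OF orthogonal_rot])

lemma wint_rot_flow_deriv: "rot.flow_deriv i j f g \<Longrightarrow> wint \<beta> g = 0"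
  using rot.wint_flow_deriv[of i j f g \<beta> 0] wint_rot[of f \<beta> i j] test_fun_measurable[of f]
  by (simp add: rot.flow_deriv_def)

lemma wint_dil_flow_deriv:
  fixes f :: "'a::euclidean_space \<Rightarrow> real"
  assumes "dil.flow_deriv f g" shows "wint \<beta> g = (\<beta> - real DIM('a)) * wint \<beta> f"
  using dil.wint_flow_deriv[OF assms] wint_dilate[of f \<beta>] test_fun_measurable[of f] assms
  by (simp add: dil.flow_deriv_def dil_def)

text \<open>By the product rule along dilations, the integrals of f' g and f g' add up to (\<beta> -
  n) times the integral of f g; subtracting a from each derivative, with 2 a = \<beta> - n, cancels
  exactly this.\<close>

lemma wint_dil_antisym:
  fixes f g :: "'a::euclidean_space \<Rightarrow> real"
  assumes f: "dil.flow_deriv f f'" and g: "dil.flow_deriv g g'" and a: "2 * a = \<beta> - real DIM('a)"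
  shows "wint \<beta> (\<lambda>x. (f' x - a * f x) * g x) = - wint \<beta> (\<lambda>x. f x * (g' x - a * g x))"
proof -
  have t: "test_fun f" "test_fun f'" "test_fun g" "test_fun g'" using f g by (auto simp: dil.flow_deriv_def)
  note b = test_fun_bdd_annular[OF test_fun_mult]
  have *: "wint \<beta> (\<lambda>x. f' x * g x) + wint \<beta> (\<lambda>x. f x * g' x) = 2 * a * wint \<beta> (\<lambda>x. f x * g x)"
    using wint_dil_flow_deriv[OF dil.flow_deriv_mult[OF f g], of \<beta>] by (simp add: wint_add b t a)
  have "wint \<beta> (\<lambda>x. (f' x - a * f x) * g x) = wint \<beta> (\<lambda>x. f' x * g x - a * (f x * g x))"
    by (simp add: algebra_simps)
  also have "\<dots> = wint \<beta> (\<lambda>x. f' x * g x) - a * wint \<beta> (\<lambda>x. f x * g x)"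
    by (simp add: wint_diff wint_cmult b bdd_annular_cmult t)
  finally have 1: "wint \<beta> (\<lambda>x. (f' x - a * f x) * g x) = wint \<beta> (\<lambda>x. f' x * g x) - a * wint \<beta> (\<lambda>x. f x * g x)" .
  have "wint \<beta> (\<lambda>x. f x * (g' x - a * g x)) = wint \<beta> (\<lambda>x. f x * g' x - a * (f x * g x))"
    by (simp add: algebra_simps)
  also have "\<dots> = wint \<beta> (\<lambda>x. f x * g' x) - a * wint \<beta> (\<lambda>x. f x * g x)"
    by (simp add: wint_diff wint_cmult b bdd_annular_cmult t)
  finally show ?thesis using 1 * by (simp add: algebra_simps)
qed

lemma flow_deriv_dil_rot:
  assumes "dil.flow_deriv f f'" shows "dil.flow_deriv (\<lambda>x. f (rot i j t x)) (\<lambda>x. f' (rot i j t x))"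
  using assms unfolding dil.flow_deriv_def by (auto intro: rot.test_fun_flow simp: dil_rot)

section \<open>Second-order behaviour of correlations with a rotated function\<close>

lemma second_derivative_nonneg_at_min:
  fixes \<phi> \<phi>' :: "real \<Rightarrow> real"
  assumes d1: "\<And>t. (\<phi> has_real_derivative \<phi>' t) (at t)" and d2: "(\<phi>' has_real_derivative c) (at 0)"
    and min: "\<And>t. \<phi> 0 \<le> \<phi> t"
  shows "c \<ge> 0"
proof (rule ccontr)
  assume "\<not> c \<ge> 0"
  then obtain d where d: "d > 0" "\<And>h. h > 0 \<Longrightarrow> h < d \<Longrightarrow> \<phi>' (0 + h) < \<phi>' 0"
    using DERIV_neg_dec_right[OF d2] by auto
  have z: "\<phi>' 0 = 0"
    by (rule DERIV_local_min[OF d1, of 1]) (use min in auto)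
  obtain z where "z > 0" "z < d / 2" "\<phi> (d/2) - \<phi> 0 = (d/2 - 0) * \<phi>' z"
    using MVT2[of 0 "d/2" \<phi> \<phi>'] d d1 by auto
  moreover have "\<phi>' z < 0" using d(2)[of z] \<open>z > 0\<close> \<open>z < d / 2\<close> z d(1) by auto
  ultimately have "\<phi> (d/2) - \<phi> 0 < 0" using d(1) mult_pos_neg[of "d/2 - 0" "\<phi>' z"] by simp
  then show False using min[of "d/2"] by simp
qed

text \<open>All differentiation falls on \<open>u\<close> while \<open>h\<close> stays fixed, so two
  derivatives of \<open>u\<close> suffice to differentiate the correlation twice. The first
  derivative is needed at every t, the second at 0 only.\<close>

lemma wint_rot_second_derivative:
  assumes "rot.flow_deriv i j u l" "rot.flow_deriv i j l ll" and h: "h \<in> borel_measurable borel" "\<And>x. \<bar>h x\<bar> \<le> H"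
  shows "((\<lambda>t. wint \<beta> (\<lambda>x. h x * u (rot i j t x))) has_real_derivative wint \<beta> (\<lambda>x. h x * l (rot i j t x))) (at t)"
    and "((\<lambda>t. wint \<beta> (\<lambda>x. h x * l (rot i j t x))) has_real_derivative wint \<beta> (\<lambda>x. h x * ll x)) (at 0)"
  using rot.flow_deriv_wint[OF assms(1) h] rot.flow_deriv_wint_0[OF assms(2) h] by auto

lemma wint_rot_move:
  assumes "test_fun f" "test_fun g"
  shows "wint \<beta> (\<lambda>x. f x * g (rot i j (-t) x)) = wint \<beta> (\<lambda>x. f (rot i j t x) * g x)"
proof -
  have "rot i j (-t) (rot i j t x) = x" for x
    using rot.flow_add[of i j "-t" t x] by (simp add: rot.flow_0)
  then show ?thesis
    using wint_rot[of "\<lambda>x. f x * g (rot i j (-t) x)" \<beta> i j t]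
      test_fun_measurable[OF test_fun_mult[OF assms(1) rot.test_fun_flow[OF assms(2)]]] by simp
qed

text \<open>Formally $\int s\,L^2u = \int (Lp)^2$, but this would need third derivatives of $u$. Instead,
  $t \mapsto \int p\,(u\circ R_t)$ is odd and $t \mapsto \int s\,(u\circ R_t) = -\int p\,(p\circ R_t)$ is minimal at $0$.\<close>

lemma wint_radial_angular:
  fixes u u1 u2 l ll :: "real^'n \<Rightarrow> real"
  assumes u: "dil.flow_deriv u u1" and u1: "dil.flow_deriv u1 u2"
    and l: "rot.flow_deriv i j u l" and ll: "rot.flow_deriv i j l ll"
    and a: "2 * a = \<beta> - real CARD('n)"
    and p: "\<And>x. p x = u1 x - a * u x" and s: "\<And>x. s x = (u2 x - a * u1 x) - a * p x"
  shows "wint \<beta> (\<lambda>x. p x * ll x) = 0" and "wint \<beta> (\<lambda>x. s x * ll x) \<ge> 0"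
proof -
  have a': "2 * a = \<beta> - real DIM(real^'n)" using a by simp
  have pd: "dil.flow_deriv p (\<lambda>x. u2 x - a * u1 x)"
    using dil.flow_deriv_diff[OF u1 dil.flow_deriv_cmult[OF u, of a]] by (simp add: p[abs_def])
  have t: "test_fun u" "test_fun p" "test_fun u1" "test_fun u2" using u u1 pd by (auto simp: dil.flow_deriv_def)
  have ts: "test_fun s" unfolding s[abs_def]
    by (intro test_fun_diff test_fun_cmult t)
  have bp: "p \<in> borel_measurable borel" "s \<in> borel_measurable borel" using t(2) ts test_fun_measurable by blast+
  obtain P where P: "\<And>x. \<bar>p x\<bar> \<le> P" using test_fun_bdd_annular[OF t(2)] unfolding bdd_annular_def by blast
  obtain S where S: "\<And>x. \<bar>s x\<bar> \<le> S" using test_fun_bdd_annular[OF ts] unfolding bdd_annular_def by blast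
  note dp = wint_rot_second_derivative[OF l ll bp(1) P, of \<beta>]
  note ds = wint_rot_second_derivative[OF l ll bp(2) S, of \<beta>]
  define \<phi> where "\<phi> t = wint \<beta> (\<lambda>x. p x * u (rot i j t x))" for t
  define \<phi>' where "\<phi>' t = wint \<beta> (\<lambda>x. p x * l (rot i j t x))" for t
  \<comment> \<open>E - a is antisymmetric and commutes with rotations, and moving the rotation to
    the other factor reverses t.\<close>
  have odd: "\<phi> (- t) = - \<phi> t" for t
  proof -
    have "\<phi> t = - wint \<beta> (\<lambda>x. u x * p (rot i j t x))"
      using wint_dil_antisym[OF u flow_deriv_dil_rot[OF u, of i j t] a'] by (simp add: \<phi>_def p)
    also have "wint \<beta> (\<lambda>x. u x * p (rot i j t x)) = \<phi> (- t)"
      unfolding \<phi>_def using wint_rot_move[OF t(2,1), of \<beta> i j t] by (simp add: mult.commute)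
    finally show ?thesis by simp
  qed
  have even: "\<phi>' (- t) = \<phi>' t" for t
  proof -
    have d: "(\<phi> has_real_derivative \<phi>' t) (at t)" for t
      using dp(1) by (simp add: \<phi>_def[abs_def] \<phi>'_def)
    have "((\<lambda>t. \<phi> (- t)) has_real_derivative \<phi>' (- t) * (- 1)) (at t)"
      by (rule DERIV_chain2[OF d]) (auto intro!: derivative_eq_intros)
    moreover have "((\<lambda>t. \<phi> (- t)) has_real_derivative - \<phi>' t) (at t)"
      unfolding odd by (intro DERIV_minus d)
    ultimately show ?thesis using DERIV_unique by fastforce
  qed
  have d2: "(\<phi>' has_real_derivative wint \<beta> (\<lambda>x. p x * ll x)) (at 0)"
    using dp(2) by (simp add: \<phi>'_def[abs_def])
  then have "((\<lambda>t. \<phi>' (- t)) has_real_derivative wint \<beta> (\<lambda>x. p x * ll x) * (- 1)) (at 0)"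
    using DERIV_mirror[of \<phi>' _ 0] by simp
  \<comment> \<open>The derivative of an odd function is even, and an even function that is
    differentiable at 0 has derivative 0 there.\<close>
  then show "wint \<beta> (\<lambda>x. p x * ll x) = 0"
    using DERIV_unique[OF d2, of "wint \<beta> (\<lambda>x. p x * ll x) * (- 1)"] unfolding even by simp
  show "wint \<beta> (\<lambda>x. s x * ll x) \<ge> 0"
  proof (rule second_derivative_nonneg_at_min[OF ds])
    fix t
    have *: "wint \<beta> (\<lambda>x. s x * u (rot i j t x)) = - wint \<beta> (\<lambda>x. p x * p (rot i j t x))" for t
      using wint_dil_antisym[OF pd flow_deriv_dil_rot[OF u, of i j t] a'] by (simp add: p s)
    have tp: "test_fun (\<lambda>x. p (rot i j t x))" by (rule rot.test_fun_flow[OF t(2)])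
    \<comment> \<open>Both quadratic terms of the expanded square agree by rotation invariance, so
      the correlation of \<open>p\<close> with its rotation is largest at t = 0.\<close>
    have "0 \<le> wint \<beta> (\<lambda>x. (p x - p (rot i j t x))\<^sup>2)" by (rule wint_nonneg) simp
    also have "\<dots> = wint \<beta> (\<lambda>x. p x * p x + p (rot i j t x) * p (rot i j t x) - 2 * (p x * p (rot i j t x)))"
      by (rule arg_cong[where f="wint \<beta>"], rule ext) (simp add: power2_eq_square algebra_simps)
    also have "\<dots> = wint \<beta> (\<lambda>x. p x * p x) + wint \<beta> (\<lambda>x. p (rot i j t x) * p (rot i j t x))
       - 2 * wint \<beta> (\<lambda>x. p x * p (rot i j t x))"
      by (simp add: wint_add wint_diff wint_cmult bdd_annular_add bdd_annular_cmult test_fun_bdd_annular test_fun_mult t tp)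
    also have "wint \<beta> (\<lambda>x. p (rot i j t x) * p (rot i j t x)) = wint \<beta> (\<lambda>x. p x * p x)"
      using wint_rot[of "\<lambda>x. p x * p x"] bp by simp
    finally show "wint \<beta> (\<lambda>x. s x * u (rot i j 0 x)) \<le> wint \<beta> (\<lambda>x. s x * u (rot i j t x))"
      unfolding * by (simp add: rot.flow_0)
  qed
qed

subsection \<open>The Gaussian Poincare inequality\<close>

text \<open>Left unnormalised: mass and second moment stay symbolic and cancel at the end of
  \<open>spherical_poincare\<close>.\<close>

definition gauss :: "'a::real_normed_vector \<Rightarrow> real" where
  "gauss x = exp (- (norm x)\<^sup>2)"

lemma gauss_pos: "gauss x > 0" by (simp add: gauss_def)

lemma gauss_nonneg: "gauss x \<ge> 0" by (simp add: gauss_def)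

lemma gauss_measurable [measurable]: "gauss \<in> borel_measurable (borel :: 'a::euclidean_space measure)"
  unfolding gauss_def[abs_def] by measurable

text \<open>Half of the exponent is kept for domination: (1 + t) exp (- t) \<le> 2 exp (- t / 2)
  absorbs quadratic growth in \<open>integrable_gauss_bound\<close>. Finiteness is inherited,
  coordinate by coordinate, from the normal density on the line.\<close>

lemma integrable_exp_neg_half_square:
  "integrable lborel (\<lambda>x::'a::euclidean_space. exp (- (norm x)\<^sup>2 / 2))"
proof (rule integrableI_nonneg)
  have 1: "exp (- (norm x)\<^sup>2 / 2) = (\<Prod>b\<in>Basis. exp (- (x \<bullet> b)\<^sup>2 / 2))" for x :: 'a
  proof -
    have "(norm x)\<^sup>2 = (\<Sum>b\<in>Basis. (x \<bullet> b)\<^sup>2)"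
      unfolding power2_norm_eq_inner by (subst euclidean_inner) (simp add: power2_eq_square)
    then show ?thesis
      by (simp add: exp_sum[symmetric] sum_divide_distrib[symmetric] sum_negf)
  qed
  have "integrable lborel (\<lambda>x. sqrt (2 * pi) * std_normal_density x)"
    by (intro integrable_mult_right integrable_normal_density) simp
  then have "integrable lborel (\<lambda>x::real. exp (- x\<^sup>2 / 2))"
    by (simp add: normal_density_def)
  then have fin: "(\<integral>\<^sup>+x. ennreal (exp (- x\<^sup>2 / 2)) \<partial>lborel) < \<infinity>"
    by (simp add: nn_integral_eq_integral)
  have "(\<integral>\<^sup>+x. ennreal (exp (- (norm (x::'a))\<^sup>2 / 2)) \<partial>lborel)
     = (\<integral>\<^sup>+x. (\<Prod>b\<in>Basis. ennreal (exp (- ((x::'a) \<bullet> b)\<^sup>2 / 2))) \<partial>lborel)"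
    by (simp only: 1 prod_ennreal exp_ge_zero)
  also have "\<dots> = (\<Prod>b\<in>(Basis::'a set). (\<integral>\<^sup>+x. ennreal (exp (- x\<^sup>2 / 2)) \<partial>lborel))"
    by (rule nn_integral_lborel_prod) auto
  also have "\<dots> < \<infinity>" using fin by (simp add: power_less_top_ennreal)
  finally show "(\<integral>\<^sup>+x. ennreal (exp (- (norm (x::'a))\<^sup>2 / 2)) \<partial>lborel) < \<infinity>" .
qed auto

lemma integrable_gauss_bound:
  fixes f :: "'a::euclidean_space \<Rightarrow> real"
  assumes [measurable]: "f \<in> borel_measurable borel" and b: "\<And>x. \<bar>f x\<bar> \<le> C * (1 + (norm x)\<^sup>2)"
  shows "integrable lborel (\<lambda>x. f x * gauss x)"
proof (rule Bochner_Integration.integrable_bound[OF integrable_mult_right[OF integrable_exp_neg_half_square, of "2 * C"]])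
  show "AE x in lborel. norm (f x * gauss x) \<le> norm (2 * C * exp (- (norm (x::'a))\<^sup>2 / 2))"
  proof (rule AE_I2)
    fix x :: 'a
    define t where "t = (norm x)\<^sup>2"
    have t: "t \<ge> 0" by (simp add: t_def)
    have "0 \<le> C * (1 + t)" using b[of x] abs_ge_zero[of "f x"] unfolding t_def by linarith
    then have C: "C \<ge> 0" using t by (simp add: zero_le_mult_iff)
    have "1 + t \<le> 2 * exp (t / 2)" using exp_ge_add_one_self[of "t/2"] by linarith
    then have "(1 + t) * exp (- t) \<le> 2 * exp (t / 2) * exp (- t)" by (intro mult_right_mono) auto
    also have "\<dots> = 2 * exp (- t / 2)" by (simp add: exp_add[symmetric])
    finally have *: "(1 + t) * exp (- t) \<le> 2 * exp (- t / 2)" .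
    have "norm (f x * gauss x) \<le> C * (1 + t) * exp (- t)"
      using b[of x] by (simp add: abs_mult gauss_def t_def mult_right_mono)
    also have "\<dots> \<le> 2 * C * exp (- t / 2)" using mult_left_mono[OF * C] by simp
    finally show "norm (f x * gauss x) \<le> norm (2 * C * exp (- (norm x)\<^sup>2 / 2))"
      using C by (simp add: t_def)
  qed
qed measurable

lemma norm_le_one_plus_square: "norm x \<le> 1 + (norm x)\<^sup>2"
proof -
  have "0 \<le> (norm x - 1)\<^sup>2" by simp
  then have "2 * norm x \<le> 1 + (norm x)\<^sup>2" by (simp add: power2_diff)
  then show ?thesis using norm_ge_zero[of x] by linarith
qed

definition gauss_mass :: "'a::euclidean_space itself \<Rightarrow> real" where
  "gauss_mass _ = (\<integral>x. gauss (x::'a) \<partial>lborel)"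

definition gauss_moment2 :: "'a::euclidean_space itself \<Rightarrow> real" where
  "gauss_moment2 _ = (\<integral>x. (norm (x::'a))\<^sup>2 * gauss x \<partial>lborel)"

text \<open>Rotating a onto a coordinate axis shows that all directions are equivalent; the n
  coordinates add up to the second moment, so each has the share 1 / n.\<close>

lemma gauss_integral_inner_square:
  fixes a :: "real^'n"
  shows "(\<integral>q. (a \<bullet> q)\<^sup>2 * gauss q \<partial>lborel) = (norm a)\<^sup>2 * (gauss_moment2 TYPE(real^'n) / real CARD('n))"
proof -
  have inv: "(\<integral>q. (a \<bullet> q)\<^sup>2 * gauss q \<partial>lborel) = (norm a)\<^sup>2 * (\<integral>q. (q $ i)\<^sup>2 * gauss (q::real^'n) \<partial>lborel)" for a :: "real^'n" and i :: 'n
  proof -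
    have "norm a = norm (norm a *\<^sub>R axis i (1::real))"
      by (simp only: norm_scaleR norm_axis_1 abs_norm_cancel mult_1_right)
    then obtain T :: "real^'n \<Rightarrow> real^'n"
      where T: "orthogonal_transformation T" "T a = norm a *\<^sub>R axis i (1::real)"
      by (rule orthogonal_transformation_exists)
    have "T a \<bullet> T q = a \<bullet> q" "gauss (T q) = gauss q" for q
      using T(1) by (auto simp: orthogonal_transformation_def gauss_def orthogonal_transformation_norm)
    then have "(\<integral>q. (a \<bullet> q)\<^sup>2 * gauss q \<partial>lborel) = (\<integral>q. (T a \<bullet> T q)\<^sup>2 * gauss (T q) \<partial>lborel)"
      by simp
    also have "\<dots> = (\<integral>q. (T a \<bullet> q)\<^sup>2 * gauss q \<partial>lborel)"
      by (rule integral_orthogonal[OF T(1), of "\<lambda>q. (T a \<bullet> q)\<^sup>2 * gauss q"]) measurable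
    also have "\<dots> = (\<integral>q. (norm a)\<^sup>2 * ((q $ i)\<^sup>2 * gauss q) \<partial>lborel)"
      by (simp add: T(2) inner_axis' power_mult_distrib mult.assoc)
    finally show ?thesis by simp
  qed
  \<comment> \<open>\<open>undefined\<close> stands for some fixed coordinate; by \<open>inv\<close>
    every coordinate gives the same value.\<close>
  define K where "K = (\<integral>q. (axis undefined 1 \<bullet> (q::real^'n))\<^sup>2 * gauss q \<partial>lborel)"
  have K: "(\<integral>q. (q $ i)\<^sup>2 * gauss (q::real^'n) \<partial>lborel) = K" for i
    unfolding K_def by (subst inv[of _ i]) (simp add: norm_axis_1)
  have int: "integrable lborel (\<lambda>q. (q $ i)\<^sup>2 * gauss (q::real^'n))" for i
  proof (rule integrable_gauss_bound[of _ 1])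
    fix q :: "real^'n"
    have "(q $ i)\<^sup>2 \<le> (norm q)\<^sup>2" using component_le_norm_cart[of q i] by (metis abs_norm_cancel power2_le_iff_abs_le norm_ge_zero abs_le_square_iff)
    then show "\<bar>(q $ i)\<^sup>2\<bar> \<le> 1 * (1 + (norm q)\<^sup>2)" by simp
  qed measurable
  have "gauss_moment2 TYPE(real^'n) = (\<integral>q. (\<Sum>i\<in>UNIV. (q $ i)\<^sup>2 * gauss (q::real^'n)) \<partial>lborel)"
    unfolding gauss_moment2_def
  proof (rule arg_cong[where f="integral\<^sup>L lborel"], rule ext)
    fix q :: "real^'n"
    have "(norm q)\<^sup>2 = (\<Sum>i\<in>UNIV. (q $ i)\<^sup>2)"
      unfolding power2_norm_eq_inner by (simp add: inner_vec_def power2_eq_square)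
    then show "(norm q)\<^sup>2 * gauss q = (\<Sum>i\<in>UNIV. (q $ i)\<^sup>2 * gauss q)"
      by (simp only: sum_distrib_right)
  qed
  also have "\<dots> = real CARD('n) * K"
    by (simp add: int K)
  finally have "K = gauss_moment2 TYPE(real^'n) / real CARD('n)" by simp
  then show ?thesis by (subst inv[of _ undefined]) (simp add: K)
qed

text \<open>The second component is both the t-derivative of the first and the first at time t +
  pi/2. Position and velocity along cos t p + sin t q thus undergo a single orthogonal motion of the
  product space.\<close>

definition pair_rot :: "real \<Rightarrow> 'a \<times> 'a \<Rightarrow> ('a::euclidean_space) \<times> 'a" where
  "pair_rot t z = (cos t *\<^sub>R fst z + sin t *\<^sub>R snd z, cos t *\<^sub>R snd z - sin t *\<^sub>R fst z)"

lemma pair_rot_norm: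
  "(norm (cos t *\<^sub>R p + sin t *\<^sub>R q))\<^sup>2 + (norm (cos t *\<^sub>R q - sin t *\<^sub>R p))\<^sup>2
    = (norm p)\<^sup>2 + (norm (q::'a::euclidean_space))\<^sup>2"
proof -
  have "(norm (cos t *\<^sub>R p + sin t *\<^sub>R q))\<^sup>2 + (norm (cos t *\<^sub>R q - sin t *\<^sub>R p))\<^sup>2
    = ((cos t)\<^sup>2 + (sin t)\<^sup>2) * (norm p)\<^sup>2 + ((cos t)\<^sup>2 + (sin t)\<^sup>2) * (norm q)\<^sup>2"
    unfolding power2_norm_eq_inner
    by (simp only: power2_eq_square) (simp only: inner_simps inner_commute[of q p] algebra_simps)
  then show ?thesis by simp
qed

lemma orthogonal_pair_rot: "orthogonal_transformation (pair_rot t :: 'a::euclidean_space \<times> 'a \<Rightarrow> _)"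
  unfolding orthogonal_transformation
proof
  show "linear (pair_rot t :: 'a \<times> 'a \<Rightarrow> _)"
    by (rule linearI) (auto simp: pair_rot_def algebra_simps)
  show "\<forall>v::'a\<times>'a. norm (pair_rot t v) = norm v"
    using pair_rot_norm[of t] by (auto simp: pair_rot_def norm_prod_def)
qed

text \<open>For each fixed t the map is orthogonal on the product space and preserves the integral
  of h; after exchanging integrals, t contributes only the length 2 pi.\<close>

lemma nn_integral_pair_rot_average:
  fixes h :: "'a::euclidean_space \<times> 'a \<Rightarrow> ennreal"
  assumes h[measurable]: "h \<in> borel_measurable borel"
  shows "(\<integral>\<^sup>+p. \<integral>\<^sup>+q. (\<integral>\<^sup>+t. h (pair_rot t (p,q)) * indicator {0..2*pi} t \<partial>lborel) \<partial>lborel \<partial>lborel)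
     = ennreal (2 * pi) * (\<integral>\<^sup>+p. \<integral>\<^sup>+q. h (p, q) \<partial>lborel \<partial>lborel)"
proof -
  have cont: "continuous_on UNIV (\<lambda>w::('a\<times>'a)\<times>real. pair_rot (snd w) (fst w))"
    unfolding pair_rot_def by (intro continuous_intros)
  have m0: "(\<lambda>w::('a\<times>'a)\<times>real. pair_rot (snd w) (fst w)) \<in> borel_measurable borel"
    by (rule borel_measurable_continuous_onI[OF cont])
  have m: "(\<lambda>w::('a\<times>'a)\<times>real. h (pair_rot (snd w) (fst w)) * indicator {0..2*pi} (snd w)) \<in> borel_measurable (lborel \<Otimes>\<^sub>M lborel)"
  proof -
    have [measurable]: "(snd :: ('a\<times>'a)\<times>real \<Rightarrow> real) \<in> borel_measurable borel"
      by (intro borel_measurable_continuous_onI continuous_intros)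
    have [measurable]: "(\<lambda>w::('a\<times>'a)\<times>real. h (pair_rot (snd w) (fst w))) \<in> borel_measurable borel"
      by (rule measurable_compose[OF m0 h])
    show ?thesis unfolding lborel_prod by measurable
  qed
  have h': "h \<in> borel_measurable (lborel \<Otimes>\<^sub>M lborel)" unfolding lborel_prod by simp
  have mt: "(\<lambda>z. \<integral>\<^sup>+t. h (pair_rot t z) * indicator {0..2*pi} t \<partial>lborel) \<in> borel_measurable (lborel \<Otimes>\<^sub>M lborel)"
    using lborel.borel_measurable_nn_integral_fst[OF m] unfolding lborel_prod by simp
  have "(\<integral>\<^sup>+p. \<integral>\<^sup>+q. (\<integral>\<^sup>+t. h (pair_rot t (p,q)) * indicator {0..2*pi} t \<partial>lborel) \<partial>lborel \<partial>lborel)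
    = (\<integral>\<^sup>+z. (\<integral>\<^sup>+t. h (pair_rot t z) * indicator {0..2*pi} t \<partial>lborel) \<partial>(lborel \<Otimes>\<^sub>M lborel))"
    by (rule lborel.nn_integral_fst[OF mt])
  also have "\<dots> = (\<integral>\<^sup>+z. (\<integral>\<^sup>+t. h (pair_rot t z) * indicator {0..2*pi} t \<partial>lborel) \<partial>lborel)"
    by (simp only: lborel_prod)
  also have "\<dots> = (\<integral>\<^sup>+t. (\<integral>\<^sup>+z. h (pair_rot t z) * indicator {0..2*pi} t \<partial>lborel) \<partial>lborel)"
    using lborel_pair.Fubini[OF m] by simp
  also have "\<dots> = (\<integral>\<^sup>+t. (\<integral>\<^sup>+z. h z \<partial>lborel) * indicator {0..2*pi} t \<partial>lborel)"
  proof (rule nn_integral_cong)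
    fix t :: real
    have [measurable]: "pair_rot t \<in> borel_measurable (borel :: ('a\<times>'a) measure)"
      unfolding pair_rot_def by (intro borel_measurable_continuous_onI continuous_intros)
    show "(\<integral>\<^sup>+z. h (pair_rot t z) * indicator {0..2*pi} t \<partial>lborel) = (\<integral>\<^sup>+z. h z \<partial>lborel) * indicator {0..2*pi} t"
      using nn_integral_orthogonal[OF h orthogonal_pair_rot, of t] by (subst nn_integral_multc) auto
  qed
  also have "\<dots> = (\<integral>\<^sup>+z. h z \<partial>lborel) * ennreal (2 * pi)"
    by (subst nn_integral_cmult) auto
  also have "(\<integral>\<^sup>+z. h z \<partial>lborel) = (\<integral>\<^sup>+p. \<integral>\<^sup>+q. h (p, q) \<partial>lborel \<partial>lborel)"
    using lborel.nn_integral_fst[OF h'] by (simp add: lborel_prod)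
  finally show ?thesis by (simp add: mult.commute)
qed

lemma nn_integral_Icc_continuous:
  assumes "continuous_on UNIV g" "\<And>x. g x \<ge> 0"
  shows "(\<integral>\<^sup>+x. ennreal (g x) * indicator {a..b} x \<partial>lborel) = ennreal (integral {a..b} (g::real\<Rightarrow>real))"
  using assms
  by (intro nn_integral_has_integral_lebesgue' integrable_integral integrable_continuous_interval)
    (auto intro: continuous_on_subset)

text \<open>For q off the line of p \<noteq> 0, the curve cos t p + sin t q misses the origin, where
  no derivative of the integrand is available. This is where dimension at least 2 enters the
  Gaussian inequality.\<close>

lemma AE_not_in_span_singleton:
  fixes p :: "'a::euclidean_space"
  assumes "DIM('a) \<ge> 2" shows "AE q in lborel. q \<notin> span {p}"
proof -
  have "dim (span {p}) < DIM('a)" using dim_le_card[of "span {p}" "{p}"] assms by (simp add: dim_span)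
  then have "negligible (span {p})" by (rule negligible_lowdim)
  then have "span {p} \<in> null_sets lebesgue" by (simp add: negligible_iff_null_sets)
  moreover have "span {p} \<in> sets lborel" using closed_span[of "{p}"] by simp
  ultimately have "span {p} \<in> null_sets lborel" by (simp add: null_sets_completion_iff)
  then show ?thesis by (rule AE_not_in)
qed

text \<open>This is \<open>integral_quarter_shift_le\<close> for F(t) = W (P t): the curve P has
  period 2 pi, P (t + pi/2) = Q t, and P' = Q makes F' the derivative of W at P t in direction Q
  t.\<close>

lemma pair_rot_great_circle_le:
  fixes W :: "'a::euclidean_space \<Rightarrow> real" and \<Gamma> :: "'a \<Rightarrow> 'a"
  assumes dW: "\<And>y. y \<noteq> 0 \<Longrightarrow> (W has_derivative (\<lambda>h. \<Gamma> y \<bullet> h)) (at y)"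
    and c\<Gamma>: "continuous_on (- {0}) \<Gamma>" and p: "p \<noteq> 0" and q: "q \<notin> span {p}"
  shows "(\<integral>\<^sup>+t. ennreal ((W (snd (pair_rot t (p,q))) - W (fst (pair_rot t (p,q))))\<^sup>2) * indicator {0..2*pi} t \<partial>lborel)
    \<le> 2 * (\<integral>\<^sup>+t. ennreal ((\<Gamma> (fst (pair_rot t (p,q))) \<bullet> snd (pair_rot t (p,q)))\<^sup>2) * indicator {0..2*pi} t \<partial>lborel)"
proof -
  define P where "P t = cos t *\<^sub>R p + sin t *\<^sub>R q" for t
  define Q where "Q t = cos t *\<^sub>R q - sin t *\<^sub>R p" for t
  have Pnz: "P t \<noteq> 0" for t
  proof
    assume z: "P t = 0"
    show False
    proof (cases "sin t = 0")
      case True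
      then have "cos t \<noteq> 0" using sin_cos_squared_add[of t] by auto
      then show False using z True p by (simp add: P_def)
    next
      case False
      have "q = (- cos t / sin t) *\<^sub>R p"
      proof -
        have "sin t *\<^sub>R q = - (cos t *\<^sub>R p)" using z by (simp add: P_def eq_neg_iff_add_eq_0 add.commute)
        then have "(1 / sin t) *\<^sub>R (sin t *\<^sub>R q) = (1 / sin t) *\<^sub>R (- (cos t *\<^sub>R p))" by simp
        then show ?thesis using False by simp
      qed
      then show False using q span_mul[OF span_base[of p "{p}"], of "- cos t / sin t"] by simp
    qed
  qed
  have PQ: "P (t + pi/2) = Q t" for t by (simp add: P_def Q_def sin_add cos_add)
  have dP: "(P has_vector_derivative Q t) (at t)" for t
    unfolding P_def Q_def
    by (auto intro!: derivative_eq_intros simp: has_vector_derivative_def algebra_simps)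
  have cP: "continuous_on UNIV P" and cQ: "continuous_on UNIV Q"
    unfolding P_def Q_def by (intro continuous_intros)+
  have c\<Gamma>P: "continuous_on UNIV (\<lambda>t. \<Gamma> (P t))"
    by (rule continuous_on_compose2[OF c\<Gamma> cP]) (use Pnz in auto)
  have cW: "continuous_on (- {0}) W"
    using dW by (intro continuous_at_imp_continuous_on) (auto intro: has_derivative_continuous)
  have cWP: "continuous_on UNIV (\<lambda>t. W (P t))"
    by (rule continuous_on_compose2[OF cW cP]) (use Pnz in auto)
  have cWQ: "continuous_on UNIV (\<lambda>t. W (Q t))"
    by (rule continuous_on_compose2[OF cW cQ]) (use Pnz PQ in \<open>auto, metis\<close>)
  have dF: "((\<lambda>t. W (P t)) has_real_derivative \<Gamma> (P t) \<bullet> Q t) (at t)" for t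
  proof -
    have "(P has_derivative (\<lambda>s. s *\<^sub>R Q t)) (at t)" using dP by (simp add: has_vector_derivative_def)
    from has_derivative_compose[OF this dW[OF Pnz[of t]]] show ?thesis
      unfolding has_field_derivative_def
      by (rule has_derivative_eq_rhs) (auto simp: mult.commute)
  qed
  have c2: "continuous_on UNIV (\<lambda>t. \<Gamma> (P t) \<bullet> Q t)" by (intro continuous_intros c\<Gamma>P cQ)
  have "integral {0..2*pi} (\<lambda>t. (W (P (t + pi/2)) - W (P t))\<^sup>2) \<le> 2 * integral {0..2*pi} (\<lambda>t. (\<Gamma> (P t) \<bullet> Q t)\<^sup>2)"
    by (rule integral_quarter_shift_le[OF dF c2]) (simp add: P_def)
  then have "ennreal (integral {0..2*pi} (\<lambda>t. (W (Q t) - W (P t))\<^sup>2)) \<le> ennreal (2 * integral {0..2*pi} (\<lambda>t. (\<Gamma> (P t) \<bullet> Q t)\<^sup>2))"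
    unfolding PQ by (rule ennreal_leI)
  also have "\<dots> = 2 * ennreal (integral {0..2*pi} (\<lambda>t. (\<Gamma> (P t) \<bullet> Q t)\<^sup>2))"
    by (subst ennreal_mult') auto
  finally show ?thesis
    unfolding pair_rot_def fst_conv snd_conv P_def[symmetric] Q_def[symmetric]
    by (subst (1 2) nn_integral_Icc_continuous) (auto intro!: continuous_intros cWP cWQ c2)
qed


text \<open>Integrate the great-circle inequality over independent Gaussian p and q; invariance
  removes the average over t. Since W has mean 0, the left side becomes twice the mass times the
  integral of W^2. On the right, integrating over q first turns the square of
  \<open>\<Gamma> p \<bullet> q\<close> into the square of \<open>norm (\<Gamma> p)\<close> times
  the moment of one coordinate. Linear W give equality.\<close>

lemma gaussian_poincare:
  fixes W :: "real^'n \<Rightarrow> real" and \<Gamma> :: "real^'n \<Rightarrow> real^'n"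
  assumes n: "CARD('n) \<ge> 2"
    and dW: "\<And>y. y \<noteq> 0 \<Longrightarrow> (W has_derivative (\<lambda>h. \<Gamma> y \<bullet> h)) (at y)"
    and c\<Gamma>: "continuous_on (- {0}) \<Gamma>"
    and mW[measurable]: "W \<in> borel_measurable borel" and m\<Gamma>[measurable]: "\<Gamma> \<in> borel_measurable borel"
    and bW: "\<And>y. \<bar>W y\<bar> \<le> C * norm y" and b\<Gamma>: "\<And>y. norm (\<Gamma> y) \<le> C"
    and mean: "(\<integral>y. W y * gauss y \<partial>lborel) = 0"
  shows "gauss_mass TYPE(real^'n) * (\<integral>y. (W y)\<^sup>2 * gauss y \<partial>lborel)
     \<le> gauss_moment2 TYPE(real^'n) / real CARD('n) * (\<integral>y. (norm (\<Gamma> y))\<^sup>2 * gauss y \<partial>lborel)"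
proof -
  let ?Z = "gauss_mass TYPE(real^'n)"
  define A where "A = (\<integral>y. (W y)\<^sup>2 * gauss y \<partial>lborel)"
  define B where "B = (\<integral>y. (norm (\<Gamma> y))\<^sup>2 * gauss y \<partial>lborel)"
  define \<kappa> where "\<kappa> = gauss_moment2 TYPE(real^'n) / real CARD('n)"
  have C0: "C \<ge> 0" using b\<Gamma>[of 0] norm_ge_zero order_trans by blast
  have iW: "integrable lborel (\<lambda>y. W y * gauss y)"
  proof (rule integrable_gauss_bound[of _ C])
    show "\<bar>W y\<bar> \<le> C * (1 + (norm y)\<^sup>2)" for y
      using bW[of y] mult_left_mono[OF norm_le_one_plus_square C0] order_trans by blast
  qed measurable
  have W2: "(W y)\<^sup>2 \<le> C\<^sup>2 * (norm y)\<^sup>2" for y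
    using bW[of y] power_mono[of "\<bar>W y\<bar>" "C * norm y" 2] by (simp add: power_mult_distrib)
  have iW2: "integrable lborel (\<lambda>y. (W y)\<^sup>2 * gauss y)"
  proof (rule integrable_gauss_bound[of _ "C\<^sup>2"])
    show "\<bar>(W y)\<^sup>2\<bar> \<le> C\<^sup>2 * (1 + (norm y)\<^sup>2)" for y
      using W2[of y] by (simp add: distrib_left add_increasing)
  qed measurable
  have i\<Gamma>: "integrable lborel (\<lambda>y. (norm (\<Gamma> y))\<^sup>2 * gauss y)"
  proof (rule integrable_gauss_bound[of _ "C\<^sup>2"])
    show "\<bar>(norm (\<Gamma> y))\<^sup>2\<bar> \<le> C\<^sup>2 * (1 + (norm y)\<^sup>2)" for y
      using power_mono[OF b\<Gamma>[of y], of 2] by (simp add: distrib_left add_increasing2)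
  qed measurable
  have iZ: "integrable lborel (gauss :: real^'n \<Rightarrow> real)"
    using integrable_gauss_bound[of "\<lambda>_. 1" 1] by simp
  have iq: "integrable lborel (\<lambda>q. (a \<bullet> q)\<^sup>2 * gauss q)" for a :: "real^'n"
  proof (rule integrable_gauss_bound[of _ "(norm a)\<^sup>2"])
    show "\<bar>(a \<bullet> q)\<^sup>2\<bar> \<le> (norm a)\<^sup>2 * (1 + (norm q)\<^sup>2)" for q
      using power_mono[OF Cauchy_Schwarz_ineq2[of a q], of 2]
      by (simp add: power_mult_distrib distrib_left add_increasing)
  qed measurable
  define h1 :: "(real^'n) \<times> (real^'n) \<Rightarrow> ennreal"
    where "h1 z = ennreal ((W (snd z) - W (fst z))\<^sup>2 * (gauss (fst z) * gauss (snd z)))" for z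
  define h2 :: "(real^'n) \<times> (real^'n) \<Rightarrow> ennreal"
    where "h2 z = ennreal (2 * ((\<Gamma> (fst z) \<bullet> snd z)\<^sup>2 * (gauss (fst z) * gauss (snd z))))" for z
  have h1m: "h1 \<in> borel_measurable borel" and h2m: "h2 \<in> borel_measurable borel"
    unfolding h1_def h2_def borel_prod[symmetric] by measurable
  \<comment> \<open>\<open>pair_rot\<close> preserves |p|^2 + |q|^2, so the product density is
    constant along each curve and leaves the t-integral as a factor.\<close>
  have gg: "gauss (fst (pair_rot t (p,q))) * gauss (snd (pair_rot t (p,q))) = gauss p * gauss (q::real^'n)" for t p q
    using pair_rot_norm[of t p q] by (simp add: gauss_def pair_rot_def exp_add[symmetric])
  have "(\<integral>\<^sup>+p. \<integral>\<^sup>+q. (\<integral>\<^sup>+t. h1 (pair_rot t (p,q)) * indicator {0..2*pi} t \<partial>lborel) \<partial>lborel \<partial>lborel)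
    \<le> (\<integral>\<^sup>+p. \<integral>\<^sup>+q. (\<integral>\<^sup>+t. h2 (pair_rot t (p,q)) * indicator {0..2*pi} t \<partial>lborel) \<partial>lborel \<partial>lborel)"
  proof (intro nn_integral_mono_AE)
    show "AE p in lborel. (\<integral>\<^sup>+q. (\<integral>\<^sup>+t. h1 (pair_rot t (p,q)) * indicator {0..2*pi} t \<partial>lborel) \<partial>lborel)
      \<le> (\<integral>\<^sup>+q. (\<integral>\<^sup>+t. h2 (pair_rot t (p,q)) * indicator {0..2*pi} t \<partial>lborel) \<partial>lborel)"
      using AE_lborel_singleton[of 0]
    proof eventually_elim
      case (elim p)
      show ?case
      proof (rule nn_integral_mono_AE)
        have "DIM(real^'n) \<ge> 2" using n by simp
        from AE_not_in_span_singleton[OF this, of p]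
        show "AE q in lborel. (\<integral>\<^sup>+t. h1 (pair_rot t (p,q)) * indicator {0..2*pi} t \<partial>lborel)
          \<le> (\<integral>\<^sup>+t. h2 (pair_rot t (p,q)) * indicator {0..2*pi} t \<partial>lborel)"
        proof eventually_elim
          case (elim q)
          have mp[measurable]: "(\<lambda>t. fst (pair_rot t (p,q))) \<in> borel_measurable borel"
            "(\<lambda>t. snd (pair_rot t (p,q))) \<in> borel_measurable borel"
            unfolding pair_rot_def by (auto intro!: borel_measurable_continuous_onI continuous_intros)
          have 1: "(\<integral>\<^sup>+t. h1 (pair_rot t (p,q)) * indicator {0..2*pi} t \<partial>lborel)
            = ennreal (gauss p * gauss q) * (\<integral>\<^sup>+t. ennreal ((W (snd (pair_rot t (p,q))) - W (fst (pair_rot t (p,q))))\<^sup>2) * indicator {0..2*pi} t \<partial>lborel)"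
            unfolding h1_def gg
            by (subst nn_integral_cmult[symmetric]) (auto intro!: nn_integral_cong simp: ennreal_mult gauss_nonneg mult_ac)
          have 2: "(\<integral>\<^sup>+t. h2 (pair_rot t (p,q)) * indicator {0..2*pi} t \<partial>lborel)
            = ennreal (2 * (gauss p * gauss q)) * (\<integral>\<^sup>+t. ennreal ((\<Gamma> (fst (pair_rot t (p,q))) \<bullet> snd (pair_rot t (p,q)))\<^sup>2) * indicator {0..2*pi} t \<partial>lborel)"
            unfolding h2_def gg
            by (subst nn_integral_cmult[symmetric]) (auto intro!: nn_integral_cong simp: ennreal_mult gauss_nonneg mult_ac)
          show ?case unfolding 1 2
            using mult_left_mono[OF pair_rot_great_circle_le[OF dW c\<Gamma> \<open>p \<noteq> 0\<close> elim], of "ennreal (gauss p * gauss q)"]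
            by (simp add: mult_ac ennreal_mult gauss_nonneg)
        qed
      qed
    qed
  qed
  then have "ennreal (2 * pi) * (\<integral>\<^sup>+p. \<integral>\<^sup>+q. h1 (p, q) \<partial>lborel \<partial>lborel)
     \<le> ennreal (2 * pi) * (\<integral>\<^sup>+p. \<integral>\<^sup>+q. h2 (p, q) \<partial>lborel \<partial>lborel)"
    unfolding nn_integral_pair_rot_average[OF h1m] nn_integral_pair_rot_average[OF h2m] .
  then have le: "(\<integral>\<^sup>+p. \<integral>\<^sup>+q. h1 (p, q) \<partial>lborel \<partial>lborel) \<le> (\<integral>\<^sup>+p. \<integral>\<^sup>+q. h2 (p, q) \<partial>lborel \<partial>lborel)"
    by (simp add: ennreal_mult_le_mult_iff)
  have Z0: "?Z \<ge> 0" "A \<ge> 0" "B \<ge> 0" "\<kappa> \<ge> 0"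
    unfolding gauss_mass_def A_def B_def \<kappa>_def gauss_moment2_def
    by (auto intro!: integral_nonneg_AE divide_nonneg_nonneg simp: gauss_nonneg)
  \<comment> \<open>The cross term of the square vanishes in the q-integral because W has mean
    0.\<close>
  have "(\<integral>\<^sup>+q. h1 (p, q) \<partial>lborel) = ennreal (A * gauss p + ?Z * ((W p)\<^sup>2 * gauss p))" for p
  proof -
    have i: "integrable lborel (\<lambda>q. gauss p * ((W q)\<^sup>2 * gauss q) + ((- 2 * W p * gauss p) * (W q * gauss q) + ((W p)\<^sup>2 * gauss p) * gauss q))"
      by (intro Bochner_Integration.integrable_add integrable_mult_right iW iW2 iZ)
    have e: "(W q - W p)\<^sup>2 * (gauss p * gauss q)
       = gauss p * ((W q)\<^sup>2 * gauss q) + ((- 2 * W p * gauss p) * (W q * gauss q) + ((W p)\<^sup>2 * gauss p) * gauss q)" for q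
      by (simp add: power2_eq_square algebra_simps)
    have "(\<integral>\<^sup>+q. h1 (p, q) \<partial>lborel) = ennreal (\<integral>q. (W q - W p)\<^sup>2 * (gauss p * gauss q) \<partial>lborel)"
      unfolding h1_def fst_conv snd_conv
    proof (rule nn_integral_eq_integral)
      show "integrable lborel (\<lambda>q. (W q - W p)\<^sup>2 * (gauss p * gauss q))" using i unfolding e .
    qed (simp add: gauss_nonneg)
    also have "(\<integral>q. (W q - W p)\<^sup>2 * (gauss p * gauss q) \<partial>lborel) = gauss p * A + ((W p)\<^sup>2 * gauss p) * ?Z"
      unfolding e A_def gauss_mass_def
      by (simp add: iW iW2 iZ mean)
    finally show ?thesis by (simp add: mult_ac)
  qed
  then have "(\<integral>\<^sup>+p. \<integral>\<^sup>+q. h1 (p, q) \<partial>lborel \<partial>lborel) = ennreal (\<integral>p. A * gauss p + ?Z * ((W p)\<^sup>2 * gauss p) \<partial>lborel)"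
    by (simp only:) (intro nn_integral_eq_integral; auto intro!: iZ iW2 add_nonneg_nonneg mult_nonneg_nonneg Z0 simp: gauss_nonneg)
  also have "(\<integral>p. A * gauss p + ?Z * ((W p)\<^sup>2 * gauss p) \<partial>lborel) = 2 * (?Z * A)"
    by (simp add: iZ iW2 A_def gauss_mass_def)
  finally have L: "(\<integral>\<^sup>+p. \<integral>\<^sup>+q. h1 (p, q) \<partial>lborel \<partial>lborel) = ennreal (2 * (?Z * A))" .
  have "(\<integral>\<^sup>+q. h2 (p, q) \<partial>lborel) = ennreal (2 * \<kappa> * ((norm (\<Gamma> p))\<^sup>2 * gauss p))" for p
  proof -
    have "(\<integral>\<^sup>+q. h2 (p, q) \<partial>lborel) = (\<integral>\<^sup>+q. ennreal (2 * gauss p * ((\<Gamma> p \<bullet> q)\<^sup>2 * gauss q)) \<partial>lborel)"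
      unfolding h2_def by (simp add: mult_ac)
    also have "\<dots> = ennreal (\<integral>q. 2 * gauss p * ((\<Gamma> p \<bullet> q)\<^sup>2 * gauss q) \<partial>lborel)"
      by (rule nn_integral_eq_integral) (auto intro!: iq simp: gauss_nonneg)
    also have "(\<integral>q. 2 * gauss p * ((\<Gamma> p \<bullet> q)\<^sup>2 * gauss q) \<partial>lborel) = 2 * \<kappa> * ((norm (\<Gamma> p))\<^sup>2 * gauss p)"
      by (simp add: gauss_integral_inner_square \<kappa>_def)
    finally show ?thesis .
  qed
  then have "(\<integral>\<^sup>+p. \<integral>\<^sup>+q. h2 (p, q) \<partial>lborel \<partial>lborel) = ennreal (\<integral>p. 2 * \<kappa> * ((norm (\<Gamma> p))\<^sup>2 * gauss p) \<partial>lborel)"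
    by (simp only:) (intro nn_integral_eq_integral; auto intro!: i\<Gamma> mult_nonneg_nonneg Z0 simp: gauss_nonneg)
  then have R: "(\<integral>\<^sup>+p. \<integral>\<^sup>+q. h2 (p, q) \<partial>lborel \<partial>lborel) = ennreal (2 * (\<kappa> * B))"
    by (simp add: B_def mult.assoc)
  have "ennreal (2 * (?Z * A)) \<le> ennreal (2 * (\<kappa> * B))"
    using le unfolding L R .
  then have "2 * (?Z * A) \<le> 2 * (\<kappa> * B)" using Z0 by (subst (asm) ennreal_le_iff) auto
  then show ?thesis unfolding A_def[symmetric] B_def[symmetric] \<kappa>_def[symmetric] by simp
qed

subsection \<open>The Poincare inequality on spheres\<close>

lemma borel_measurable_sgn_euclidean [measurable]:
  "(sgn :: 'a::euclidean_space \<Rightarrow> 'a) \<in> borel_measurable borel"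
  unfolding sgn_div_norm[abs_def] by measurable

text \<open>In the inner integral y enters only through its direction and its norm. Three dilations,
  with the order of integration exchanged in between, separate the variables: scaling x by |y| turns
  sgn y into y, scaling y by 1 / |x| turns |x| y into y, and scaling x by |y| turns |y| / |x| into 1
  / |x|. Besides the weighted integral of f there remains a factor that does not involve f.\<close>

lemma nn_integral_polar_const:
  fixes f :: "'a::euclidean_space \<Rightarrow> ennreal" and k :: "real \<Rightarrow> ennreal"
  assumes [measurable]: "f \<in> borel_measurable borel" "k \<in> borel_measurable borel"
  shows "(\<integral>\<^sup>+x. ennreal (norm (x::'a) powr (-\<beta>)) * (\<integral>\<^sup>+y. f (norm x *\<^sub>R sgn y) * k (norm y) \<partial>lborel) \<partial>lborel)
    = (\<integral>\<^sup>+x. ennreal (norm (x::'a) powr (- 2 * real DIM('a))) * k (1 / norm x) \<partial>lborel)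
      * (\<integral>\<^sup>+y. f y * ennreal (norm y powr (-\<beta>)) \<partial>lborel)"
proof -
  let ?n = "real DIM('a)"
  have scale: "ennreal (c ^ DIM('a)) * (ennreal ((c * r) powr s) * X) = ennreal (c powr (?n + s)) * (ennreal (r powr s) * X)"
    if "c > 0" "r \<ge> 0" for c r s :: real and X
    using that by (simp add: powr_add powr_mult powr_realpow ennreal_mult mult_ac)
  have "(\<integral>\<^sup>+x. ennreal (norm (x::'a) powr (-\<beta>)) * (\<integral>\<^sup>+y. f (norm x *\<^sub>R sgn y) * k (norm y) \<partial>lborel) \<partial>lborel)
    = (\<integral>\<^sup>+x. (\<integral>\<^sup>+y. ennreal (norm (x::'a) powr (-\<beta>)) * (f (norm x *\<^sub>R sgn y) * k (norm (y::'a))) \<partial>lborel) \<partial>lborel)"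
    by (simp add: nn_integral_cmult)
  also have "\<dots> = (\<integral>\<^sup>+y. (\<integral>\<^sup>+x. ennreal (norm (x::'a) powr (-\<beta>)) * (f (norm x *\<^sub>R sgn y) * k (norm (y::'a))) \<partial>lborel) \<partial>lborel)"
    by (rule lborel_pair.Fubini') measurable
  also have "\<dots> = (\<integral>\<^sup>+y. (\<integral>\<^sup>+x. ennreal (norm y powr (?n - \<beta>)) * (ennreal (norm (x::'a) powr (-\<beta>)) * (f (norm x *\<^sub>R y) * k (norm (y::'a)))) \<partial>lborel) \<partial>lborel)"
  proof (rule nn_integral_cong_AE)
    show "AE y in lborel. (\<integral>\<^sup>+x. ennreal (norm (x::'a) powr (-\<beta>)) * (f (norm x *\<^sub>R sgn y) * k (norm (y::'a))) \<partial>lborel)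
      = (\<integral>\<^sup>+x. ennreal (norm y powr (?n - \<beta>)) * (ennreal (norm (x::'a) powr (-\<beta>)) * (f (norm x *\<^sub>R y) * k (norm y))) \<partial>lborel)"
      using AE_lborel_singleton[of 0]
    proof eventually_elim
      case (elim y)
      then have c: "norm y > 0" by simp
      have e: "norm (norm y *\<^sub>R x) *\<^sub>R sgn y = norm x *\<^sub>R y" for x :: 'a
        using c by (simp add: sgn_div_norm)
      have "(\<integral>\<^sup>+x. ennreal (norm (x::'a) powr (-\<beta>)) * (f (norm x *\<^sub>R sgn y) * k (norm y)) \<partial>lborel)
        = (\<integral>\<^sup>+x. ennreal (norm y ^ DIM('a)) * (ennreal (norm (norm y *\<^sub>R (x::'a)) powr (-\<beta>)) * (f (norm (norm y *\<^sub>R x) *\<^sub>R sgn y) * k (norm y))) \<partial>lborel)"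
        by (rule nn_integral_dilate[OF c]) measurable
      also have "\<dots> = (\<integral>\<^sup>+x. ennreal (norm y powr (?n - \<beta>)) * (ennreal (norm (x::'a) powr (-\<beta>)) * (f (norm x *\<^sub>R y) * k (norm y))) \<partial>lborel)"
      proof (rule nn_integral_cong)
        fix x :: 'a
        show "ennreal (norm y ^ DIM('a)) * (ennreal (norm (norm y *\<^sub>R x) powr (-\<beta>)) * (f (norm (norm y *\<^sub>R x) *\<^sub>R sgn y) * k (norm y)))
          = ennreal (norm y powr (?n - \<beta>)) * (ennreal (norm x powr (-\<beta>)) * (f (norm x *\<^sub>R y) * k (norm y)))"
          unfolding e using scale[OF c norm_ge_zero[of x], of "-\<beta>"] by simp
      qed
      finally show ?case .
    qed
  qed
  also have "\<dots> = (\<integral>\<^sup>+x. (\<integral>\<^sup>+y. ennreal (norm y powr (?n - \<beta>)) * (ennreal (norm (x::'a) powr (-\<beta>)) * (f (norm x *\<^sub>R y) * k (norm (y::'a)))) \<partial>lborel) \<partial>lborel)"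
    by (rule lborel_pair.Fubini') measurable
  also have "\<dots> = (\<integral>\<^sup>+x. (\<integral>\<^sup>+y. ennreal (norm x powr (- 2 * ?n)) * (ennreal (norm y powr (?n - \<beta>)) * (f y * k (norm y / norm (x::'a)))) \<partial>lborel) \<partial>lborel)"
  proof (rule nn_integral_cong_AE)
    show "AE x in lborel. (\<integral>\<^sup>+y. ennreal (norm y powr (?n - \<beta>)) * (ennreal (norm (x::'a) powr (-\<beta>)) * (f (norm x *\<^sub>R y) * k (norm (y::'a)))) \<partial>lborel)
      = (\<integral>\<^sup>+y. ennreal (norm x powr (- 2 * ?n)) * (ennreal (norm y powr (?n - \<beta>)) * (f y * k (norm y / norm (x::'a)))) \<partial>lborel)"
      using AE_lborel_singleton[of 0]
    proof eventually_elim
      case (elim x)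
      then have c: "norm x > 0" by simp
      have "(\<integral>\<^sup>+y. ennreal (norm x powr (- 2 * ?n)) * (ennreal (norm y powr (?n - \<beta>)) * (f y * k (norm y / norm (x::'a)))) \<partial>lborel)
        = (\<integral>\<^sup>+y. ennreal (norm x ^ DIM('a)) * (ennreal (norm x powr (- 2 * ?n)) * (ennreal (norm (norm x *\<^sub>R y) powr (?n - \<beta>)) * (f (norm x *\<^sub>R y) * k (norm (norm x *\<^sub>R y) / norm (x::'a))))) \<partial>lborel)"
        by (rule nn_integral_dilate[OF c]) measurable
      also have "\<dots> = (\<integral>\<^sup>+y. ennreal (norm y powr (?n - \<beta>)) * (ennreal (norm (x::'a) powr (-\<beta>)) * (f (norm x *\<^sub>R y) * k (norm (y::'a)))) \<partial>lborel)"
      proof (rule nn_integral_cong)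
        fix y :: 'a
        have "ennreal (norm x ^ DIM('a)) * (ennreal (norm x powr (- 2 * ?n)) * ennreal (norm (norm x *\<^sub>R y) powr (?n - \<beta>)))
          = ennreal (norm x powr ?n * norm x powr (- 2 * ?n) * norm x powr (?n - \<beta>) * norm y powr (?n - \<beta>))"
          using c by (simp add: powr_mult powr_realpow ennreal_mult mult_ac)
        also have "norm x powr ?n * norm x powr (- 2 * ?n) * norm x powr (?n - \<beta>) = norm x powr (-\<beta>)"
          by (simp add: powr_add[symmetric])
        also have "ennreal (norm x powr (-\<beta>) * norm y powr (?n - \<beta>)) = ennreal (norm y powr (?n - \<beta>)) * ennreal (norm x powr (-\<beta>))"
          by (simp add: ennreal_mult mult.commute)
        finally have e: "ennreal (norm x ^ DIM('a)) * (ennreal (norm x powr (- 2 * ?n)) * ennreal (norm (norm x *\<^sub>R y) powr (?n - \<beta>)))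
          = ennreal (norm y powr (?n - \<beta>)) * ennreal (norm x powr (-\<beta>))" .
        have e2: "norm (norm x *\<^sub>R y) / norm x = norm y" using c by simp
        show "ennreal (norm x ^ DIM('a)) * (ennreal (norm x powr (- 2 * ?n)) * (ennreal (norm (norm x *\<^sub>R y) powr (?n - \<beta>)) * (f (norm x *\<^sub>R y) * k (norm (norm x *\<^sub>R y) / norm x))))
          = ennreal (norm y powr (?n - \<beta>)) * (ennreal (norm x powr (-\<beta>)) * (f (norm x *\<^sub>R y) * k (norm y)))"
          unfolding e2 using arg_cong[OF e, of "\<lambda>t. t * (f (norm x *\<^sub>R y) * k (norm y))"]
          by (simp only: mult.assoc)
      qed
      finally show ?case by simp
    qed
  qed
  also have "\<dots> = (\<integral>\<^sup>+y. (\<integral>\<^sup>+x. ennreal (norm x powr (- 2 * ?n)) * (ennreal (norm y powr (?n - \<beta>)) * (f y * k (norm y / norm (x::'a)))) \<partial>lborel) \<partial>lborel)"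
    by (rule lborel_pair.Fubini') measurable
  also have "\<dots> = (\<integral>\<^sup>+y. (\<integral>\<^sup>+x. ennreal (norm (x::'a) powr (- 2 * ?n)) * k (1 / norm x) \<partial>lborel) * (f y * ennreal (norm y powr (-\<beta>))) \<partial>lborel)"
  proof (rule nn_integral_cong_AE)
    show "AE y in lborel. (\<integral>\<^sup>+x. ennreal (norm x powr (- 2 * ?n)) * (ennreal (norm y powr (?n - \<beta>)) * (f y * k (norm y / norm (x::'a)))) \<partial>lborel)
      = (\<integral>\<^sup>+x. ennreal (norm (x::'a) powr (- 2 * ?n)) * k (1 / norm x) \<partial>lborel) * (f y * ennreal (norm y powr (-\<beta>)))"
      using AE_lborel_singleton[of 0]
    proof eventually_elim
      case (elim y)
      then have c: "norm y > 0" by simp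
      have "(\<integral>\<^sup>+x. ennreal (norm x powr (- 2 * ?n)) * (ennreal (norm y powr (?n - \<beta>)) * (f y * k (norm y / norm (x::'a)))) \<partial>lborel)
        = (\<integral>\<^sup>+x. ennreal (norm y ^ DIM('a)) * (ennreal (norm (norm y *\<^sub>R x) powr (- 2 * ?n)) * (ennreal (norm y powr (?n - \<beta>)) * (f y * k (norm y / norm (norm y *\<^sub>R (x::'a)))))) \<partial>lborel)"
        by (rule nn_integral_dilate[OF c]) measurable
      also have "\<dots> = (\<integral>\<^sup>+x. (ennreal (norm (x::'a) powr (- 2 * ?n)) * k (1 / norm x)) * (f y * ennreal (norm y powr (-\<beta>))) \<partial>lborel)"
      proof (rule nn_integral_cong)
        fix x :: 'a
        have "ennreal (norm y ^ DIM('a)) * (ennreal (norm (norm y *\<^sub>R x) powr (- 2 * ?n)) * ennreal (norm y powr (?n - \<beta>)))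
          = ennreal (norm y powr ?n * norm y powr (- 2 * ?n) * norm y powr (?n - \<beta>) * norm x powr (- 2 * ?n))"
          using c by (simp add: powr_mult powr_realpow ennreal_mult mult_ac)
        also have "norm y powr ?n * norm y powr (- 2 * ?n) * norm y powr (?n - \<beta>) = norm y powr (-\<beta>)"
          by (simp add: powr_add[symmetric])
        also have "ennreal (norm y powr (-\<beta>) * norm x powr (- 2 * ?n)) = ennreal (norm x powr (- 2 * ?n)) * ennreal (norm y powr (-\<beta>))"
          by (simp add: ennreal_mult mult.commute)
        finally have e: "ennreal (norm y ^ DIM('a)) * (ennreal (norm (norm y *\<^sub>R x) powr (- 2 * ?n)) * ennreal (norm y powr (?n - \<beta>)))
          = ennreal (norm x powr (- 2 * ?n)) * ennreal (norm y powr (-\<beta>))" .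
        have e2: "norm y / norm (norm y *\<^sub>R x) = 1 / norm x" using c by simp
        show "ennreal (norm y ^ DIM('a)) * (ennreal (norm (norm y *\<^sub>R x) powr (- 2 * ?n)) * (ennreal (norm y powr (?n - \<beta>)) * (f y * k (norm y / norm (norm y *\<^sub>R (x::'a))))))
          = (ennreal (norm (x::'a) powr (- 2 * ?n)) * k (1 / norm x)) * (f y * ennreal (norm y powr (-\<beta>)))"
          unfolding e2 using arg_cong[OF e, of "\<lambda>t. t * (f y * k (1 / norm x))"]
          by (simp only: mult_ac)
      qed
      also have "\<dots> = (\<integral>\<^sup>+x. ennreal (norm (x::'a) powr (- 2 * ?n)) * k (1 / norm x) \<partial>lborel) * (f y * ennreal (norm y powr (-\<beta>)))"
        by (rule nn_integral_multc) measurable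
      finally show ?case .
    qed
  qed
  also have "\<dots> = (\<integral>\<^sup>+x. ennreal (norm (x::'a) powr (- 2 * ?n)) * k (1 / norm x) \<partial>lborel)
      * (\<integral>\<^sup>+y. f y * ennreal (norm y powr (-\<beta>)) \<partial>lborel)"
    by (rule nn_integral_cmult) measurable
  finally show ?thesis .
qed

lemma norm_scaleR_sgn: "y \<noteq> 0 \<Longrightarrow> norm (norm x *\<^sub>R sgn (y::'a::real_normed_vector)) = norm x"
  by (simp add: norm_sgn)

text \<open>A substitute for polar coordinates that uses only dilations; the constant is identified by
  testing with a radial function.\<close>

lemma nn_integral_polar:
  fixes f :: "'a::euclidean_space \<Rightarrow> ennreal" and k :: "real \<Rightarrow> ennreal"
  assumes [measurable]: "f \<in> borel_measurable borel" "k \<in> borel_measurable borel"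
  shows "(\<integral>\<^sup>+x. ennreal (norm (x::'a) powr (-\<beta>)) * (\<integral>\<^sup>+y. f (norm x *\<^sub>R sgn y) * k (norm y) \<partial>lborel) \<partial>lborel)
    = (\<integral>\<^sup>+y. k (norm (y::'a)) \<partial>lborel) * (\<integral>\<^sup>+y. f y * ennreal (norm y powr (-\<beta>)) \<partial>lborel)"
proof -
  let ?C = "\<integral>\<^sup>+x. ennreal (norm (x::'a) powr (- 2 * real DIM('a))) * k (1 / norm x) \<partial>lborel"
  \<comment> \<open>For a radial function the direction of y is irrelevant, so the inner integral
    can be evaluated; this one has a positive finite weighted integral \<open>I\<close>, which can
    be cancelled.\<close>
  define g :: "'a \<Rightarrow> ennreal" where "g x = indicator {1..2} (norm x)" for x
  have [measurable]: "g \<in> borel_measurable borel" unfolding g_def by measurable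
  define I where "I = (\<integral>\<^sup>+y. g y * ennreal (norm y powr (-\<beta>)) \<partial>lborel)"
  have "?C * I = (\<integral>\<^sup>+x. ennreal (norm (x::'a) powr (-\<beta>)) * (\<integral>\<^sup>+y. g (norm x *\<^sub>R sgn y) * k (norm (y::'a)) \<partial>lborel) \<partial>lborel)"
    unfolding I_def by (rule nn_integral_polar_const[symmetric]) measurable
  also have "\<dots> = (\<integral>\<^sup>+x. ennreal (norm (x::'a) powr (-\<beta>)) * (g x * (\<integral>\<^sup>+y. k (norm (y::'a)) \<partial>lborel)) \<partial>lborel)"
  proof -
    have "(\<integral>\<^sup>+y. g (norm x *\<^sub>R sgn y) * k (norm (y::'a)) \<partial>lborel) = g x * (\<integral>\<^sup>+y. k (norm (y::'a)) \<partial>lborel)" for x :: 'a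
    proof -
      have "(\<integral>\<^sup>+y. g (norm x *\<^sub>R sgn y) * k (norm (y::'a)) \<partial>lborel) = (\<integral>\<^sup>+y. g x * k (norm (y::'a)) \<partial>lborel)"
      proof (rule nn_integral_cong_AE)
        show "AE y in lborel. g (norm x *\<^sub>R sgn y) * k (norm (y::'a)) = g x * k (norm y)"
          using AE_lborel_singleton[of 0]
          by eventually_elim (simp add: g_def norm_scaleR_sgn del: norm_scaleR)
      qed
      then show ?thesis by (simp add: nn_integral_cmult)
    qed
    then show ?thesis by simp
  qed
  also have "\<dots> = I * (\<integral>\<^sup>+y. k (norm (y::'a)) \<partial>lborel)"
    unfolding I_def by (subst nn_integral_multc[symmetric]) (auto simp: mult_ac)
  finally have eq: "?C * I = (\<integral>\<^sup>+y. k (norm (y::'a)) \<partial>lborel) * I" by (simp add: mult.commute)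
  have bg: "bdd_annular (\<lambda>x::'a. indicator {1..2} (norm x) :: real)"
    unfolding bdd_annular_def annular_def
    by (intro conjI exI[of _ 1] exI[of _ "2::real"]) (auto simp: indicator_def)
  have I: "I = ennreal (wint \<beta> (\<lambda>x::'a. indicator {1..2} (norm x)))"
    unfolding I_def wint_def g_def
    by (subst nn_integral_eq_integral[symmetric, OF bdd_annular_integrable[OF bg]])
      (auto simp: ennreal_mult ennreal_indicator)
  then have Ifin: "I \<noteq> \<infinity>" by simp
  have Inz: "I \<noteq> 0"
  proof
    assume "I = 0"
    then have "AE y in lborel. g y * ennreal (norm (y::'a) powr (-\<beta>)) = 0"
      unfolding I_def by (subst (asm) nn_integral_0_iff_AE) auto
    then have "AE y in lborel. \<not> (y \<in> {y::'a. 1 < norm y \<and> norm y < 2})"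
      by eventually_elim (auto simp: g_def indicator_def split: if_splits)
    moreover have op: "open {y::'a. 1 < norm y \<and> norm y < 2}"
      by (intro open_Collect_conj open_Collect_less continuous_intros)
    ultimately have "{y::'a. 1 < norm y \<and> norm y < 2} \<in> null_sets lborel"
      by (subst AE_iff_null_sets) auto
    then have "negligible {y::'a. 1 < norm y \<and> norm y < 2}"
      by (simp add: negligible_iff_null_sets null_sets_completionI)
    moreover obtain b :: 'a where "norm b = 3/2" using vector_choose_size[of "3/2"] by auto
    then have "b \<in> {y. 1 < norm y \<and> norm y < 2}" by simp
    ultimately show False using open_not_negligible[OF op] by blast
  qed
  have "?C = (\<integral>\<^sup>+y. k (norm (y::'a)) \<partial>lborel)"
    using arg_cong[OF eq, of "\<lambda>t. t / I"] Ifin Inz by (simp add: ennreal_mult_divide_eq)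
  then show ?thesis by (simp only: nn_integral_polar_const[OF assms])
qed

text \<open>The extension |y| (u (r y / |y|) - m) has degree one, so its gradient depends only on
  the direction of y: the radial part is u - m, the tangential part is r times the tangential
  gradient of u.\<close>

lemma has_derivative_norm_scaled_angular:
  fixes u :: "real^'n \<Rightarrow> real" and gu :: "real^'n \<Rightarrow> real^'n"
  assumes du: "\<And>x. (u has_derivative (\<lambda>h. gu x \<bullet> h)) (at x)" and y: "y \<noteq> 0"
  shows "((\<lambda>y. norm y * (u (r *\<^sub>R sgn y) - m)) has_derivative
     (\<lambda>h. ((u (r *\<^sub>R sgn y) - m) *\<^sub>R sgn y
        + r *\<^sub>R (gu (r *\<^sub>R sgn y) - (sgn y \<bullet> gu (r *\<^sub>R sgn y)) *\<^sub>R sgn y)) \<bullet> h)) (at y)"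
proof -
  have ny: "norm y > 0" using y by simp
  have dn: "(norm has_derivative (\<lambda>h. sgn y \<bullet> h)) (at y)"
    using has_derivative_norm[OF y] by (simp add: inner_commute)
  have ds: "((\<lambda>y. r *\<^sub>R sgn y) has_derivative (\<lambda>h. (r / norm y) *\<^sub>R (h - (sgn y \<bullet> h) *\<^sub>R sgn y))) (at y)"
  proof -
    have i: "((\<lambda>y. inverse (norm y)) has_derivative (\<lambda>h. - (inverse (norm y) * (sgn y \<bullet> h) * inverse (norm y)))) (at y)"
      by (rule Deriv.has_derivative_inverse[OF _ dn]) (simp add: y)
    have "((\<lambda>y. r *\<^sub>R (inverse (norm y) *\<^sub>R y)) has_derivative
      (\<lambda>h. r *\<^sub>R (inverse (norm y) *\<^sub>R h + (- (inverse (norm y) * (sgn y \<bullet> h) * inverse (norm y))) *\<^sub>R y))) (at y)"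
      by (rule has_derivative_scaleR_right[OF has_derivative_scaleR[OF i has_derivative_ident]])
    then show ?thesis unfolding sgn_div_norm[abs_def]
      by (rule has_derivative_eq_rhs)
        (auto simp: fun_eq_iff sgn_div_norm algebra_simps divide_inverse)
  qed
  have dus: "((\<lambda>y. u (r *\<^sub>R sgn y)) has_derivative (\<lambda>h. gu (r *\<^sub>R sgn y) \<bullet> ((r / norm y) *\<^sub>R (h - (sgn y \<bullet> h) *\<^sub>R sgn y)))) (at y)"
    by (rule has_derivative_compose[OF ds du])
  have "((\<lambda>y. norm y * (u (r *\<^sub>R sgn y) - m)) has_derivative
     (\<lambda>h. norm y * (gu (r *\<^sub>R sgn y) \<bullet> ((r / norm y) *\<^sub>R (h - (sgn y \<bullet> h) *\<^sub>R sgn y)) - 0) + (sgn y \<bullet> h) * (u (r *\<^sub>R sgn y) - m))) (at y)"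
    by (intro has_derivative_mult dn has_derivative_diff dus has_derivative_const)
  then show ?thesis
    using ny by (elim has_derivative_eq_rhs)
      (auto simp: fun_eq_iff inner_simps inner_commute algebra_simps)
qed

text \<open>The radial and the tangential part are orthogonal. At x = r sgn y the second summand is
  the angular energy \<open>Q x\<close> of \<open>spherical_poincare\<close>.\<close>

lemma norm_angular_gradient_square:
  fixes g y :: "'a::euclidean_space"
  assumes y: "y \<noteq> 0"
  shows "(norm (c *\<^sub>R sgn y + r *\<^sub>R (g - (sgn y \<bullet> g) *\<^sub>R sgn y)))\<^sup>2
    = c\<^sup>2 + ((norm (r *\<^sub>R sgn y))\<^sup>2 * (norm g)\<^sup>2 - ((r *\<^sub>R sgn y) \<bullet> g)\<^sup>2)"
proof -
  have 1: "sgn y \<bullet> sgn y = 1" using y by (simp add: dot_square_norm norm_sgn)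
  show ?thesis
    unfolding power2_norm_eq_inner
    by (simp add: inner_simps 1 inner_commute[of g "sgn y"] power2_eq_square algebra_simps)
qed

text \<open>On each sphere this is the sharp Poincare inequality with constant $n-1$. It is the Gaussian
  inequality applied to the extension of $u - m$ that is homogeneous of degree one; no constant
  is lost because linear functions are extremal in both inequalities.\<close>

lemma spherical_poincare:
  fixes u :: "real^'n \<Rightarrow> real" and gu :: "real^'n \<Rightarrow> real^'n"
  assumes n: "CARD('n) \<ge> 2"
    and du: "\<And>x. (u has_derivative (\<lambda>h. gu x \<bullet> h)) (at x)" and cgu: "continuous_on UNIV gu"
    and au: "annular u" and agu: "annular (\<lambda>x. norm (gu x))"
    and Q: "\<And>x. Q x = (norm x)\<^sup>2 * (norm (gu x))\<^sup>2 - (x \<bullet> gu x)\<^sup>2"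
  obtains m :: "real \<Rightarrow> real" where "m \<in> borel_measurable borel" "bdd_annular (\<lambda>x::real^'n. m (norm x))"
    "(real CARD('n) - 1) * wint \<beta> (\<lambda>x. (u x - m (norm x))\<^sup>2) \<le> wint \<beta> Q"
proof -
  let ?Z = "gauss_mass TYPE(real^'n)" and ?M = "gauss_moment2 TYPE(real^'n)"
  have cu: "continuous_on UNIV u"
    using du by (intro continuous_at_imp_continuous_on) (auto intro: has_derivative_continuous)
  have mu[measurable]: "u \<in> borel_measurable borel" and mgu[measurable]: "gu \<in> borel_measurable borel"
    using cu cgu borel_measurable_continuous_onI by auto
  have tu: "test_fun u" and tgu: "test_fun (\<lambda>x. norm (gu x))"
    unfolding test_fun_def using au agu cu cgu by (auto intro: continuous_intros)
  obtain B where B: "\<And>x. \<bar>u x\<bar> \<le> B" using test_fun_bdd_annular[OF tu] unfolding bdd_annular_def by blast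
  obtain G where G: "\<And>x. norm (gu x) \<le> G" using test_fun_bdd_annular[OF tgu] unfolding bdd_annular_def by auto
  have B0: "B \<ge> 0" using B[of 0] by linarith
  have G0: "G \<ge> 0" using G[of 0] norm_ge_zero order_trans by blast
  have Q0: "Q x \<ge> 0" for x
    using power_mono[OF Cauchy_Schwarz_ineq2[of x "gu x"], of 2] by (simp add: Q power_mult_distrib)
  have tQ: "test_fun Q"
    unfolding test_fun_def
  proof
    show "continuous_on UNIV Q" unfolding Q[abs_def] by (intro continuous_intros cgu)
    show "annular Q" by (rule annular_mono[OF agu]) (auto simp: Q)
  qed
  have mQ[measurable]: "Q \<in> borel_measurable borel" using test_fun_measurable[OF tQ] .
  have i1: "integrable lborel (\<lambda>y::real^'n. norm y * gauss y)"
    by (rule integrable_gauss_bound[of _ 1]) (use norm_le_one_plus_square in auto)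
  have iu: "integrable lborel (\<lambda>y::real^'n. (norm y * u (r *\<^sub>R sgn y)) * gauss y)" for r
  proof (rule integrable_gauss_bound[of _ B])
    show "\<bar>norm y * u (r *\<^sub>R sgn y)\<bar> \<le> B * (1 + (norm y)\<^sup>2)" for y
      using mult_mono[OF norm_le_one_plus_square[of y] B[of "r *\<^sub>R sgn y"]] B0 by (simp add: abs_mult mult.commute)
  qed measurable
  define M1 where "M1 = (\<integral>y. norm (y::real^'n) * gauss y \<partial>lborel)"
  have pos: "(\<integral>y. h y * gauss (y::real^'n) \<partial>lborel) > 0"
    if "integrable lborel (\<lambda>y. h y * gauss y)" "\<And>y. y \<noteq> 0 \<Longrightarrow> h y > 0" for h :: "real^'n \<Rightarrow> real"
  proof -
    have AE: "AE y in lborel. 0 < h y * gauss y"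
      using AE_lborel_singleton[of 0] by eventually_elim (use that(2) in \<open>auto simp: gauss_pos\<close>)
    then have "(\<integral>y. h y * gauss y \<partial>lborel) \<ge> 0" by (intro integral_nonneg_AE) (auto elim: eventually_mono)
    moreover have "(\<integral>y. h y * gauss y \<partial>lborel) \<noteq> 0"
    proof
      assume "(\<integral>y. h y * gauss y \<partial>lborel) = 0"
      then have "AE y in lborel. h y * gauss y = 0"
        using AE by (subst (asm) integral_nonneg_eq_0_iff_AE[OF that(1)]) (auto elim: eventually_mono)
      with AE have "AE y in (lborel :: (real^'n) measure). False" by eventually_elim auto
      then show False by (simp add: ae_filter_eq_bot_iff trivial_limit_def[symmetric])
    qed
    ultimately show ?thesis by simp
  qed
  have M1: "M1 > 0" unfolding M1_def by (rule pos[OF i1]) auto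
  have i2: "integrable lborel (\<lambda>y::real^'n. (norm y)\<^sup>2 * gauss y)"
    by (rule integrable_gauss_bound[of _ 1]) auto
  have i0: "integrable lborel (\<lambda>y::real^'n. 1 * gauss y)"
    by (rule integrable_gauss_bound[of _ 1]) auto
  have Zpos: "?Z > 0" using pos[OF i0] by (simp add: gauss_mass_def)
  have Mpos: "?M > 0" unfolding gauss_moment2_def using pos[OF i2] by simp
  \<comment> \<open>The weight |y| gauss y is the one for which
    \<open>norm y * (u (r *\<^sub>R sgn y) - m r)\<close> has Gaussian mean 0. As u (r sgn y)
    depends only on the direction of y, \<open>m r\<close> is the mean of u over the sphere of
    radius r.\<close>
  define m where "m r = (\<integral>y. (norm y * u (r *\<^sub>R sgn y)) * gauss (y::real^'n) \<partial>lborel) / M1" for r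
  have mm[measurable]: "m \<in> borel_measurable borel" unfolding m_def by measurable
  have mB: "\<bar>m r\<bar> \<le> B" for r
  proof -
    have "\<bar>\<integral>y. (norm y * u (r *\<^sub>R sgn y)) * gauss (y::real^'n) \<partial>lborel\<bar> \<le> (\<integral>y. B * (norm (y::real^'n) * gauss y) \<partial>lborel)"
    proof (rule integral_abs_bound_integral[OF iu])
      show "integrable lborel (\<lambda>y::real^'n. B * (norm y * gauss y))" using i1 by simp
      show "\<bar>norm y * u (r *\<^sub>R sgn y) * gauss y\<bar> \<le> B * (norm y * gauss y)" for y :: "real^'n"
        using mult_right_mono[OF B[of "r *\<^sub>R sgn y"], of "norm y * gauss y"]
        by (simp add: abs_mult gauss_nonneg mult_ac)
    qed
    also have "\<dots> = B * M1" by (simp add: M1_def)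
    finally show ?thesis using M1 by (simp add: m_def field_simps)
  qed
  define f where "f x = (u x - m (norm x))\<^sup>2" for x
  have am: "annular (\<lambda>x::real^'n. m (norm x))"
  proof -
    obtain d R where "d > 0" and R: "\<And>x. u x \<noteq> 0 \<Longrightarrow> d \<le> norm x \<and> norm x \<le> R"
      using au unfolding annular_def by blast
    have "d \<le> norm x \<and> norm x \<le> R" if "m (norm x) \<noteq> 0" for x :: "real^'n"
    proof (rule ccontr)
      assume c: "\<not> (d \<le> norm x \<and> norm x \<le> R)"
      have "(norm y * u (norm x *\<^sub>R sgn y)) = 0" for y :: "real^'n"
        using R[of "norm x *\<^sub>R sgn y"] c by (cases "y = 0") (auto simp: norm_sgn)
      then have "m (norm x) = 0" by (simp only: m_def mult_zero_left Bochner_Integration.integral_zero div_0)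
      with that show False by simp
    qed
    then show ?thesis unfolding annular_def using \<open>d > 0\<close> by blast
  qed
  have bm: "bdd_annular (\<lambda>x::real^'n. m (norm x))"
    unfolding bdd_annular_def using mB am by (auto intro!: exI[of _ B])
  have bf: "bdd_annular f" unfolding f_def[abs_def] by (intro bdd_annular_power2 bdd_annular_diff test_fun_bdd_annular[OF tu] bm)
  then have mf[measurable]: "f \<in> borel_measurable borel" unfolding bdd_annular_def by blast
  have f0: "f x \<ge> 0" for x by (simp add: f_def)
  let ?K = "?M / real CARD('n)"
  \<comment> \<open>The Gaussian inequality for the extension from the sphere of radius |x|, where
    W^2 = |y|^2 f and |\<Gamma>|^2 = f + Q, both evaluated at the point |x| sgn y.\<close>
  have key: "ennreal ?Z * (\<integral>\<^sup>+y. ennreal (f (norm x *\<^sub>R sgn y)) * ennreal ((norm y)\<^sup>2 * exp (- (norm (y::real^'n))\<^sup>2)) \<partial>lborel)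
    \<le> ennreal ?K * (\<integral>\<^sup>+y. ennreal (f (norm x *\<^sub>R sgn y) + Q (norm x *\<^sub>R sgn y)) * ennreal (exp (- (norm (y::real^'n))\<^sup>2)) \<partial>lborel)"
    for x :: "real^'n"
  proof -
    define r where "r = norm x"
    define W where "W y = norm y * (u (r *\<^sub>R sgn y) - m r)" for y :: "real^'n"
    define \<Gamma> where "\<Gamma> y = (u (r *\<^sub>R sgn y) - m r) *\<^sub>R sgn y
        + r *\<^sub>R (gu (r *\<^sub>R sgn y) - (sgn y \<bullet> gu (r *\<^sub>R sgn y)) *\<^sub>R sgn y)" for y :: "real^'n"
    have r0: "r \<ge> 0" by (simp add: r_def)
    have [measurable]: "W \<in> borel_measurable borel" "\<Gamma> \<in> borel_measurable borel"
      unfolding W_def \<Gamma>_def by measurable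
    have sg: "norm (sgn y) \<le> 1" for y :: "real^'n" by (simp add: norm_sgn)
    have csgn: "continuous_on (- {0}) (sgn :: real^'n \<Rightarrow> real^'n)"
      unfolding sgn_div_norm[abs_def] by (intro continuous_intros) auto
    have c1: "continuous_on (- {0}) (\<lambda>y::real^'n. u (r *\<^sub>R sgn y))"
      by (rule continuous_on_compose2[OF cu]) (auto intro!: continuous_intros csgn)
    have c2: "continuous_on (- {0}) (\<lambda>y::real^'n. gu (r *\<^sub>R sgn y))"
      by (rule continuous_on_compose2[OF cgu]) (auto intro!: continuous_intros csgn)
    define C where "C = 2 * B + r * (2 * G)"
    have u2: "\<bar>u z - m r\<bar> \<le> 2 * B" for z
      using B[of z] mB[of r] by linarith
    have gp: "gauss_mass TYPE(real^'n) * (\<integral>y. (W y)\<^sup>2 * gauss y \<partial>lborel)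
       \<le> ?K * (\<integral>y. (norm (\<Gamma> y))\<^sup>2 * gauss y \<partial>lborel)"
    proof (rule gaussian_poincare[OF n, where C = C])
      show "(W has_derivative (\<lambda>h. \<Gamma> y \<bullet> h)) (at y)" if "y \<noteq> 0" for y
        unfolding W_def[abs_def] \<Gamma>_def by (rule has_derivative_norm_scaled_angular[OF du that])
      show "continuous_on (- {0}) \<Gamma>" unfolding \<Gamma>_def[abs_def] by (intro continuous_intros c1 c2 csgn)
      show "\<bar>W y\<bar> \<le> C * norm y" for y
      proof -
        have "\<bar>W y\<bar> \<le> norm y * (2 * B)" unfolding W_def abs_mult using u2 by (intro mult_mono) auto
        also have "\<dots> \<le> norm y * C" using r0 G0 by (intro mult_left_mono) (auto simp: C_def)
        finally show ?thesis by (simp add: mult.commute)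
      qed
      show "norm (\<Gamma> y) \<le> C" for y
      proof -
        have a: "norm ((u (r *\<^sub>R sgn y) - m r) *\<^sub>R sgn y) \<le> 2 * B * 1"
          unfolding norm_scaleR using u2 sg B0 by (intro mult_mono) auto
        have "\<bar>sgn y \<bullet> gu (r *\<^sub>R sgn y)\<bar> \<le> 1 * G"
          by (rule order_trans[OF Cauchy_Schwarz_ineq2]) (intro mult_mono sg G; simp)
        then have "norm ((sgn y \<bullet> gu (r *\<^sub>R sgn y)) *\<^sub>R sgn y) \<le> G * 1"
          unfolding norm_scaleR using sg G0 by (intro mult_mono) auto
        then have "norm (gu (r *\<^sub>R sgn y) - (sgn y \<bullet> gu (r *\<^sub>R sgn y)) *\<^sub>R sgn y) \<le> 2 * G"
          using norm_triangle_ineq4[of "gu (r *\<^sub>R sgn y)" "(sgn y \<bullet> gu (r *\<^sub>R sgn y)) *\<^sub>R sgn y"] G[of "r *\<^sub>R sgn y"] by linarith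
        then have "norm (r *\<^sub>R (gu (r *\<^sub>R sgn y) - (sgn y \<bullet> gu (r *\<^sub>R sgn y)) *\<^sub>R sgn y)) \<le> r * (2 * G)"
          using r0 by (simp add: mult_left_mono)
        then show ?thesis unfolding \<Gamma>_def C_def using a norm_triangle_le[OF add_mono] by (smt (verit))
      qed
      have "(\<integral>y. W y * gauss y \<partial>lborel) = (\<integral>y. (norm y * u (r *\<^sub>R sgn y)) * gauss y - m r * (norm y * gauss y) \<partial>lborel)"
        by (simp add: W_def algebra_simps)
      also have "\<dots> = m r * M1 - m r * M1"
        using iu i1 M1 by (simp add: M1_def[symmetric] m_def)
      finally show "(\<integral>y. W y * gauss y \<partial>lborel) = 0" by simp
    qed measurable
    have bnd: "\<exists>C. \<forall>y::real^'n. \<bar>f (r *\<^sub>R sgn y) + Q (r *\<^sub>R sgn y)\<bar> \<le> C"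
      "\<exists>C. \<forall>y::real^'n. \<bar>f (r *\<^sub>R sgn y)\<bar> \<le> C"
      using bdd_annular_add[OF bf test_fun_bdd_annular[OF tQ]] bf unfolding bdd_annular_def by blast+
    have Wf: "AE y in lborel. (W y)\<^sup>2 * gauss y = f (r *\<^sub>R sgn y) * ((norm y)\<^sup>2 * gauss y)"
      using AE_lborel_singleton[of 0]
    proof eventually_elim
      case (elim y)
      then have "norm (r *\<^sub>R sgn y) = r" unfolding r_def by (rule norm_scaleR_sgn)
      then show ?case by (simp add: W_def f_def power_mult_distrib mult_ac del: norm_scaleR)
    qed
    have \<Gamma>f: "AE y in lborel. (norm (\<Gamma> y))\<^sup>2 * gauss y = (f (r *\<^sub>R sgn y) + Q (r *\<^sub>R sgn y)) * gauss y"
      using AE_lborel_singleton[of 0]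
    proof eventually_elim
      case (elim y)
      then have "norm (r *\<^sub>R sgn y) = r" unfolding r_def by (rule norm_scaleR_sgn)
      then show ?case unfolding \<Gamma>_def norm_angular_gradient_square[OF elim] by (simp add: f_def Q del: norm_scaleR)
    qed
    have iA: "integrable lborel (\<lambda>y::real^'n. (f (r *\<^sub>R sgn y) * (norm y)\<^sup>2) * gauss y)"
    proof -
      obtain C where C: "\<And>y::real^'n. \<bar>f (r *\<^sub>R sgn y)\<bar> \<le> C" using bnd(2) by blast
      show ?thesis
      proof (rule integrable_gauss_bound[of _ C])
        show "\<bar>f (r *\<^sub>R sgn y) * (norm y)\<^sup>2\<bar> \<le> C * (1 + (norm y)\<^sup>2)" for y :: "real^'n"
          unfolding abs_mult using C[of y] C[of 0] by (intro mult_mono) auto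
      qed measurable
    qed
    have iB: "integrable lborel (\<lambda>y::real^'n. (f (r *\<^sub>R sgn y) + Q (r *\<^sub>R sgn y)) * gauss y)"
    proof -
      obtain C where C: "\<And>y::real^'n. \<bar>f (r *\<^sub>R sgn y) + Q (r *\<^sub>R sgn y)\<bar> \<le> C" using bnd(1) by blast
      show ?thesis
      proof (rule integrable_gauss_bound[of _ C])
        show "\<bar>f (r *\<^sub>R sgn y) + Q (r *\<^sub>R sgn y)\<bar> \<le> C * (1 + (norm y)\<^sup>2)" for y :: "real^'n"
        proof -
          have "C \<ge> 0" using C[of 0] by linarith
          then have "C * 1 \<le> C * (1 + (norm y)\<^sup>2)" by (intro mult_left_mono) auto
          then show ?thesis using C[of y] by linarith
        qed
      qed measurable
    qed
    have A: "(\<integral>\<^sup>+y. ennreal (f (r *\<^sub>R sgn y)) * ennreal ((norm y)\<^sup>2 * exp (- (norm (y::real^'n))\<^sup>2)) \<partial>lborel)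
      = ennreal (\<integral>y. (W y)\<^sup>2 * gauss y \<partial>lborel)"
    proof -
      have "(\<integral>y. (W y)\<^sup>2 * gauss y \<partial>lborel) = (\<integral>y. (f (r *\<^sub>R sgn y) * (norm y)\<^sup>2) * gauss y \<partial>lborel)"
        using Wf by (intro integral_cong_AE) (auto simp: mult_ac)
      then show ?thesis
        by (simp add: nn_integral_eq_integral[OF iA, symmetric] f0 gauss_nonneg)
          (simp add: gauss_def ennreal_mult[symmetric] f0 mult_ac)
    qed
    have Bq: "(\<integral>\<^sup>+y. ennreal (f (r *\<^sub>R sgn y) + Q (r *\<^sub>R sgn y)) * ennreal (exp (- (norm (y::real^'n))\<^sup>2)) \<partial>lborel)
      = ennreal (\<integral>y. (norm (\<Gamma> y))\<^sup>2 * gauss y \<partial>lborel)"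
    proof -
      have "(\<integral>y. (norm (\<Gamma> y))\<^sup>2 * gauss y \<partial>lborel) = (\<integral>y. (f (r *\<^sub>R sgn y) + Q (r *\<^sub>R sgn y)) * gauss y \<partial>lborel)"
        using \<Gamma>f by (intro integral_cong_AE) auto
      moreover have "ennreal (f (r *\<^sub>R sgn y) + Q (r *\<^sub>R sgn y)) * ennreal (exp (- (norm y)\<^sup>2))
        = ennreal ((f (r *\<^sub>R sgn y) + Q (r *\<^sub>R sgn y)) * gauss y)" for y :: "real^'n"
        by (simp only: gauss_def ennreal_mult[symmetric] add_nonneg_nonneg f0 Q0 exp_ge_zero)
      ultimately show ?thesis
        by (simp only: nn_integral_eq_integral[OF iB] AE_I2 mult_nonneg_nonneg add_nonneg_nonneg f0 Q0 gauss_nonneg)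
    qed
    show ?thesis
      unfolding r_def[symmetric] A Bq
      using gp Zpos Mpos by (simp add: ennreal_mult'[symmetric] ennreal_leI)
  qed
  let ?w = "\<lambda>x::real^'n. ennreal (norm x powr (-\<beta>))"
  have "ennreal ?Z * (\<integral>\<^sup>+x. ?w x * (\<integral>\<^sup>+y. ennreal (f (norm x *\<^sub>R sgn y)) * ennreal ((norm y)\<^sup>2 * exp (- (norm (y::real^'n))\<^sup>2)) \<partial>lborel) \<partial>lborel)
    \<le> ennreal ?K * (\<integral>\<^sup>+x. ?w x * (\<integral>\<^sup>+y. ennreal (f (norm x *\<^sub>R sgn y) + Q (norm x *\<^sub>R sgn y)) * ennreal (exp (- (norm (y::real^'n))\<^sup>2)) \<partial>lborel) \<partial>lborel)"
    (is "ennreal ?Z * (\<integral>\<^sup>+x. ?w x * ?F x \<partial>lborel) \<le> ennreal ?K * (\<integral>\<^sup>+x. ?w x * ?H x \<partial>lborel)")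
  proof -
    have [measurable]: "?F \<in> borel_measurable borel" "?H \<in> borel_measurable borel" by measurable
    have "ennreal ?Z * (\<integral>\<^sup>+x. ?w x * ?F x \<partial>lborel) = (\<integral>\<^sup>+x. ennreal ?Z * (?w x * ?F x) \<partial>lborel)"
      by (rule nn_integral_cmult[symmetric]) measurable
    also have "\<dots> \<le> (\<integral>\<^sup>+x. ennreal ?K * (?w x * ?H x) \<partial>lborel)"
    proof (rule nn_integral_mono)
      fix x show "ennreal ?Z * (?w x * ?F x) \<le> ennreal ?K * (?w x * ?H x)"
        using mult_left_mono[OF key[of x] zero_le, of "?w x"] by (simp only: mult_ac)
    qed
    also have "\<dots> = ennreal ?K * (\<integral>\<^sup>+x. ?w x * ?H x \<partial>lborel)"
      by (rule nn_integral_cmult) measurable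
    finally show ?thesis .
  qed
  \<comment> \<open>The kernels t^2 exp (- t^2) and exp (- t^2) produce the second moment M and the
    mass Z; each meets the other one among the factors Z and M / n already present.\<close>
  also have "(\<integral>\<^sup>+x. ?w x * ?F x \<partial>lborel)
     = (\<integral>\<^sup>+y. ennreal ((norm y)\<^sup>2 * exp (- (norm (y::real^'n))\<^sup>2)) \<partial>lborel) * (\<integral>\<^sup>+y. ennreal (f y) * ?w y \<partial>lborel)"
    by (rule nn_integral_polar[of "\<lambda>x. ennreal (f x)" "\<lambda>t. ennreal (t\<^sup>2 * exp (- t\<^sup>2))"]) measurable
  also have "(\<integral>\<^sup>+x. ?w x * ?H x \<partial>lborel)
     = (\<integral>\<^sup>+y. ennreal (exp (- (norm (y::real^'n))\<^sup>2)) \<partial>lborel) * (\<integral>\<^sup>+y. ennreal (f y + Q y) * ?w y \<partial>lborel)"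
    by (rule nn_integral_polar[of "\<lambda>x. ennreal (f x + Q x)" "\<lambda>t. ennreal (exp (- t\<^sup>2))"]) measurable
  also have "(\<integral>\<^sup>+y. ennreal ((norm y)\<^sup>2 * exp (- (norm (y::real^'n))\<^sup>2)) \<partial>lborel) = ennreal ?M"
    unfolding gauss_moment2_def nn_integral_eq_integral[OF i2, symmetric, simplified gauss_nonneg]
    by (subst nn_integral_eq_integral[OF i2, symmetric]) (auto simp: gauss_def)
  also have "(\<integral>\<^sup>+y. ennreal (exp (- (norm (y::real^'n))\<^sup>2)) \<partial>lborel) = ennreal ?Z"
    using nn_integral_eq_integral[OF i0] by (simp add: gauss_mass_def gauss_def)
  also have "(\<integral>\<^sup>+y. ennreal (f y) * ?w y \<partial>lborel) = ennreal (wint \<beta> f)"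
    unfolding wint_def
    by (subst nn_integral_eq_integral[OF bdd_annular_integrable[OF bf], symmetric]) (auto simp: f0 ennreal_mult)
  also have "(\<integral>\<^sup>+y. ennreal (f y + Q y) * ?w y \<partial>lborel) = ennreal (wint \<beta> (\<lambda>x. f x + Q x))"
    unfolding wint_def
    by (subst nn_integral_eq_integral[OF bdd_annular_integrable[OF bdd_annular_add[OF bf test_fun_bdd_annular[OF tQ]]], symmetric])
      (auto simp: f0 Q0 ennreal_mult)
  finally have "ennreal (?Z * (?M * wint \<beta> f)) \<le> ennreal (?K * (?Z * wint \<beta> (\<lambda>x. f x + Q x)))"
    using Zpos Mpos wint_nonneg[of f \<beta>, OF f0] wint_nonneg[of "\<lambda>x. f x + Q x" \<beta>] f0 Q0
    by (simp add: ennreal_mult del: times_divide_eq_left)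
  then have "?Z * (?M * wint \<beta> f) \<le> ?K * (?Z * wint \<beta> (\<lambda>x. f x + Q x))"
    using Zpos Mpos wint_nonneg[of "\<lambda>x. f x + Q x" \<beta>] f0 Q0 by (subst (asm) ennreal_le_iff) auto
  also have "\<dots> = ?Z * (?M * (wint \<beta> (\<lambda>x. f x + Q x) / real CARD('n)))" by simp
  \<comment> \<open>With Z M cancelled, n times the integral of f is at most that of f + Q; the
    summand f accounts for the drop from n to n - 1.\<close>
  finally have "wint \<beta> f \<le> wint \<beta> (\<lambda>x. f x + Q x) / real CARD('n)"
    using Zpos Mpos by (simp only: mult_le_cancel_left_pos)
  moreover have "wint \<beta> (\<lambda>x. f x + Q x) = wint \<beta> f + wint \<beta> Q"
    by (rule wint_add[OF bf test_fun_bdd_annular[OF tQ]])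
  ultimately have "(real CARD('n) - 1) * wint \<beta> f \<le> wint \<beta> Q"
    using n by (simp add: field_simps)
  then show thesis using that[OF mm bm] by (simp only: f_def[abs_def])
qed

subsection \<open>Hardy inequalities and the expansion of the square\<close>

text \<open>The strict bound R < 1 keeps the support away from the unit sphere, where ln |x|
  vanishes.\<close>

definition unit_annular :: "('a::real_normed_vector \<Rightarrow> real) \<Rightarrow> bool" where
  "unit_annular f \<longleftrightarrow> (\<exists>d>0. \<exists>R<1. \<forall>x. f x \<noteq> 0 \<longrightarrow> d \<le> norm x \<and> norm x \<le> R)"

lemma unit_annular_annular: "unit_annular f \<Longrightarrow> annular f"
  unfolding unit_annular_def annular_def by blast

text \<open>Continuity is glued from two open sets that cover the space: the punctured unit ball,
  where ln |x| is continuous and nonzero, and the complement of the closed annulus, where the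
  product is 0.\<close>

lemma test_fun_times_ln_power:
  fixes f :: "'a::euclidean_space \<Rightarrow> real"
  assumes f: "continuous_on UNIV f" and u: "unit_annular f"
  shows "test_fun (\<lambda>x. f x * (inverse (ln (norm x))) ^ k)"
  unfolding test_fun_def
proof
  show "annular (\<lambda>x. f x * (inverse (ln (norm x))) ^ k)"
    by (rule annular_mult1[OF unit_annular_annular[OF u]])
  from u obtain d R where d: "d > 0" and R1: "R < 1" and R: "\<And>x. f x \<noteq> 0 \<Longrightarrow> d \<le> norm x \<and> norm x \<le> R"
    unfolding unit_annular_def by blast
  let ?A = "{x::'a. 0 < norm x \<and> norm x < 1}" and ?B = "{x::'a. norm x < d \<or> R < norm x}"
  have oA: "open ?A" by (intro open_Collect_conj open_Collect_less continuous_intros)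
  have oB: "open ?B" by (intro open_Collect_disj open_Collect_less continuous_intros)
  have cA: "continuous_on ?A (\<lambda>x. f x * (inverse (ln (norm x))) ^ k)"
    by (intro continuous_intros continuous_on_subset[OF f]) (auto simp: ln_eq_zero_iff)
  have cB: "continuous_on ?B (\<lambda>x. f x * (inverse (ln (norm x))) ^ k)"
  proof (rule continuous_on_eq[of _ "\<lambda>_. 0"])
    show "0 = f x * (inverse (ln (norm x))) ^ k" if "x \<in> ?B" for x using that R[of x] by (cases "f x = 0") auto
  qed simp
  have "?A \<union> ?B = UNIV" using d R1 by auto
  then show "continuous_on UNIV (\<lambda>x. f x * (inverse (ln (norm x))) ^ k)"
    using continuous_on_open_Un[OF oA oB cA cB] by simp
qed

text \<open>Dilation by e^t translates ln |x| by t, so E maps (ln |x|)^(-k) to - k (ln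
  |x|)^(-k-1).\<close>

lemma flow_deriv_times_ln_power:
  fixes f :: "'a::euclidean_space \<Rightarrow> real"
  assumes fd: "dil.flow_deriv f g" and u: "unit_annular f" and ug: "unit_annular g"
  shows "dil.flow_deriv (\<lambda>x. f x * (inverse (ln (norm x))) ^ k)
     (\<lambda>x. g x * (inverse (ln (norm x))) ^ k - real k * (f x * (inverse (ln (norm x))) ^ Suc k))"
  unfolding dil.flow_deriv_def
proof (intro conjI allI)
  have c: "continuous_on UNIV f" "continuous_on UNIV g" using fd unfolding dil.flow_deriv_def test_fun_def by auto
  show "test_fun (\<lambda>x. f x * (inverse (ln (norm x))) ^ k)" by (rule test_fun_times_ln_power[OF c(1) u])
  show "test_fun (\<lambda>x. g x * (inverse (ln (norm x))) ^ k - real k * (f x * (inverse (ln (norm x))) ^ Suc k))"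
    by (intro test_fun_diff test_fun_cmult test_fun_times_ln_power c u ug)
  fix x :: 'a
  show "((\<lambda>t. f (dil t x) * (inverse (ln (norm (dil t x)))) ^ k) has_real_derivative
     g x * (inverse (ln (norm x))) ^ k - real k * (f x * (inverse (ln (norm x))) ^ Suc k)) (at 0)"
  proof (cases "0 < norm x \<and> norm x < 1")
    case True
    have fx: "((\<lambda>t. f (dil t x)) has_real_derivative g x) (at 0)" using fd by (simp add: dil.flow_deriv_def)
    have ln: "ln (norm (dil t x)) = t + ln (norm x)" for t
      using True by (simp add: dil_def ln_mult)
    have nz: "ln (norm x) \<noteq> 0" using True by (simp add: ln_eq_zero_iff)
    have *: "((\<lambda>t. inverse (t + ln (norm x))) has_real_derivative - (inverse (ln (norm x)) * 1 * inverse (ln (norm x)))) (at 0)"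
      using nz by (auto intro!: derivative_eq_intros)
    have "((\<lambda>t. f (dil t x) * (inverse (t + ln (norm x))) ^ k) has_real_derivative
      g x * (inverse (0 + ln (norm x))) ^ k
       + real k * (- (inverse (ln (norm x)) * 1 * inverse (ln (norm x))) * inverse (0 + ln (norm x)) ^ (k - Suc 0)) * f (dil 0 x)) (at 0)"
      by (rule DERIV_mult[OF fx DERIV_power[OF *]])
    then show ?thesis
      unfolding ln
      by (rule DERIV_cong) (cases k; simp add: dil_def algebra_simps)
  next
    case False
    from u obtain d R where d: "d > 0" and R1: "R < 1" and R: "\<And>x. f x \<noteq> 0 \<Longrightarrow> d \<le> norm x \<and> norm x \<le> R"
      unfolding unit_annular_def by blast
    have fx0: "f x = 0" using R[of x] d R1 False by force
    have gx0: "g x = 0" using ug False unfolding unit_annular_def by force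
    have "\<forall>\<^sub>F t in nhds 0. f (dil t x) * (inverse (ln (norm (dil t x)))) ^ k = 0"
    proof -
      have "continuous_on UNIV (\<lambda>t::real. norm (dil t x))" unfolding dil_def by (intro continuous_intros)
      then have "isCont (\<lambda>t::real. norm (dil t x)) 0" by (simp add: continuous_on_eq_continuous_at)
      then have tt: "((\<lambda>t::real. norm (dil t x)) \<longlongrightarrow> norm x) (nhds 0)"
        unfolding continuous_at by (simp add: dil_def tendsto_nhds_iff)
      have "norm x < d \<or> R < norm x" using False d R1 by force
      then have "\<forall>\<^sub>F t::real in nhds 0. norm (dil t x) < d \<or> R < norm (dil t x)"
      proof
        assume "norm x < d"
        from order_tendstoD(2)[OF tt this] show ?thesis by (rule eventually_mono) simp
      next
        assume "R < norm x"
        from order_tendstoD(1)[OF tt this] show ?thesis by (rule eventually_mono) simp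
      qed
      then show ?thesis by (rule eventually_mono) (use R in force)
    qed
    then have "((\<lambda>t. f (dil t x) * (inverse (ln (norm (dil t x)))) ^ k) has_real_derivative 0) (at 0)
      \<longleftrightarrow> ((\<lambda>t. 0) has_real_derivative 0) (at (0::real))"
      by (intro DERIV_cong_ev) auto
    then show ?thesis by (simp add: fx0 gx0)
  qed
qed

text \<open>In the variable ln |x| this is a Hardy inequality on the line. Antisymmetry applied to f
  (ln |x|)^(-k) and f (ln |x|)^(-k-1) brings in k and k + 1 from the two powers, so the integral of
  H F is (2 k + 1) / 2 times that of F^2. Nonnegativity of the integral of (H - (2 k + 1) / 2 F)^2
  then gives the bound. The cases k = 0 and k = 1 have constants 1/4 and 9/4.\<close>

lemma weighted_log_hardy:
  fixes f :: "'a::euclidean_space \<Rightarrow> real"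
  assumes fd: "dil.flow_deriv f g" and u: "unit_annular f" and ug: "unit_annular g"
    and a: "2 * a = \<beta> - real DIM('a)" and h: "\<And>x. h x = g x - a * f x"
  shows "wint \<beta> (\<lambda>x. (h x * inverse (ln (norm x)) ^ k)\<^sup>2)
    \<ge> ((2 * real k + 1) / 2)\<^sup>2 * wint \<beta> (\<lambda>x. (f x * inverse (ln (norm x)) ^ Suc k)\<^sup>2)"
proof -
  let ?\<sigma> = "\<lambda>x::'a. inverse (ln (norm x))"
  let ?c = "(2 * real k + 1) / 2"
  have c: "continuous_on UNIV f" "continuous_on UNIV g" using fd unfolding dil.flow_deriv_def test_fun_def by auto
  note tf = test_fun_times_ln_power[OF c(1) u] and tg = test_fun_times_ln_power[OF c(2) ug]
  have th: "test_fun (\<lambda>x. h x * ?\<sigma> x ^ j)" for j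
  proof -
    have "(\<lambda>x. h x * ?\<sigma> x ^ j) = (\<lambda>x. g x * ?\<sigma> x ^ j - a * (f x * ?\<sigma> x ^ j))"
      by (simp add: h algebra_simps)
    then show ?thesis using test_fun_diff[OF tg test_fun_cmult[OF tf]] by simp
  qed
  define F where "F x = f x * ?\<sigma> x ^ Suc k" for x
  define H where "H x = h x * ?\<sigma> x ^ k" for x
  have tF: "test_fun F" and tH: "test_fun H" unfolding F_def[abs_def] H_def[abs_def] by (rule tf th)+
  have "wint \<beta> (\<lambda>x. (g x * ?\<sigma> x ^ k - real k * (f x * ?\<sigma> x ^ Suc k) - a * (f x * ?\<sigma> x ^ k)) * (f x * ?\<sigma> x ^ Suc k))
    = - wint \<beta> (\<lambda>x. f x * ?\<sigma> x ^ k * ((g x * ?\<sigma> x ^ Suc k - real (Suc k) * (f x * ?\<sigma> x ^ Suc (Suc k))) - a * (f x * ?\<sigma> x ^ Suc k)))"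
    by (rule wint_dil_antisym[OF flow_deriv_times_ln_power[OF assms(1-3)] flow_deriv_times_ln_power[OF assms(1-3)] a])
  moreover have "(g x * ?\<sigma> x ^ k - real k * (f x * ?\<sigma> x ^ Suc k) - a * (f x * ?\<sigma> x ^ k)) * (f x * ?\<sigma> x ^ Suc k)
    = H x * F x - real k * (F x * F x)" for x
    by (simp add: H_def F_def h algebra_simps)
  moreover have "f x * ?\<sigma> x ^ k * ((g x * ?\<sigma> x ^ Suc k - real (Suc k) * (f x * ?\<sigma> x ^ Suc (Suc k))) - a * (f x * ?\<sigma> x ^ Suc k))
    = H x * F x - real (Suc k) * (F x * F x)" for x
    by (simp add: H_def F_def h algebra_simps)
  ultimately have "wint \<beta> (\<lambda>x. H x * F x - real k * (F x * F x)) = - wint \<beta> (\<lambda>x. H x * F x - real (Suc k) * (F x * F x))"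
    by simp
  then have HF: "wint \<beta> (\<lambda>x. H x * F x) = ?c * wint \<beta> (\<lambda>x. F x * F x)"
    by (simp only: wint_diff wint_cmult test_fun_bdd_annular test_fun_mult test_fun_cmult tF tH) (simp add: algebra_simps)
  have "0 \<le> wint \<beta> (\<lambda>x. (H x - ?c * F x)\<^sup>2)" by (rule wint_nonneg) simp
  also have "(\<lambda>x. (H x - ?c * F x)\<^sup>2) = (\<lambda>x. H x * H x + (?c * ?c) * (F x * F x) - (2 * ?c) * (H x * F x))"
  proof
    have "(s - b * t)\<^sup>2 = s * s + (b * b) * (t * t) - (2 * b) * (s * t)" for s b t :: real
      by (simp add: power2_eq_square algebra_simps)
    then show "(H x - ?c * F x)\<^sup>2 = H x * H x + (?c * ?c) * (F x * F x) - (2 * ?c) * (H x * F x)" for x .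
  qed
  also have "wint \<beta> \<dots> = wint \<beta> (\<lambda>x. H x * H x) + (?c * ?c) * wint \<beta> (\<lambda>x. F x * F x) - (2 * ?c) * wint \<beta> (\<lambda>x. H x * F x)"
    by (simp only: wint_diff wint_add wint_cmult test_fun_bdd_annular test_fun_mult test_fun_cmult test_fun_add tF tH)
  finally have "?c * ?c * wint \<beta> (\<lambda>x. F x * F x) \<le> wint \<beta> (\<lambda>x. H x * H x)"
    unfolding HF by (simp only: mult.assoc)
  then show ?thesis unfolding H_def F_def by (simp only: power2_eq_square)
qed

section \<open>Angular pairings and the expanded square\<close>

lemma wint_times_sum2:
  fixes f :: "'a::euclidean_space \<Rightarrow> real" and g :: "'n::finite \<Rightarrow> 'n \<Rightarrow> 'a \<Rightarrow> real"
  assumes f: "bdd_annular f" and g: "\<And>i j. bdd_annular (g i j)"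
    and \<Lambda>: "\<And>x. \<Lambda> x = (1/2) * (\<Sum>i\<in>UNIV. \<Sum>j\<in>UNIV. g i j x)"
  shows "wint \<beta> (\<lambda>x. f x * \<Lambda> x) = (1/2) * (\<Sum>i\<in>UNIV. \<Sum>j\<in>UNIV. wint \<beta> (\<lambda>x. f x * g i j x))"
proof -
  have b: "bdd_annular (\<lambda>x. f x * g i j x)" for i j by (intro bdd_annular_mult f g)
  have bs: "bdd_annular (\<lambda>x. \<Sum>j\<in>UNIV. f x * g i j x)" for i
    by (rule bdd_annular_sum) (rule b)
  have "wint \<beta> (\<lambda>x. f x * \<Lambda> x) = wint \<beta> (\<lambda>x. (1/2) * (\<Sum>i\<in>UNIV. \<Sum>j\<in>UNIV. f x * g i j x))"
    by (simp add: \<Lambda> sum_distrib_left mult_ac)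
  also have "\<dots> = (1/2) * (\<Sum>i\<in>UNIV. \<Sum>j\<in>UNIV. wint \<beta> (\<lambda>x. f x * g i j x))"
    by (simp only: wint_cmult wint_sum[OF b] wint_sum[OF bs])
  finally show ?thesis .
qed

text \<open>The rotation derivative of u times \<open>l i j\<close> integrates to 0, so each L_ij
  moves to the other factor with a change of sign.\<close>

lemma wint_angular_parts:
  fixes u :: "real^'n \<Rightarrow> real"
  assumes l: "\<And>i j. rot.flow_deriv i j u (l i j)" and ll: "\<And>i j. rot.flow_deriv i j (l i j) (ll i j)"
    and \<Lambda>: "\<And>x. \<Lambda> x = (1/2) * (\<Sum>i\<in>UNIV. \<Sum>j\<in>UNIV. ll i j x)"
    and Q: "\<And>x. Q x = (1/2) * (\<Sum>i\<in>UNIV. \<Sum>j\<in>UNIV. (l i j x)\<^sup>2)"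
  shows "wint \<beta> (\<lambda>x. u x * \<Lambda> x) = - wint \<beta> Q"
proof -
  have tu: "test_fun u" using l[of undefined undefined] by (simp add: rot.flow_deriv_def)
  have tl: "test_fun (l i j)" "test_fun (ll i j)" for i j using ll[of i j] by (auto simp: rot.flow_deriv_def)
  have bl: "bdd_annular (\<lambda>x. (l i j x)\<^sup>2)" for i j by (intro test_fun_bdd_annular test_fun_power2 tl)
  have "wint \<beta> (\<lambda>x. u x * ll i j x) = - wint \<beta> (\<lambda>x. (l i j x)\<^sup>2)" for i j
  proof -
    have "wint \<beta> (\<lambda>x. l i j x * l i j x + u x * ll i j x) = 0"
      by (rule wint_rot_flow_deriv[OF rot.flow_deriv_mult[OF l ll]])
    then show ?thesis
      by (simp add: wint_add test_fun_bdd_annular test_fun_mult tu tl power2_eq_square)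
  qed
  then have "wint \<beta> (\<lambda>x. u x * \<Lambda> x) = - ((1/2) * (\<Sum>i\<in>UNIV. \<Sum>j\<in>UNIV. wint \<beta> (\<lambda>x. (l i j x)\<^sup>2)))"
    by (simp add: wint_times_sum2[OF test_fun_bdd_annular[OF tu] test_fun_bdd_annular[OF tl(2)] \<Lambda>] sum_negf)
  also have "(1/2) * (\<Sum>i\<in>UNIV. \<Sum>j\<in>UNIV. wint \<beta> (\<lambda>x. (l i j x)\<^sup>2)) = wint \<beta> Q"
    unfolding Q[abs_def]
    by (simp only: wint_cmult wint_sum[OF bl] wint_sum[OF bdd_annular_sum[OF bl]])
  finally show ?thesis .
qed

text \<open>The operators are antisymmetric ($u_1 - a u$) or symmetric ($\Lambda$) for the weight, so all
  mixed terms of the square cancel or have a sign.\<close>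

lemma rellich_core:
  fixes u u1 u2 :: "real^'n \<Rightarrow> real" and l ll :: "'n \<Rightarrow> 'n \<Rightarrow> real^'n \<Rightarrow> real"
  assumes u: "dil.flow_deriv u u1" and u1: "dil.flow_deriv u1 u2"
    and ua: "unit_annular u" and u1a: "unit_annular u1" and u2a: "unit_annular u2"
    and l: "\<And>i j. rot.flow_deriv i j u (l i j)" and ll: "\<And>i j. rot.flow_deriv i j (l i j) (ll i j)"
    and a: "2 * a = \<beta> - real CARD('n)"
    and \<Lambda>: "\<And>x. \<Lambda> x = (1/2) * (\<Sum>i\<in>UNIV. \<Sum>j\<in>UNIV. ll i j x)"
    and Q: "\<And>x. Q x = (1/2) * (\<Sum>i\<in>UNIV. \<Sum>j\<in>UNIV. (l i j x)\<^sup>2)"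
    and gap: "wint \<beta> (\<lambda>x. (\<Lambda> x)\<^sup>2) \<ge> (real CARD('n) - 1) * wint \<beta> Q"
    and cond: "b * (2 * a + b) \<le> real CARD('n) - 1"
  shows "wint \<beta> (\<lambda>x. (u2 x + (b - a) * u1 x + \<Lambda> x)\<^sup>2)
    \<ge> b\<^sup>2 * wint \<beta> (\<lambda>x. (u1 x)\<^sup>2 + Q x)
      + a\<^sup>2 / 4 * wint \<beta> (\<lambda>x. (u x * inverse (ln (norm x)))\<^sup>2)
      + 9 / 16 * wint \<beta> (\<lambda>x. (u x * (inverse (ln (norm x)))\<^sup>2)\<^sup>2)"
proof -
  have a': "2 * a = \<beta> - real DIM(real^'n)" using a by simp
  define p where "p x = u1 x - a * u x" for x
  define s where "s x = (u2 x - a * u1 x) - a * p x" for x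
  have pd: "dil.flow_deriv p (\<lambda>x. u2 x - a * u1 x)"
    using dil.flow_deriv_diff[OF u1 dil.flow_deriv_cmult[OF u, of a]] by (simp add: p_def[abs_def])
  have tu: "test_fun u" "test_fun u1" "test_fun u2" "test_fun p" using u u1 pd by (auto simp: dil.flow_deriv_def)
  have ts: "test_fun s" unfolding s_def[abs_def] by (intro test_fun_diff test_fun_cmult tu)
  have tl: "test_fun (l i j)" "test_fun (ll i j)" for i j using ll[of i j] by (auto simp: rot.flow_deriv_def)
  have t\<Lambda>: "test_fun \<Lambda>" unfolding \<Lambda>[abs_def] by (intro test_fun_cmult test_fun_sum tl)
  have tQ: "test_fun Q" unfolding Q[abs_def] by (intro test_fun_cmult test_fun_sum test_fun_power2 tl)
  note pairing = wint_times_sum2[OF test_fun_bdd_annular test_fun_bdd_annular[OF tl(2)] \<Lambda>]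
  note ra = wint_radial_angular[OF u u1 l ll a p_def s_def]
  have p\<Lambda>: "wint \<beta> (\<lambda>x. p x * \<Lambda> x) = 0"
    by (simp add: pairing[OF tu(4)] ra(1))
  have s\<Lambda>: "wint \<beta> (\<lambda>x. s x * \<Lambda> x) \<ge> 0"
    by (simp add: pairing[OF ts] ra(2) sum_nonneg)
  note u\<Lambda> = wint_angular_parts[OF l ll \<Lambda> Q]
  have ps: "wint \<beta> (\<lambda>x. p x * s x) = 0"
    using wint_dil_antisym[OF pd pd a'] by (simp add: s_def mult.commute)
  have us: "wint \<beta> (\<lambda>x. u x * s x) = - wint \<beta> (\<lambda>x. p x * p x)"
    using wint_dil_antisym[OF u pd a'] by (simp add: p_def s_def)
  have up: "wint \<beta> (\<lambda>x. u x * p x) = 0"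
    using wint_dil_antisym[OF u u a'] by (simp add: p_def mult.commute)
  let ?I = "wint \<beta>"
  have bm: "test_fun f \<Longrightarrow> test_fun g \<Longrightarrow> bdd_annular (\<lambda>x. c * (f x * g x))" for f g and c :: real
    by (intro bdd_annular_cmult test_fun_bdd_annular test_fun_mult)
  have bm1: "test_fun f \<Longrightarrow> test_fun g \<Longrightarrow> bdd_annular (\<lambda>x. f x * g x)" for f g :: "real^'n \<Rightarrow> real"
    by (intro test_fun_bdd_annular test_fun_mult)
  have "?I (\<lambda>x. (u2 x + (b - a) * u1 x + \<Lambda> x)\<^sup>2) = ?I (\<lambda>x. 1 * (s x * s x) + (a+b)\<^sup>2 * (p x * p x)
     + (a*b)\<^sup>2 * (u x * u x) + 1 * (\<Lambda> x * \<Lambda> x) + (2*(a+b)) * (p x * s x) + (2*a*b) * (u x * s x)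
     + 2 * (s x * \<Lambda> x) + (2*(a+b)*(a*b)) * (u x * p x) + (2*(a+b)) * (p x * \<Lambda> x) + (2*a*b) * (u x * \<Lambda> x))"
  proof (rule arg_cong[where f="wint \<beta>"], rule ext)
    fix x
    \<comment> \<open>E^2 + (b - a) E = (E - a)^2 + (a + b)(E - a) + a b; in the variables s, p, u
      every mixed integral is either computed or has a sign.\<close>
    have e: "u2 x + (b - a) * u1 x + \<Lambda> x = s x + (a + b) * p x + a * b * u x + \<Lambda> x"
      by (simp add: s_def p_def algebra_simps)
    show "(u2 x + (b - a) * u1 x + \<Lambda> x)\<^sup>2 = 1 * (s x * s x) + (a+b)\<^sup>2 * (p x * p x)
     + (a*b)\<^sup>2 * (u x * u x) + 1 * (\<Lambda> x * \<Lambda> x) + (2*(a+b)) * (p x * s x) + (2*a*b) * (u x * s x)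
     + 2 * (s x * \<Lambda> x) + (2*(a+b)*(a*b)) * (u x * p x) + (2*(a+b)) * (p x * \<Lambda> x) + (2*a*b) * (u x * \<Lambda> x)"
      unfolding e by (simp add: power2_eq_square algebra_simps)
  qed
  also have "\<dots> = ?I (\<lambda>x. s x * s x) + (a+b)\<^sup>2 * ?I (\<lambda>x. p x * p x)
     + (a*b)\<^sup>2 * ?I (\<lambda>x. u x * u x) + ?I (\<lambda>x. \<Lambda> x * \<Lambda> x) + (2*(a+b)) * ?I (\<lambda>x. p x * s x) + (2*a*b) * ?I (\<lambda>x. u x * s x)
     + 2 * ?I (\<lambda>x. s x * \<Lambda> x) + (2*(a+b)*(a*b)) * ?I (\<lambda>x. u x * p x) + (2*(a+b)) * ?I (\<lambda>x. p x * \<Lambda> x) + (2*a*b) * ?I (\<lambda>x. u x * \<Lambda> x)"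
    by (simp only: wint_add wint_cmult bdd_annular_add bm bm1 tu ts t\<Lambda> mult_1)
  finally have T: "?I (\<lambda>x. (u2 x + (b - a) * u1 x + \<Lambda> x)\<^sup>2) = ?I (\<lambda>x. s x * s x) + (a+b)\<^sup>2 * ?I (\<lambda>x. p x * p x)
     + (a*b)\<^sup>2 * ?I (\<lambda>x. u x * u x) + ?I (\<lambda>x. \<Lambda> x * \<Lambda> x) - 2*a*b * ?I (\<lambda>x. p x * p x)
     + 2 * ?I (\<lambda>x. s x * \<Lambda> x) - 2*a*b * ?I Q"
    unfolding ps us up p\<Lambda> u\<Lambda> by simp
  have "?I (\<lambda>x. (u1 x)\<^sup>2 + Q x) = ?I (\<lambda>x. 1 * (p x * p x) + (2*a) * (u x * p x) + a\<^sup>2 * (u x * u x) + Q x)"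
    by (rule arg_cong[where f="wint \<beta>"], rule ext) (simp add: p_def power2_eq_square algebra_simps)
  also have "\<dots> = ?I (\<lambda>x. p x * p x) + (2*a) * ?I (\<lambda>x. u x * p x) + a\<^sup>2 * ?I (\<lambda>x. u x * u x) + ?I Q"
    by (simp only: wint_add wint_cmult bdd_annular_add bm bm1 tu test_fun_bdd_annular[OF tQ] mult_1)
  finally have G: "?I (\<lambda>x. (u1 x)\<^sup>2 + Q x) = ?I (\<lambda>x. p x * p x) + a\<^sup>2 * ?I (\<lambda>x. u x * u x) + ?I Q"
    unfolding up by simp
  have Q0: "?I Q \<ge> 0" by (rule wint_nonneg) (simp add: Q sum_nonneg)
  have lam: "?I (\<lambda>x. \<Lambda> x * \<Lambda> x) \<ge> b * (2 * a + b) * ?I Q"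
    using gap mult_right_mono[OF cond Q0] by (simp add: power2_eq_square)
  have unit_comb: "unit_annular (\<lambda>x. f x - c * g x)" if "unit_annular f" "unit_annular g" for f g :: "real^'n \<Rightarrow> real" and c
  proof -
    from that obtain d1 R1 d2 R2 where "d1 > 0" "d2 > 0" "R1 < 1" "R2 < 1"
      and 1: "\<And>x. f x \<noteq> 0 \<Longrightarrow> d1 \<le> norm x \<and> norm x \<le> R1"
      and 2: "\<And>x. g x \<noteq> 0 \<Longrightarrow> d2 \<le> norm x \<and> norm x \<le> R2"
      unfolding unit_annular_def by metis
    have "min d1 d2 \<le> norm x \<and> norm x \<le> max R1 R2" if "f x - c * g x \<noteq> 0" for x
    proof (cases "f x = 0")
      case True
      then have "g x \<noteq> 0" using that by auto
      then show ?thesis using 2[of x] by auto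
    next
      case False then show ?thesis using 1[of x] by auto
    qed
    then show ?thesis unfolding unit_annular_def using \<open>d1 > 0\<close> \<open>d2 > 0\<close> \<open>R1 < 1\<close> \<open>R2 < 1\<close>
      by (intro exI[of _ "min d1 d2"] conjI exI[of _ "max R1 R2"]) auto
  qed
  have pa: "unit_annular p" unfolding p_def[abs_def] by (rule unit_comb[OF u1a ua])
  have p1a: "unit_annular (\<lambda>x. u2 x - a * u1 x)" by (rule unit_comb[OF u2a u1a])
  have H1: "?I (\<lambda>x. p x * p x) \<ge> 1/4 * ?I (\<lambda>x. (u x * inverse (ln (norm x)))\<^sup>2)"
    using weighted_log_hardy[OF u ua u1a a' p_def, of 0] by (simp add: power2_eq_square)
  have H2: "?I (\<lambda>x. s x * s x) \<ge> 1/4 * ?I (\<lambda>x. (p x * inverse (ln (norm x)))\<^sup>2)"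
    using weighted_log_hardy[OF pd pa p1a a' s_def, of 0] by (simp add: power2_eq_square)
  have H3: "?I (\<lambda>x. (p x * inverse (ln (norm x)))\<^sup>2) \<ge> 9/4 * ?I (\<lambda>x. (u x * (inverse (ln (norm x)))\<^sup>2)\<^sup>2)"
    using weighted_log_hardy[OF u ua u1a a' p_def, of 1] by (simp add: power2_eq_square)
  have H1': "a\<^sup>2 * (1/4 * ?I (\<lambda>x. (u x * inverse (ln (norm x)))\<^sup>2)) \<le> a\<^sup>2 * ?I (\<lambda>x. p x * p x)"
    by (rule mult_left_mono[OF H1]) simp
  \<comment> \<open>The coefficient of the p-term is (a + b)^2 - 2 a b = a^2 + b^2: b^2 goes to the
    gradient and a^2 feeds the first logarithmic term. For Q, the split - 2 a b = b^2 - b (2 a + b)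
    separates the share of the gradient from the part that the spectral gap absorbs.\<close>
  have arith: "b\<^sup>2 * (Ip + a\<^sup>2 * Iu + IQ) + a\<^sup>2 / 4 * H + 9 / 16 * K
      \<le> Is + (a+b)\<^sup>2 * Ip + (a*b)\<^sup>2 * Iu + IL - 2*a*b * Ip + 2 * IsL - 2*a*b * IQ"
    if "a\<^sup>2 * (1/4 * H) \<le> a\<^sup>2 * Ip" "1/4 * P \<le> Is" "9/4 * K \<le> P" "b * (2 * a + b) * IQ \<le> IL" "0 \<le> IsL"
    for Is Ip Iu IL IsL IQ H K P :: real
  proof -
    have "Is + (a+b)\<^sup>2 * Ip + (a*b)\<^sup>2 * Iu + IL - 2*a*b * Ip + 2 * IsL - 2*a*b * IQ
      = Is + a\<^sup>2 * Ip + b\<^sup>2 * (Ip + a\<^sup>2 * Iu + IQ) + (IL - b * (2 * a + b) * IQ) + 2 * IsL"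
      by (simp add: power2_eq_square algebra_simps)
    then show ?thesis using that by linarith
  qed
  show ?thesis
    unfolding T G by (rule arith[OF H1' H2 H3 lam s\<Lambda>])
qed

subsection \<open>Polar form of the Laplacian\<close>

lemma has_derivative_grad:
  fixes f :: "real^'n \<Rightarrow> real"
  assumes "f differentiable (at x)"
  shows "(f has_derivative (\<lambda>h. grad f x \<bullet> h)) (at x)"
proof -
  let ?D = "frechet_derivative f (at x)"
  have D: "(f has_derivative ?D) (at x)" using assms frechet_derivative_works by blast
  then have lin: "linear ?D" using has_derivative_linear by blast
  have "?D h = grad f x \<bullet> h" for h
  proof -
    have "?D h = ?D (\<Sum>i\<in>UNIV. h $ i *\<^sub>R axis i 1)"
      using basis_expansion[of h] by (simp add: scalar_mult_eq_scaleR)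
    also have "\<dots> = (\<Sum>i\<in>UNIV. h $ i * ?D (axis i 1))"
      by (simp add: linear_sum[OF lin] linear_scale[OF lin])
    also have "\<dots> = grad f x \<bullet> h"
      by (simp add: grad_def pderiv_dir_def inner_vec_def mult.commute)
    finally show ?thesis .
  qed
  then show ?thesis using D by (simp add: has_derivative_eq_rhs fun_eq_iff)
qed

text \<open>Off the closed set K the function vanishes in a neighbourhood. Applied twice, this
  confines the second partials to the support of the function.\<close>

lemma pderiv_dir_support:
  fixes f :: "real^'n \<Rightarrow> real"
  assumes K: "closed K" and f: "\<And>x. f x \<noteq> 0 \<Longrightarrow> x \<in> K" and "pderiv_dir f i x \<noteq> 0"
  shows "x \<in> K"
proof (rule ccontr)
  assume x: "x \<notin> K"
  have "(f has_derivative (\<lambda>h. 0)) (at x)"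
  proof (rule has_derivative_transform_within_open[of "\<lambda>_. 0" _ _ _ "- K"])
    show "open (- K)" using K by auto
    show "0 = f y" if "y \<in> - K" for y using f[of y] that by auto
  qed (use x in auto)
  then have "frechet_derivative f (at x) = (\<lambda>h. 0)" using frechet_derivative_at by metis
  with assms(3) show False by (simp add: pderiv_dir_def)
qed

lemma dil_derivative: "((\<lambda>t. dil t x) has_vector_derivative x) (at 0)"
  unfolding dil_def by (auto intro!: derivative_eq_intros simp: has_vector_derivative_def)

lemma rot_derivative:
  fixes x :: "real^'n"
  assumes "i \<noteq> j"
  shows "((\<lambda>t. rot i j t x) has_vector_derivative (x $ i *\<^sub>R axis j 1 - x $ j *\<^sub>R axis i 1)) (at 0)"
proof -
  have eq: "rot i j t x = x + (cos t - 1) *\<^sub>R (x $ i *\<^sub>R axis i 1 + x $ j *\<^sub>R axis j 1)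
     + sin t *\<^sub>R (x $ i *\<^sub>R axis j 1 - x $ j *\<^sub>R axis i 1)" for t
    using assms by (auto simp: rot_def vec_eq_iff axis_def algebra_simps)
  show ?thesis unfolding eq
    by (auto intro!: derivative_eq_intros simp: has_vector_derivative_def)
qed

lemma DERIV_along_curve:
  fixes f :: "'a::real_normed_vector \<Rightarrow> real"
  assumes f: "(f has_derivative D) (at x)" and c: "(c has_vector_derivative v) (at 0)" and c0: "c 0 = x"
  shows "((\<lambda>t. f (c t)) has_real_derivative D v) (at 0)"
proof -
  have lin: "linear D" using f has_derivative_linear by blast
  have "((\<lambda>t. f (c t)) has_derivative (\<lambda>s. D (s *\<^sub>R v))) (at 0)"
    using has_derivative_compose[of c _ 0 UNIV f D] c f c0 by (simp add: has_vector_derivative_def)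
  then show ?thesis unfolding has_field_derivative_def
    by (rule has_derivative_eq_rhs) (auto simp: linear_scale[OF lin] mult.commute)
qed

lemma grad_inner: "grad f x \<bullet> h = (\<Sum>i\<in>UNIV. pderiv_dir f i x * h $ i)"
  by (simp add: grad_def inner_vec_def)

lemma grad_inner_axis: "grad f x \<bullet> axis i 1 = pderiv_dir f i x"
  by (simp add: grad_def inner_axis)

definition rad1 :: "(real^'n \<Rightarrow> real) \<Rightarrow> real^'n \<Rightarrow> real" where
  "rad1 u x = x \<bullet> grad u x"

text \<open>E^2 u, that is, the derivative of \<open>rad1 u\<close> along dilations, written out so
  that its continuity can be read off from that of the partial derivatives.\<close>

definition rad2 :: "(real^'n \<Rightarrow> real) \<Rightarrow> real^'n \<Rightarrow> real" where
  "rad2 u x = rad1 u x + (\<Sum>i\<in>UNIV. \<Sum>j\<in>UNIV. x $ i * x $ j * pderiv_dir (pderiv_dir u i) j x)"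

definition ang1 :: "(real^'n \<Rightarrow> real) \<Rightarrow> 'n \<Rightarrow> 'n \<Rightarrow> real^'n \<Rightarrow> real" where
  "ang1 u i j x = x $ i * pderiv_dir u j x - x $ j * pderiv_dir u i x"

text \<open>L_ij^2 u, with the mixed partials in both orders as differentiation of
  \<open>ang1\<close> produces them. The diagonal is set apart because the formula would give - 2
  x_i d_i u there, whereas L_ii = 0.\<close>

definition ang2 :: "(real^'n \<Rightarrow> real) \<Rightarrow> 'n \<Rightarrow> 'n \<Rightarrow> real^'n \<Rightarrow> real" where
  "ang2 u i j x = (if i = j then 0 else
      (x $ i)\<^sup>2 * pderiv_dir (pderiv_dir u j) j x + (x $ j)\<^sup>2 * pderiv_dir (pderiv_dir u i) i x
      - x $ i * x $ j * pderiv_dir (pderiv_dir u j) i x - x $ i * x $ j * pderiv_dir (pderiv_dir u i) j x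
      - x $ i * pderiv_dir u i x - x $ j * pderiv_dir u j x)"

lemma rad1_sum: "rad1 u x = (\<Sum>i\<in>UNIV. x $ i * pderiv_dir u i x)"
  by (simp add: rad1_def grad_def inner_vec_def)

text \<open>Summed over all pairs, the off-diagonal formula of \<open>ang2\<close> gives 2 |x|^2
  times the Laplacian, minus twice the Hessian form in x, minus 2 n E u; the correction on the
  diagonal returns 2 E u. After halving, the rest is balanced by the Hessian form and the E u inside
  \<open>rad2\<close> together with (n - 2) E u.\<close>

lemma laplacian_polar:
  fixes u :: "real^'n \<Rightarrow> real"
  shows "(norm x)\<^sup>2 * laplacian u x = rad2 u x + (real CARD('n) - 2) * rad1 u x
     + (1/2) * (\<Sum>i\<in>UNIV. \<Sum>j\<in>UNIV. ang2 u i j x)"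
proof -
  let ?g = "\<lambda>i. pderiv_dir u i x" and ?h = "\<lambda>i j. pderiv_dir (pderiv_dir u i) j x"
  let ?H = "\<Sum>i\<in>UNIV. \<Sum>j\<in>UNIV. x $ i * x $ j * ?h i j"
  have nx: "(norm x)\<^sup>2 = (\<Sum>i\<in>UNIV. (x $ i)\<^sup>2)"
    unfolding power2_norm_eq_inner by (simp add: inner_vec_def power2_eq_square)
  have "ang2 u i j x = (x $ i)\<^sup>2 * ?h j j + (x $ j)\<^sup>2 * ?h i i - x $ i * x $ j * ?h j i - x $ i * x $ j * ?h i j
      - x $ i * ?g i - x $ j * ?g j + (if i = j then 2 * (x $ i * ?g i) else 0)" for i j
    by (auto simp: ang2_def power2_eq_square)
  then have "(\<Sum>i\<in>UNIV. \<Sum>j\<in>UNIV. ang2 u i j x)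
    = (\<Sum>i\<in>UNIV. \<Sum>j\<in>UNIV. (x $ i)\<^sup>2 * ?h j j) + (\<Sum>i\<in>UNIV. \<Sum>j\<in>UNIV. (x $ j)\<^sup>2 * ?h i i)
      - (\<Sum>i\<in>UNIV. \<Sum>j\<in>UNIV. x $ i * x $ j * ?h j i) - ?H
      - (\<Sum>i\<in>UNIV. \<Sum>j\<in>(UNIV::'n set). x $ i * ?g i) - (\<Sum>i\<in>(UNIV::'n set). \<Sum>j\<in>UNIV. x $ j * ?g j)
      + (\<Sum>i\<in>UNIV. \<Sum>j\<in>UNIV. if i = j then 2 * (x $ i * ?g i) else 0)"
    by (simp only: sum.distrib sum_subtractf)
  also have "(\<Sum>i\<in>UNIV. \<Sum>j\<in>UNIV. (x $ i)\<^sup>2 * ?h j j) = (norm x)\<^sup>2 * laplacian u x"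
    unfolding nx laplacian_def by (simp only: sum_product)
  also have "(\<Sum>i\<in>UNIV. \<Sum>j\<in>UNIV. (x $ j)\<^sup>2 * ?h i i) = (norm x)\<^sup>2 * laplacian u x"
    unfolding nx laplacian_def by (subst sum.swap) (simp only: sum_product)
  also have "(\<Sum>i\<in>UNIV. \<Sum>j\<in>UNIV. x $ i * x $ j * ?h j i) = ?H"
    by (subst sum.swap) (simp add: mult_ac)
  also have "(\<Sum>i\<in>UNIV. \<Sum>j\<in>(UNIV::'n set). x $ i * ?g i) = real CARD('n) * rad1 u x"
    by (simp add: rad1_sum sum_distrib_left)
  also have "(\<Sum>i\<in>(UNIV::'n set). \<Sum>j\<in>UNIV. x $ j * ?g j) = real CARD('n) * rad1 u x"
    by (simp add: rad1_sum)
  also have "(\<Sum>i\<in>UNIV. \<Sum>j\<in>UNIV. if i = j then 2 * (x $ i * ?g i) else 0) = 2 * rad1 u x"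
    by (simp add: rad1_sum sum_distrib_left)
  finally show ?thesis by (simp add: rad2_def algebra_simps)
qed

text \<open>Lagrange's identity. It links the angular energy to the gradient: |x|^2 |grad u|^2 is
  the square of E u plus this quantity.\<close>

lemma ang1_square_sum:
  fixes u :: "real^'n \<Rightarrow> real"
  shows "(1/2) * (\<Sum>i\<in>UNIV. \<Sum>j\<in>UNIV. (ang1 u i j x)\<^sup>2) = (norm x)\<^sup>2 * (norm (grad u x))\<^sup>2 - (x \<bullet> grad u x)\<^sup>2"
proof -
  let ?g = "\<lambda>i. pderiv_dir u i x"
  have nx: "(norm x)\<^sup>2 = (\<Sum>i\<in>UNIV. (x $ i)\<^sup>2)" and ng: "(norm (grad u x))\<^sup>2 = (\<Sum>i\<in>UNIV. (?g i)\<^sup>2)"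
    unfolding power2_norm_eq_inner by (simp_all add: inner_vec_def power2_eq_square grad_def)
  have "(ang1 u i j x)\<^sup>2 = (x $ i)\<^sup>2 * (?g j)\<^sup>2 + (x $ j)\<^sup>2 * (?g i)\<^sup>2 - 2 * ((x $ i * ?g i) * (x $ j * ?g j))" for i j
    by (simp add: ang1_def power2_eq_square algebra_simps)
  then have "(\<Sum>i\<in>UNIV. \<Sum>j\<in>UNIV. (ang1 u i j x)\<^sup>2)
    = (\<Sum>i\<in>UNIV. \<Sum>j\<in>UNIV. (x $ i)\<^sup>2 * (?g j)\<^sup>2) + (\<Sum>i\<in>UNIV. \<Sum>j\<in>UNIV. (x $ j)\<^sup>2 * (?g i)\<^sup>2)
      - 2 * (\<Sum>i\<in>UNIV. \<Sum>j\<in>UNIV. (x $ i * ?g i) * (x $ j * ?g j))"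
    by (simp only: sum.distrib sum_subtractf sum_distrib_left)
  also have "(\<Sum>i\<in>UNIV. \<Sum>j\<in>UNIV. (x $ i)\<^sup>2 * (?g j)\<^sup>2) = (norm x)\<^sup>2 * (norm (grad u x))\<^sup>2"
    unfolding nx ng by (simp only: sum_product)
  also have "(\<Sum>i\<in>UNIV. \<Sum>j\<in>UNIV. (x $ j)\<^sup>2 * (?g i)\<^sup>2) = (norm x)\<^sup>2 * (norm (grad u x))\<^sup>2"
    unfolding nx ng by (subst sum.swap) (simp only: sum_product)
  also have "(\<Sum>i\<in>UNIV. \<Sum>j\<in>UNIV. (x $ i * ?g i) * (x $ j * ?g j)) = (x \<bullet> grad u x)\<^sup>2"
    unfolding rad1_def[symmetric] rad1_sum power2_eq_square by (simp only: sum_product)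
  finally show ?thesis by simp
qed

text \<open>With N = n - 1 and m the spherical mean, expand the integral of (\<Lambda> + N (u -
  m))^2 \<ge> 0. The function \<Lambda> is orthogonal to radial functions and pairs with u to minus
  the integral of Q, while the Poincare inequality bounds N^2 times the integral of (u - m)^2 by N
  times that of Q. Of the resulting 2 N, one N is spent on this bound.\<close>

lemma angular_spectral_gap:
  fixes u :: "real^'n \<Rightarrow> real"
  assumes n: "CARD('n) \<ge> 2"
    and du: "\<And>x. (u has_derivative (\<lambda>h. gu x \<bullet> h)) (at x)" and cgu: "continuous_on UNIV gu"
    and agu: "annular (\<lambda>x. norm (gu x))"
    and l: "\<And>i j. rot.flow_deriv i j u (l i j)" and ll: "\<And>i j. rot.flow_deriv i j (l i j) (ll i j)"
    and Q: "\<And>x. Q x = (norm x)\<^sup>2 * (norm (gu x))\<^sup>2 - (x \<bullet> gu x)\<^sup>2"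
    and Ql: "\<And>x. Q x = (1/2) * (\<Sum>i\<in>UNIV. \<Sum>j\<in>UNIV. (l i j x)\<^sup>2)"
    and \<Lambda>: "\<And>x. \<Lambda> x = (1/2) * (\<Sum>i\<in>UNIV. \<Sum>j\<in>UNIV. ll i j x)"
  shows "(real CARD('n) - 1) * wint \<beta> Q \<le> wint \<beta> (\<lambda>x. (\<Lambda> x)\<^sup>2)"
proof -
  let ?N = "real CARD('n) - 1"
  have tu: "test_fun u" using l[of undefined undefined] by (simp add: rot.flow_deriv_def)
  have tl: "test_fun (l i j)" "test_fun (ll i j)" for i j using ll[of i j] by (auto simp: rot.flow_deriv_def)
  have t\<Lambda>: "test_fun \<Lambda>" unfolding \<Lambda>[abs_def] by (intro test_fun_cmult test_fun_sum tl)
  obtain m where mm: "m \<in> borel_measurable borel" and bm: "bdd_annular (\<lambda>x::real^'n. m (norm x))"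
    and poin: "?N * wint \<beta> (\<lambda>x. (u x - m (norm x))\<^sup>2) \<le> wint \<beta> Q"
    by (rule spherical_poincare[OF n du cgu _ agu Q]) (use tu in \<open>simp add: test_fun_def\<close>)
  note pairing = wint_times_sum2[OF _ test_fun_bdd_annular[OF tl(2)] \<Lambda>]
  \<comment> \<open>\<open>m (norm x)\<close> is rotation invariant, so its correlation with the
    rotated \<open>l i j\<close> is constant in t and has derivative 0.\<close>
  have m\<Lambda>: "wint \<beta> (\<lambda>x. m (norm x) * \<Lambda> x) = 0"
  proof -
    have "wint \<beta> (\<lambda>x. m (norm x) * ll i j x) = 0" for i j
    proof -
      obtain C where C: "\<And>x::real^'n. \<bar>m (norm x)\<bar> \<le> C" using bm unfolding bdd_annular_def by blast
      have mn: "(\<lambda>x::real^'n. m (norm x)) \<in> borel_measurable borel" using bm unfolding bdd_annular_def by blast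
      have "((\<lambda>t. wint \<beta> (\<lambda>x. m (norm x) * l i j (rot i j t x))) has_real_derivative wint \<beta> (\<lambda>x. m (norm x) * ll i j x)) (at 0)"
        by (rule rot.flow_deriv_wint_0[OF ll mn C])
      moreover have "wint \<beta> (\<lambda>x. m (norm x) * l i j (rot i j t x)) = wint \<beta> (\<lambda>x. m (norm x) * l i j x)" for t
        using wint_rot[of "\<lambda>x. m (norm x) * l i j x" \<beta> i j t] mn test_fun_measurable[OF tl(1)]
        by (simp add: norm_rot)
      ultimately have "((\<lambda>t::real. wint \<beta> (\<lambda>x. m (norm x) * l i j x)) has_real_derivative wint \<beta> (\<lambda>x. m (norm x) * ll i j x)) (at 0)"
        by simp
      then show ?thesis using DERIV_unique[OF _ DERIV_const] by blast
    qed
    then show ?thesis by (simp add: pairing[OF bm])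
  qed
  note u\<Lambda> = wint_angular_parts[OF l ll \<Lambda> Ql]
  have bu: "bdd_annular u" "bdd_annular \<Lambda>" using tu t\<Lambda> test_fun_bdd_annular by auto
  have bd: "bdd_annular (\<lambda>x. (u x - m (norm x))\<^sup>2)" by (intro bdd_annular_power2 bdd_annular_diff bu bm)
  have "0 \<le> wint \<beta> (\<lambda>x. (\<Lambda> x + ?N * (u x - m (norm x)))\<^sup>2)" by (rule wint_nonneg) simp
  also have "(\<lambda>x. (\<Lambda> x + ?N * (u x - m (norm x)))\<^sup>2)
    = (\<lambda>x. \<Lambda> x * \<Lambda> x + (2 * ?N) * (u x * \<Lambda> x) - (2 * ?N) * (m (norm x) * \<Lambda> x) + ?N\<^sup>2 * (u x - m (norm x))\<^sup>2)"
  proof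
    have "(s + c * (v - w))\<^sup>2 = s * s + (2 * c) * (v * s) - (2 * c) * (w * s) + c\<^sup>2 * (v - w)\<^sup>2" for s c v w :: real
      by (simp add: power2_eq_square algebra_simps)
    then show "(\<Lambda> x + ?N * (u x - m (norm x)))\<^sup>2
      = \<Lambda> x * \<Lambda> x + (2 * ?N) * (u x * \<Lambda> x) - (2 * ?N) * (m (norm x) * \<Lambda> x) + ?N\<^sup>2 * (u x - m (norm x))\<^sup>2" for x .
  qed
  also have "wint \<beta> \<dots> = wint \<beta> (\<lambda>x. \<Lambda> x * \<Lambda> x) + (2 * ?N) * wint \<beta> (\<lambda>x. u x * \<Lambda> x)
     - (2 * ?N) * wint \<beta> (\<lambda>x. m (norm x) * \<Lambda> x) + ?N\<^sup>2 * wint \<beta> (\<lambda>x. (u x - m (norm x))\<^sup>2)"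
    by (simp only: wint_add wint_diff wint_cmult bdd_annular_add bdd_annular_diff bdd_annular_cmult bdd_annular_mult bu bm bd)
  also have "\<dots> = wint \<beta> (\<lambda>x. (\<Lambda> x)\<^sup>2) - 2 * ?N * wint \<beta> Q + ?N * (?N * wint \<beta> (\<lambda>x. (u x - m (norm x))\<^sup>2))"
    unfolding u\<Lambda> m\<Lambda> by (simp add: power2_eq_square)
  also have "\<dots> \<le> wint \<beta> (\<lambda>x. (\<Lambda> x)\<^sup>2) - 2 * ?N * wint \<beta> Q + ?N * wint \<beta> Q"
    using mult_left_mono[OF poin, of ?N] n by simp
  finally show ?thesis by (simp add: algebra_simps)
qed

theorem theorem1p5:
  fixes u :: "real^'n \<Rightarrow> real" and \<alpha> :: real
  assumes "CARD('n) \<ge> 2"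
    and "\<bar>3 * \<alpha> + 4 + real CARD('n)\<bar> \<le> 2 * sqrt ((real CARD('n))\<^sup>2 - real CARD('n) + 1)"
    and "C2c (ball 0 1 - {0}) u"
  shows "wnorm2 \<alpha> (laplacian u) \<ge>
           (real CARD('n) + \<alpha>)\<^sup>2 / 4 * wnorm2 (\<alpha> + 2) (grad u)
         + (real CARD('n) - 4 - \<alpha>)\<^sup>2 / 16 * wnorm2 (\<alpha> + 4) (\<lambda>x. u x / ln (norm x))
         + 9 / 16 * wnorm2 (\<alpha> + 4) (\<lambda>x. u x / (ln (norm x))\<^sup>2)"
proof -
  note n = assms(1) and hyp = assms(2) and C2c = assms(3)
  let ?n = "real CARD('n)"
  let ?g = "\<lambda>i. pderiv_dir u i" and ?h = "\<lambda>i j. pderiv_dir (pderiv_dir u i) j"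
  define K where "K = closure {x. u x \<noteq> 0}"
  have diffu: "u differentiable (at x)" and diffg: "?g i differentiable (at x)"
    and ch: "continuous_on S (?h i j)" for x i j S
    using C2c continuous_on_subset unfolding C2c_def C2_def by blast+
  have K: "compact K" "K \<subseteq> ball 0 1 - {0}" using C2c unfolding C2c_def K_def by auto
  have Kc: "closed K" by (simp add: K_def)
  have uK: "u x \<noteq> 0 \<Longrightarrow> x \<in> K" for x unfolding K_def using closure_subset[of "{x. u x \<noteq> 0}"] by auto
  have gK: "?g i x \<noteq> 0 \<Longrightarrow> x \<in> K" for x i by (rule pderiv_dir_support[OF Kc uK])
  have hK: "?h i j x \<noteq> 0 \<Longrightarrow> x \<in> K" for x i j by (rule pderiv_dir_support[OF Kc gK])
  \<comment> \<open>Compactness of the support leaves a gap both at the origin and at the unit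
    sphere.\<close>
  obtain d R where d: "d > 0" "R < 1" "\<And>x. x \<in> K \<Longrightarrow> d \<le> norm x \<and> norm x \<le> R"
  proof -
    obtain d where d: "d > 0" "\<And>x. x \<in> K \<Longrightarrow> d \<le> norm x"
      using separate_point_closed[OF Kc, of 0] K(2) by auto
    have "\<exists>R<1. \<forall>x\<in>K. norm x \<le> R"
    proof (cases "K = {}")
      case True then show ?thesis by (intro exI[of _ 0]) auto
    next
      case False
      have "continuous_on K norm" by (intro continuous_intros)
      then obtain y where "y \<in> K" "\<And>x. x \<in> K \<Longrightarrow> norm x \<le> norm y"
        using continuous_attains_sup[OF K(1) False] by blast
      then show ?thesis using K(2) by (intro exI[of _ "norm y"]) auto
    qed
    then show thesis using that d by blast
  qed
  have ua: "unit_annular f" if "\<And>x. f x \<noteq> 0 \<Longrightarrow> x \<in> K" for f :: "real^'n \<Rightarrow> real"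
    unfolding unit_annular_def using d that by blast
  have tf: "test_fun f" if "continuous_on UNIV f" "\<And>x. f x \<noteq> 0 \<Longrightarrow> x \<in> K" for f :: "real^'n \<Rightarrow> real"
    unfolding test_fun_def using that unit_annular_annular[OF ua] by blast
  have du: "(u has_derivative (\<lambda>h. grad u x \<bullet> h)) (at x)" for x by (rule has_derivative_grad[OF diffu])
  have dg: "(?g i has_derivative (\<lambda>h. grad (?g i) x \<bullet> h)) (at x)" for x i by (rule has_derivative_grad[OF diffg])
  have cu: "continuous_on S u" and cg: "continuous_on S (?g i)" for S i
    by (intro continuous_at_imp_continuous_on ballI differentiable_imp_continuous_within diffu diffg)+
  note [continuous_intros] = cu cg ch
  have K1: "rad1 u x \<noteq> 0 \<Longrightarrow> x \<in> K" for x
  proof (rule ccontr)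
    assume "rad1 u x \<noteq> 0" "x \<notin> K"
    then have "?g i x = 0" for i using gK[of i x] by blast
    with \<open>rad1 u x \<noteq> 0\<close> show False by (simp add: rad1_sum)
  qed
  have K2: "rad2 u x \<noteq> 0 \<Longrightarrow> x \<in> K" for x
  proof (rule ccontr)
    assume "rad2 u x \<noteq> 0" "x \<notin> K"
    then have "?h i j x = 0" "rad1 u x = 0" for i j using hK[of i j x] K1[of x] by blast+
    with \<open>rad2 u x \<noteq> 0\<close> show False by (simp add: rad2_def)
  qed
  have K3: "ang1 u i j x \<noteq> 0 \<Longrightarrow> x \<in> K" for x i j
  proof (rule ccontr)
    assume "ang1 u i j x \<noteq> 0" "x \<notin> K"
    then have "?g i x = 0" for i using gK[of i x] by blast
    with \<open>ang1 u i j x \<noteq> 0\<close> show False by (simp add: ang1_def)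
  qed
  have K4: "ang2 u i j x \<noteq> 0 \<Longrightarrow> x \<in> K" for x i j
  proof (rule ccontr)
    assume "ang2 u i j x \<noteq> 0" "x \<notin> K"
    then have "?h i j x = 0" "?g i x = 0" for i j using hK[of i j x] gK[of i x] by blast+
    with \<open>ang2 u i j x \<noteq> 0\<close> show False by (simp add: ang2_def split: if_splits)
  qed
  have t0: "test_fun u" by (rule tf[OF cu uK])
  have t1: "test_fun (rad1 u)" by (rule tf[OF _ K1]) (auto simp: rad1_sum[abs_def] intro!: continuous_intros)
  have t2: "test_fun (rad2 u)" by (rule tf[OF _ K2]) (auto simp: rad2_def[abs_def] rad1_sum[abs_def] intro!: continuous_intros)
  have t3: "test_fun (ang1 u i j)" for i j by (rule tf[OF _ K3]) (auto simp: ang1_def[abs_def] intro!: continuous_intros)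
  have t4: "test_fun (ang2 u i j)" for i j
    by (rule tf[OF _ K4]) (cases "i = j"; auto simp: ang2_def[abs_def] intro!: continuous_intros)
  have dcomp: "((\<lambda>x. x $ i) has_derivative (\<lambda>h. h $ i)) (at x)" for i and x :: "real^'n"
    by (rule bounded_linear_imp_has_derivative[OF bounded_linear_vec_nth])
  have f1: "dil.flow_deriv u (rad1 u)"
    unfolding dil.flow_deriv_def
  proof (intro conjI allI t0 t1)
    fix x
    show "((\<lambda>t. u (dil t x)) has_real_derivative rad1 u x) (at 0)"
      using DERIV_along_curve[OF du dil_derivative[of x]] by (simp add: dil_def rad1_def inner_commute)
  qed
  have f2: "dil.flow_deriv (rad1 u) (rad2 u)"
    unfolding dil.flow_deriv_def
  proof (intro conjI allI t1 t2)
    fix x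
    have "(rad1 u has_derivative (\<lambda>h. \<Sum>i\<in>UNIV. x $ i * (grad (?g i) x \<bullet> h) + h $ i * ?g i x)) (at x)"
      unfolding rad1_sum[abs_def] by (intro has_derivative_sum has_derivative_mult dcomp dg)
    from DERIV_along_curve[OF this dil_derivative[of x]]
    have "((\<lambda>t. rad1 u (dil t x)) has_real_derivative (\<Sum>i\<in>UNIV. x $ i * (grad (?g i) x \<bullet> x) + x $ i * ?g i x)) (at 0)"
      by (simp add: dil_def)
    also have "(\<Sum>i\<in>UNIV. x $ i * (grad (?g i) x \<bullet> x) + x $ i * ?g i x) = rad2 u x"
      by (simp add: rad2_def rad1_sum sum.distrib grad_inner sum_distrib_left mult_ac)
    finally show "((\<lambda>t. rad1 u (dil t x)) has_real_derivative rad2 u x) (at 0)" .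
  qed
  have f3: "rot.flow_deriv i j u (ang1 u i j)" for i j
    unfolding rot.flow_deriv_def
  proof (intro conjI allI t0 t3)
    fix x
    show "((\<lambda>t. u (rot i j t x)) has_real_derivative ang1 u i j x) (at 0)"
    proof (cases "i = j")
      case True then show ?thesis by (simp add: rot_def ang1_def)
    next
      case False
      from DERIV_along_curve[OF du rot_derivative[OF False, of x]]
      show ?thesis by (simp add: rot.flow_0 ang1_def inner_diff_right grad_inner_axis)
    qed
  qed
  have f4: "rot.flow_deriv i j (ang1 u i j) (ang2 u i j)" for i j
    unfolding rot.flow_deriv_def
  proof (intro conjI allI t3 t4)
    fix x
    show "((\<lambda>t. ang1 u i j (rot i j t x)) has_real_derivative ang2 u i j x) (at 0)"
    proof (cases "i = j")
      case True then show ?thesis by (simp add: rot_def ang1_def ang2_def)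
    next
      case False
      have "(ang1 u i j has_derivative (\<lambda>h. (x $ i * (grad (?g j) x \<bullet> h) + h $ i * ?g j x)
         - (x $ j * (grad (?g i) x \<bullet> h) + h $ j * ?g i x))) (at x)"
        unfolding ang1_def[abs_def] by (intro has_derivative_diff has_derivative_mult dcomp dg)
      from DERIV_along_curve[OF this rot_derivative[OF False, of x] rot.flow_0]
      show ?thesis
      proof (rule DERIV_cong)
        have "(x $ i *\<^sub>R axis j 1 - x $ j *\<^sub>R axis i 1 :: real^'n) $ i = - x $ j"
          "(x $ i *\<^sub>R axis j 1 - x $ j *\<^sub>R axis i 1 :: real^'n) $ j = x $ i"
          using False by (simp_all add: axis_def)
        then show "(x $ i * (grad (?g j) x \<bullet> (x $ i *\<^sub>R axis j 1 - x $ j *\<^sub>R axis i 1))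
            + (x $ i *\<^sub>R axis j 1 - x $ j *\<^sub>R axis i 1) $ i * ?g j x)
         - (x $ j * (grad (?g i) x \<bullet> (x $ i *\<^sub>R axis j 1 - x $ j *\<^sub>R axis i 1))
            + (x $ i *\<^sub>R axis j 1 - x $ j *\<^sub>R axis i 1) $ j * ?g i x) = ang2 u i j x"
          using False by (simp only: inner_diff_right inner_scaleR_right grad_inner_axis)
            (simp add: ang2_def power2_eq_square algebra_simps)
      qed
    qed
  qed
  define \<beta> where "\<beta> = \<alpha> + 4"
  define a where "a = (\<alpha> + 4 - ?n) / 2"
  define b where "b = (?n + \<alpha>) / 2"
  define \<Lambda> where "\<Lambda> x = (1/2) * (\<Sum>i\<in>UNIV. \<Sum>j\<in>UNIV. ang2 u i j x)" for x
  define Q where "Q x = (1/2) * (\<Sum>i\<in>UNIV. \<Sum>j\<in>UNIV. (ang1 u i j x)\<^sup>2)" for x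
  have Qg: "Q x = (norm x)\<^sup>2 * (norm (grad u x))\<^sup>2 - (x \<bullet> grad u x)\<^sup>2" for x
    unfolding Q_def by (rule ang1_square_sum)
  have cgrad: "continuous_on UNIV (grad u)"
    unfolding grad_def[abs_def] by (intro continuous_on_vec_lambda cg)
  have agrad: "annular (\<lambda>x. norm (grad u x))"
  proof (rule unit_annular_annular[OF ua])
    fix x assume "norm (grad u x) \<noteq> 0"
    then have "\<exists>i. ?g i x \<noteq> 0" by (auto simp: grad_def vec_eq_iff)
    then show "x \<in> K" using gK by blast
  qed
  have gap: "(?n - 1) * wint \<beta> Q \<le> wint \<beta> (\<lambda>x. (\<Lambda> x)\<^sup>2)"
    by (rule angular_spectral_gap[OF n du cgrad agrad f3 f4 Qg Q_def \<Lambda>_def])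
  \<comment> \<open>The identity 12 (n - 1 - b (2 a + b)) = 4 (n^2 - n + 1) - (3 \<alpha> + 4 + n)^2
    makes this equivalent to the squared hypothesis.\<close>
  have cond: "b * (2 * a + b) \<le> ?n - 1"
  proof -
    have pos: "?n\<^sup>2 - ?n + 1 \<ge> 0"
    proof -
      have "?n * 1 \<le> ?n * ?n" using n by (intro mult_left_mono) auto
      then show ?thesis by (simp add: power2_eq_square)
    qed
    have "(3 * \<alpha> + 4 + ?n)\<^sup>2 \<le> (2 * sqrt (?n\<^sup>2 - ?n + 1))\<^sup>2"
      using power_mono[OF hyp, of 2] by simp
    also have "\<dots> = 4 * (?n\<^sup>2 - ?n + 1)" using pos by (simp add: power_mult_distrib)
    finally show ?thesis
      unfolding a_def b_def by (simp add: power2_eq_square field_simps)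
  qed
  have a2: "2 * a = \<beta> - ?n" by (simp add: a_def \<beta>_def)
  have core: "wint \<beta> (\<lambda>x. (rad2 u x + (b - a) * rad1 u x + \<Lambda> x)\<^sup>2)
    \<ge> b\<^sup>2 * wint \<beta> (\<lambda>x. (rad1 u x)\<^sup>2 + Q x)
      + a\<^sup>2 / 4 * wint \<beta> (\<lambda>x. (u x * inverse (ln (norm x)))\<^sup>2)
      + 9 / 16 * wint \<beta> (\<lambda>x. (u x * (inverse (ln (norm x)))\<^sup>2)\<^sup>2)"
    by (rule rellich_core[OF f1 f2 ua[OF uK] ua[OF K1] ua[OF K2] f3 f4 a2 \<Lambda>_def Q_def gap cond])
  \<comment> \<open>Moves k powers of |x| from the weight into the integrand. It holds at the origin
    too, where both sides are 0, so the integrands below agree pointwise.\<close>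
  have pw: "norm x powr (-s) = (norm x) ^ k * norm x powr (- (s + real k))" for x :: "real^'n" and s k
  proof (cases "x = 0")
    case False
    then have "norm x powr real k * norm x powr (- (s + real k)) = norm x powr (-s)"
      by (simp add: powr_add[symmetric])
    then show ?thesis using False by (simp add: powr_realpow)
  qed simp
  have ba: "b - a = ?n - 2" by (simp add: a_def b_def field_simps)
  have "wnorm2 \<alpha> (laplacian u) = wint \<beta> (\<lambda>x. (rad2 u x + (b - a) * rad1 u x + \<Lambda> x)\<^sup>2)"
    unfolding wnorm2_def wint_def
  proof (rule arg_cong[where f="integral\<^sup>L lborel"], rule ext)
    fix x
    have e: "rad2 u x + (b - a) * rad1 u x + \<Lambda> x = (norm x)\<^sup>2 * laplacian u x"
      unfolding ba \<Lambda>_def using laplacian_polar[of x u] by simp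
    show "(norm (laplacian u x))\<^sup>2 * norm x powr (-\<alpha>) = (rad2 u x + (b - a) * rad1 u x + \<Lambda> x)\<^sup>2 * norm x powr (-\<beta>)"
      unfolding e using pw[of x \<alpha> 4] by (simp add: \<beta>_def power_mult_distrib)
  qed
  moreover have "wnorm2 (\<alpha> + 2) (grad u) = wint \<beta> (\<lambda>x. (rad1 u x)\<^sup>2 + Q x)"
    unfolding wnorm2_def wint_def
  proof (rule arg_cong[where f="integral\<^sup>L lborel"], rule ext)
    fix x
    have e: "(rad1 u x)\<^sup>2 + Q x = (norm x)\<^sup>2 * (norm (grad u x))\<^sup>2"
      by (simp add: Qg rad1_def)
    show "(norm (grad u x))\<^sup>2 * norm x powr (-(\<alpha>+2)) = ((rad1 u x)\<^sup>2 + Q x) * norm x powr (-\<beta>)"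
    proof -
      have "\<alpha> + 2 + real 2 = \<beta>" by (simp add: \<beta>_def)
      then have "norm x powr (-(\<alpha>+2)) = (norm x)\<^sup>2 * norm x powr (-\<beta>)"
        using pw[of x "\<alpha> + 2" 2] by (simp only:)
      then show ?thesis unfolding e by (simp only: mult_ac)
    qed
  qed
  moreover have "wnorm2 (\<alpha> + 4) (\<lambda>x. u x / ln (norm x)) = wint \<beta> (\<lambda>x. (u x * inverse (ln (norm x)))\<^sup>2)"
    by (simp add: wnorm2_def wint_def \<beta>_def divide_inverse)
  moreover have "wnorm2 (\<alpha> + 4) (\<lambda>x. u x / (ln (norm x))\<^sup>2) = wint \<beta> (\<lambda>x. (u x * (inverse (ln (norm x)))\<^sup>2)\<^sup>2)"
    by (simp add: wnorm2_def wint_def \<beta>_def divide_inverse power_inverse)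
  moreover have "b\<^sup>2 = (?n + \<alpha>)\<^sup>2 / 4" "a\<^sup>2 / 4 = (?n - 4 - \<alpha>)\<^sup>2 / 16"
    by (simp_all add: a_def b_def power2_eq_square field_simps)
  ultimately show ?thesis using core by (simp only:)
qed

end
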